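(* Suppose the weight sequence $\mathbf{w}$ has type II or III, and let $v_0$ be a uniformly random vertex of $\mathcal{T}_n$. Let $\bar{\mathcal{T}}^*$ denote the pointed fringe subtree of $\mathcal{T}^*$ at its unique vertex of infinite outdegree. Then $$H(\mathcal{T}_n,v_0,\Omega_n)\to\bar{\mathcal{T}}^*$$ in distribution in $\mathfrak{T}^\bullet$.
   Context: A weight sequence $\mathbf{w}=(\omega_k)_{k\ge0}$ consists of non-negative reals with $\omega_0>0$ and $\omega_k>0$ for some $k\ge2$; $\mathcal{T}_n$ is the random plane tree with $n$ vertices drawn with probability proportional to $\prod_v\omega_{d^+(v)}$ ($n\equiv1\bmod\gcd\{i:\omega_i>0\}$). Let $\phi(z)=\sum_k\omega_kz^k$ with radius $\rho_\phi$, $\psi(t)=t\phi'(t)/\phi(t)$ and $\nu=\lim_{t\nearrow\rho_\phi}\psi(t)$ when $\rho_\phi>0$. Type II: $\rho_\phi>0$, $0<\nu<1$, $\tau:=\rho_\phi$. Type III: $\rho_\phi=0$, $\tau:=\nu:=0$. $\xi$ has law $\Pr{\xi=k}=\tau^k\omega_k/\phi(\tau)$, $\mu=\mathbb{E}\xi=\min(\nu,1)$, $\mathcal{T}$ is a Galton–Watson tree with offspring $\xi$, $\hat\xi\in\mathbb{N}\cup\{\infty\}$ has $\Pr{\hat\xi=k}=k\Pr{\xi=k}$, $\Pr{\hat\xi=\infty}=1-\mu$. Let $N_k$ be the number of vertices of $\mathcal{T}_n$ with outdegree $k$. $(\Omega_n)$ is a fixed deterministic sequence with $\Omega_n\to\infty$,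 $\Omega_n=o(n)$, such that for every sequence $K_n\to\infty$ with $K_n\le\Omega_n$ one has $\sum_{k\le K_n}kN_k=\mu n+o_p(n)$ and $\sum_{k>K_n}kN_k=(1-\mu)n+o_p(n)$ (such a sequence exists). Space $\mathfrak{T}^\bullet$: pointed plane trees (possibly infinite, with possibly infinite outdegrees) are encoded as families of outdegrees indexed by the vertices of a universal tree $\mathcal{U}^\bullet_\infty$ with a backward spine $u_0,u_1,\dots$ ($u_i$ parent of $u_{i-1}$; pointed vertex $u_0$); non-spine vertices get values in $\overline{\mathbb{N}}_0=\mathbb{N}_0\cup\{\infty\}$, and $u_i$ ($i\ge1$) gets a value in $\{*\}\sqcup(\overline{\mathbb{N}}_0\times\overline{\mathbb{N}}_0)$ (numbers of children left/right of $u_{i-1}$, or $*$ if absent); one-point compactification on $\overline{\mathbb{N}}_0$, product topology. For a pointed tree $(T,v)$ and an ancestor $a$ of $v$, the pointed fringe subtree $f^\bullet((T,v),a)$ is the subtree of $T$ consisting of $a$ and its descendants, rooted at $a$ and pointed at $v$. $H(\mathcal{T}_n,v_0,\Omega_n)$ is the pointed fringe subtree of $(\mathcal{T}_n,v_0)$ at the youngest (closest) ancestor of $v_0$ having outdegree $>\Omega_n$, and equals a placeholder $\diamond$ if no such ancestor exists. $\mathcal{T}^*$: $u_0$ is the root of an independent copy of $\mathcal{T}$; for $i=1,2,\dots$, $u_i$ receives offspring according to an independent copy $\hat\xi_i$ of $\hat\xi$, a uniformly chosen child is $u_{i-1}$, all others are roots of independent copies of $\mathcal{T}$ (if $\hat\xi_i=\infty$,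 infinitely many children on both sides of $u_{i-1}$). With $i_1<i_2$ the first two indices with $\hat\xi_i=\infty$, the construction stops and $u_{i_2-1}$ is the root; $u_{i_1}$ is the unique vertex of infinite degree. *)

theory Defs
  imports "HOL-Analysis.Analysis" "HOL-Probability.Probability"
begin

section \<open>Finite plane trees, pointed at Ulam-Harris paths\<close>

datatype ptree = Node "ptree list"

fun kids :: "ptree \<Rightarrow> ptree list" where
  "kids (Node ts) = ts"

definition outdeg :: "ptree \<Rightarrow> nat" where
  "outdeg t = length (kids t)"

text \<open>Subtree at a path (list of 0-based child indices); None if the vertex does not exist.\<close>
fun subt :: "ptree \<Rightarrow> nat list \<Rightarrow> ptree option" where
  "subt t [] = Some t"
| "subt t (i # p) = (if i < length (kids t) then subt (kids t ! i) p else None)"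

definition verts :: "ptree \<Rightarrow> nat list set" where
  "verts t = {p. subt t p \<noteq> None}"

fun nv :: "ptree \<Rightarrow> nat" where
  "nv (Node ts) = 1 + sum_list (map nv ts)"

text \<open>Weight of a tree: product over vertices of w(outdegree).\<close>
fun wt :: "(nat \<Rightarrow> real) \<Rightarrow> ptree \<Rightarrow> real" where
  "wt w (Node ts) = w (length ts) * prod_list (map (wt w) ts)"

text \<open>Number of vertices with outdegree k.\<close>
definition Nk :: "ptree \<Rightarrow> nat \<Rightarrow> real" where
  "Nk t k = real (card {p \<in> verts t. outdeg (the (subt t p)) = k})"

text \<open>The simply generated tree T_n.\<close>
definition Zn :: "(nat \<Rightarrow> real) \<Rightarrow> nat \<Rightarrow> real" where
  "Zn w n = (\<Sum>t\<in>{t. nv t = n}. wt w t)"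

definition Tn :: "(nat \<Rightarrow> real) \<Rightarrow> nat \<Rightarrow> ptree pmf" where
  "Tn w n = embed_pmf (\<lambda>t. if nv t = n then wt w t / Zn w n else 0)"

text \<open>T_n together with a uniformly random vertex v_0.\<close>
definition pointedTn :: "(nat \<Rightarrow> real) \<Rightarrow> nat \<Rightarrow> (ptree \<times> nat list) pmf" where
  "pointedTn w n = bind_pmf (Tn w n) (\<lambda>t. map_pmf (\<lambda>p. (t, p)) (pmf_of_set (verts t)))"

section \<open>The space of pointed trees\<close>

text \<open>Vertices of the universal pointed tree U^bullet_infinity:
  Sp i           = spine vertex u_(i+1);
  Dn xs          = the descendant of u_0 at Ulam word xs (Dn [] = u_0);
  Sd i l m xs    = the descendant at word xs of the (m+1)-th child of u_(i+1)
                   to the left (l = True) resp. right (l = False) of u_i.\<close>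
datatype uvert = Sp nat | Dn "nat list" | Sd nat bool nat "nat list"

text \<open>Values: Deg d (outdegree in N_0 \<union> {\<infinity>}), Star (absent spine vertex),
  SPair a b (numbers of children left/right of the spine child).\<close>
datatype tval = Deg enat | Star | SPair enat enat

text \<open>Topology: disjoint union of N0bar, {*}, N0bar x N0bar, where N0bar = enat
  carries its order topology, i.e. the one-point compactification of N_0.\<close>
instantiation tval :: topological_space
begin
definition open_tval :: "tval set \<Rightarrow> bool" where
  "open_tval S \<longleftrightarrow> open (Deg -` S) \<and> open ((\<lambda>(a, b). SPair a b) -` S)"
instance
proof
  show "open (UNIV :: tval set)" by (simp add: open_tval_def)
next
  fix S T :: "tval set" assume "open S" "open T"
  then show "open (S \<inter> T)" by (auto simp: open_tval_def vimage_Int)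
next
  fix K :: "tval set set" assume "\<forall>S\<in>K. open S"
  then show "open (\<Union>K)" by (auto simp: open_tval_def vimage_Union intro!: open_UN)
qed
end

text \<open>The space frak T^bullet (product topology inherited from the function type).\<close>
definition TS :: "(uvert \<Rightarrow> tval) set" where
  "TS = {f. (\<forall>xs. f (Dn xs) \<in> range Deg) \<and> (\<forall>i l m xs. f (Sd i l m xs) \<in> range Deg)
            \<and> (\<forall>i. f (Sp i) \<noteq> Star \<longrightarrow> f (Sp i) \<in> range (\<lambda>(a, b). SPair a b))}"

definition degv :: "ptree \<Rightarrow> nat list \<Rightarrow> tval" where
  "degv t p = (case subt t p of Some s \<Rightarrow> Deg (enat (outdeg s)) | None \<Rightarrow> Deg 0)"

text \<open>Encoding of a finite pointed plane tree (t, q) (q a vertex of t).\<close>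
definition enc :: "ptree \<Rightarrow> nat list \<Rightarrow> uvert \<Rightarrow> tval" where
  "enc t q v = (case v of
      Dn xs \<Rightarrow> degv t (q @ xs)
    | Sp i \<Rightarrow> (if i + 1 \<le> length q then
                 (let par = take (length q - (i + 1)) q; k = q ! (length q - (i + 1));
                      d = outdeg (the (subt t par))
                  in SPair (enat k) (enat (d - 1 - k)))
               else Star)
    | Sd i l m xs \<Rightarrow> (if i + 1 \<le> length q then
                 (let par = take (length q - (i + 1)) q; k = q ! (length q - (i + 1));
                      d = outdeg (the (subt t par))
                  in if l then (if m + 1 \<le> k then degv t (par @ [k - (m + 1)] @ xs) else Deg 0)
                     else (if k + m + 1 < d then degv t (par @ [k + m + 1] @ xs) else Deg 0))
               else Deg 0))"

text \<open>H(T, v, Omega): pointed fringe subtree at the youngest proper ancestor of v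
  with outdegree > Omega; None plays the role of the placeholder diamond.\<close>
definition Hfr :: "ptree \<Rightarrow> nat list \<Rightarrow> real \<Rightarrow> (uvert \<Rightarrow> tval) option" where
  "Hfr t p Om = (let J = {j. j < length p \<and> real (outdeg (the (subt t (take j p)))) > Om}
                 in if J = {} then None
                    else Some (enc (the (subt t (take (Max J) p))) (drop (Max J) p)))"

section \<open>Weight sequences\<close>

definition phi :: "(nat \<Rightarrow> real) \<Rightarrow> real \<Rightarrow> real" where
  "phi w t = (\<Sum>k. w k * t ^ k)"

definition psi :: "(nat \<Rightarrow> real) \<Rightarrow> real \<Rightarrow> real" where
  "psi w t = t * deriv (phi w) t / phi w t"

definition weight_seq :: "(nat \<Rightarrow> real) \<Rightarrow> bool" where
  "weight_seq w \<longleftrightarrow> (\<forall>k. 0 \<le> w k) \<and> 0 < w 0 \<and> (\<exists>k\<ge>2. 0 < w k)"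

text \<open>Type II with tau = rho_phi (rho_phi is necessarily finite here, see NOTES).\<close>
definition typeII :: "(nat \<Rightarrow> real) \<Rightarrow> real \<Rightarrow> bool" where
  "typeII w \<tau> \<longleftrightarrow> conv_radius w = ereal \<tau> \<and> 0 < \<tau> \<and>
     (\<exists>\<nu>. (psi w \<longlongrightarrow> \<nu>) (at_left \<tau>) \<and> 0 < \<nu> \<and> \<nu> < 1)"

definition typeIII :: "(nat \<Rightarrow> real) \<Rightarrow> bool" where
  "typeIII w \<longleftrightarrow> conv_radius w = 0"

definition span :: "(nat \<Rightarrow> real) \<Rightarrow> nat" where
  "span w = Gcd {i. 0 < w i}"

text \<open>Filter: n \<rightarrow> \<infinity> along n \<equiv> 1 mod span.\<close>
definition admF :: "(nat \<Rightarrow> real) \<Rightarrow> nat filter" where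
  "admF w = inf sequentially (principal {n. n mod span w = 1 mod span w})"

text \<open>Offspring law xi: P(xi = k) = tau^k w_k / phi(tau).\<close>
definition xi :: "(nat \<Rightarrow> real) \<Rightarrow> real \<Rightarrow> nat pmf" where
  "xi w \<tau> = embed_pmf (\<lambda>k. \<tau> ^ k * w k / phi w \<tau>)"

definition mu :: "(nat \<Rightarrow> real) \<Rightarrow> real \<Rightarrow> real" where
  "mu w \<tau> = (\<Sum>k. real k * pmf (xi w \<tau>) k)"

text \<open>Size-biased xihat together with a uniform position of the spine child:
  Some (a, b) = xihat = a + b + 1 with a children left and b right of the spine child
  (probability (a+b+1) P(xi=a+b+1) / (a+b+1)); None = xihat = infinity (prob. 1 - mu).\<close>
definition yhat :: "(nat \<Rightarrow> real) \<Rightarrow> real \<Rightarrow> (nat \<times> nat) option pmf" where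
  "yhat w \<tau> = embed_pmf (\<lambda>y. case y of None \<Rightarrow> 1 - mu w \<tau>
                                  | Some (a, b) \<Rightarrow> pmf (xi w \<tau>) (a + b + 1))"

text \<open>Encoding of a Galton-Watson tree given offspring numbers at all Ulam words.\<close>
definition gw :: "(nat list \<Rightarrow> nat) \<Rightarrow> nat list \<Rightarrow> tval" where
  "gw X xs = (if \<forall>j<length xs. xs ! j < X (take j xs) then Deg (enat (X xs)) else Deg 0)"

text \<open>bar T^*: fringe subtree of T^* at its vertex of infinite degree, pointed at u_0,
  built from i.i.d. offspring variables X (one per non-spine vertex of U^bullet) and
  i.i.d. spine variables Y i (for u_(i+1)). L + 1 = i_1 is the first infinite spine vertex.\<close>
definition Tstarbar :: "(uvert \<Rightarrow> nat) \<times> (nat \<Rightarrow> (nat \<times> nat) option) \<Rightarrow> uvert \<Rightarrow> tval" where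
  "Tstarbar \<omega> v = (let X = fst \<omega>; Y = snd \<omega>; L = (LEAST i. Y i = None) in
     case v of
       Dn xs \<Rightarrow> gw (\<lambda>u. X (Dn u)) xs
     | Sp i \<Rightarrow> (if i < L then (case Y i of Some (a, b) \<Rightarrow> SPair (enat a) (enat b) | None \<Rightarrow> Star)
               else if i = L then SPair \<infinity> \<infinity> else Star)
     | Sd i l m xs \<Rightarrow> (if i < L then
                         (case Y i of Some (a, b) \<Rightarrow>
                            (if (if l then m < a else m < b) then gw (\<lambda>u. X (Sd i l m u)) xs else Deg 0)
                          | None \<Rightarrow> Deg 0)
                       else if i = L then gw (\<lambda>u. X (Sd i l m u)) xs else Deg 0))"

definition Tstar_space :: "(nat \<Rightarrow> real) \<Rightarrow> real \<Rightarrow>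
    ((uvert \<Rightarrow> nat) \<times> (nat \<Rightarrow> (nat \<times> nat) option)) measure" where
  "Tstar_space w \<tau> = (PiM UNIV (\<lambda>_. measure_pmf (xi w \<tau>))) \<Otimes>\<^sub>M (PiM UNIV (\<lambda>_. measure_pmf (yhat w \<tau>)))"

end

(* Call a vertex big if its outdegree exceeds Omega. By hypothesis the big vertices together have
   (1 - mu + o(1)) n children, so the claim reduces to a law of large numbers: for every fixed list
   cs of finite trees, the proportion of windows of length cs consecutive children of big vertices
   whose fringe subtrees are cs tends to the Galton-Watson weight q of cs. Only a lower bound is
   needed, because the limiting masses already add up to 1.

   Type II: after tilting to the offspring law xi, cut the children of big vertices into disjoint
   blocks. Weighting each matching block by exp(-s), and every block by the compensating factor
   1 / (1 - q (1 - exp(-s))), leaves the total mass of all trees at most 1. Chernoff's bound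
   controls the number of matches up to probability exp(-delta n) / P(|T| = n), and P(|T| = n)
   decays subexponentially: grafting at the leftmost leaf makes it supermultiplicative, and the
   generating function of |T| has radius of convergence 1.
   Type III: almost all vertices are leaves.

   The limit tree seen from its infinite vertex is described by such windows: the child containing
   u_0 carries a size-biased Galton-Watson tree pointed at a uniform vertex, and its siblings carry
   independent Galton-Watson trees. *)
theory Submission
  imports Defs
begin

instance ptree :: countable by countable_datatype
instance uvert :: countable by countable_datatype
instance tval :: countable by countable_datatype

lemma verts_Node: "verts (Node ts) = insert [] (\<Union>i<length ts. (#) i ` verts (ts ! i))"
proof -
  have "p \<in> verts (Node ts) \<longleftrightarrow> p \<in> insert [] (\<Union>i<length ts. (#) i ` verts (ts ! i))" for p
    by (cases p) (auto simp: verts_def)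
  then show ?thesis by blast
qed

lemma Nil_in_verts [simp]: "[] \<in> verts t"
  by (simp add: verts_def)

lemma Cons_in_verts: "i # p \<in> verts t \<longleftrightarrow> i < length (kids t) \<and> p \<in> verts (kids t ! i)"
  by (auto simp: verts_def)

lemma subt_append: "subt t (p @ q) = (case subt t p of None \<Rightarrow> None | Some s \<Rightarrow> subt s q)"
  by (induction t p rule: subt.induct) auto

lemma append_in_verts: "p @ q \<in> verts t \<longleftrightarrow> p \<in> verts t \<and> q \<in> verts (the (subt t p))"
  by (auto simp: verts_def subt_append split: option.splits)

lemma Node_kids [simp]: "Node (kids t) = t"
  by (cases t) simp

lemma finite_verts [simp]: "finite (verts t)"
  by (induction t) (simp add: verts_Node)

lemma sum_verts_Node:
  fixes F :: "nat list \<Rightarrow> 'a :: comm_monoid_add"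
  shows "sum F (verts (Node ts)) = F [] + (\<Sum>i<length ts. \<Sum>p\<in>verts (ts ! i). F (i # p))"
  unfolding verts_Node
  by (subst sum.insert, simp, force, subst sum.UNION_disjoint) (auto simp: sum.reindex)

lemma prod_verts_Node:
  fixes F :: "nat list \<Rightarrow> 'a :: comm_monoid_mult"
  shows "prod F (verts (Node ts)) = F [] * (\<Prod>i<length ts. \<Prod>p\<in>verts (ts ! i). F (i # p))"
  unfolding verts_Node
  by (subst prod.insert, simp, force, subst prod.UNION_disjoint) (auto simp: prod.reindex)

lemma sum_list_conv_lessThan: "sum_list (map f xs) = (\<Sum>i<length xs. f (xs ! i))"
  by (simp add: sum_list_sum_nth atLeast0LessThan)

lemma prod_list_conv_lessThan: "prod_list (map f xs) = (\<Prod>i<length xs. f (xs ! i))"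
  by (induction xs) (auto simp: prod.lessThan_Suc_shift simp del: prod.lessThan_Suc)

lemma card_verts: "card (verts t) = nv t"
proof (induction t)
  case (Node ts)
  have "card (verts (Node ts)) = 1 + (\<Sum>i<length ts. card (verts (ts ! i)))"
    using sum_verts_Node[of "\<lambda>_. 1::nat" ts] by simp
  also have "\<dots> = nv (Node ts)"
    using Node by (simp add: sum_list_conv_lessThan)
  finally show ?case .
qed

lemma wt_conv_prod: "wt w t = (\<Prod>p\<in>verts t. w (outdeg (the (subt t p))))"
proof (induction t)
  case (Node ts)
  then show ?case
    by (simp add: prod_verts_Node prod_list_conv_lessThan outdeg_def)
qed

lemma nv_pos [simp]: "nv t > 0"
  by (cases t) simp

lemma nv_neq_0 [simp]: "nv t \<noteq> 0"
  by (cases t) simp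

lemma nv_nth_less: "i < length ts \<Longrightarrow> nv (ts ! i) < nv (Node ts)"
  using member_le_sum_list[of "nv (ts ! i)" "map nv ts"] by (simp add: less_Suc_eq_le)

lemma nv_mem_less: "t \<in> set ts \<Longrightarrow> nv t < nv (Node ts)"
  using nv_nth_less by (metis in_set_conv_nth)

lemma length_le_sum_list: "(\<And>x. x \<in> set xs \<Longrightarrow> 1 \<le> f x) \<Longrightarrow> length xs \<le> sum_list (map f xs)" for f :: "'a \<Rightarrow> nat"
  by (induction xs) (fastforce)+

lemma length_less_nv: "length ts < nv (Node ts)"
  using length_le_sum_list[of ts nv] nv_pos by (simp add: Suc_leI less_Suc_eq_le)

lemma nv_subt: "subt t p = Some s \<Longrightarrow> nv s \<le> nv t"
proof (induction t p rule: subt.induct)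
  case (2 t i p)
  then show ?case
    using nv_nth_less[of i "kids t"] by (auto split: if_splits)
qed simp

lemma outdeg_less_nv: "outdeg t < nv t"
  by (metis Node_kids length_less_nv outdeg_def)

subsection \<open>Additive functionals\<close>

definition tot :: "(ptree \<Rightarrow> 'a :: comm_monoid_add) \<Rightarrow> ptree \<Rightarrow> 'a" where
  "tot h t = (\<Sum>p\<in>verts t. h (the (subt t p)))"

lemma tot_Node: "tot h (Node ts) = h (Node ts) + (\<Sum>i<length ts. tot h (ts ! i))"
  by (simp add: tot_def sum_verts_Node)

lemma tot_outdeg: "tot outdeg t + 1 = nv t"
proof (induction t)
  case (Node ts)
  have "(\<Sum>i<length ts. tot outdeg (ts ! i)) + length ts = (\<Sum>i<length ts. tot outdeg (ts ! i) + 1)"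
    by (simp add: sum.distrib del: One_nat_def)
  also have "\<dots> = (\<Sum>i<length ts. nv (ts ! i))"
    using Node by (intro sum.cong refl) (simp del: One_nat_def)
  finally show ?case
    by (simp add: tot_Node sum_list_conv_lessThan) (simp add: outdeg_def)
qed

subsection \<open>Finite sums over lists and trees\<close>

definition lists_n :: "'a set \<Rightarrow> nat \<Rightarrow> 'a list set" where
  "lists_n A n = {xs. set xs \<subseteq> A \<and> length xs = n}"

lemma finite_lists_n [simp]: "finite A \<Longrightarrow> finite (lists_n A n)"
  by (simp add: lists_n_def finite_lists_length_eq)

lemma lists_n_0 [simp]: "lists_n A 0 = {[]}"
  by (auto simp: lists_n_def)

lemma lists_n_1: "lists_n A (Suc 0) = (\<lambda>x. [x]) ` A"
  by (auto simp: lists_n_def length_Suc_conv)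

lemma sum_lists_n_1:
  fixes F :: "'a list \<Rightarrow> 'b :: comm_monoid_add"
  shows "sum F (lists_n A (Suc 0)) = (\<Sum>x\<in>A. F [x])"
  by (simp add: lists_n_1 sum.reindex inj_on_def)

lemma sum_lists_n_add:
  fixes F :: "'a list \<Rightarrow> 'b :: comm_monoid_add"
  shows "sum F (lists_n A (k + l)) = (\<Sum>us\<in>lists_n A k. \<Sum>vs\<in>lists_n A l. F (us @ vs))"
proof -
  have "bij_betw (\<lambda>(us, vs). us @ vs) (lists_n A k \<times> lists_n A l) (lists_n A (k + l))"
  proof (rule bij_betw_byWitness[where f' = "\<lambda>ts. (take k ts, drop k ts)"])
    show "(\<lambda>ts. (take k ts, drop k ts)) ` lists_n A (k + l) \<subseteq> lists_n A k \<times> lists_n A l"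
      by (auto simp: lists_n_def dest: in_set_takeD in_set_dropD)
  qed (auto simp: lists_n_def)
  then have "sum F (lists_n A (k + l)) = (\<Sum>x\<in>lists_n A k \<times> lists_n A l. F (case x of (us, vs) \<Rightarrow> us @ vs))"
    by (simp add: sum.reindex_bij_betw[symmetric])
  also have "\<dots> = (\<Sum>us\<in>lists_n A k. \<Sum>vs\<in>lists_n A l. F (us @ vs))"
    by (simp add: sum.cartesian_product case_prod_beta)
  finally show ?thesis .
qed

lemma sum_prod_lists_n:
  fixes u :: "'a \<Rightarrow> 'b :: comm_semiring_1"
  shows "(\<Sum>ts\<in>lists_n A n. prod_list (map u ts)) = sum u A ^ n"
proof (induction n)
  case (Suc n)
  have "(\<Sum>ts\<in>lists_n A (Suc 0 + n). prod_list (map u ts)) = sum u A * sum u A ^ n"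
    by (simp only: sum_lists_n_add sum_lists_n_1) (simp add: Suc[symmetric] sum_product)
  then show ?case by simp
qed simp

lemma sum_prod_nth_lists_n:
  fixes u v :: "'a \<Rightarrow> 'b :: comm_semiring_1"
  assumes "k < n"
  shows "(\<Sum>ts\<in>lists_n A n. prod_list (map u ts) * v (ts ! k)) = (\<Sum>x\<in>A. u x * v x) * sum u A ^ (n - 1)"
proof -
  have n: "n = k + (Suc 0 + (n - Suc k))"
    using assms by simp
  have "(\<Sum>ts\<in>lists_n A n. prod_list (map u ts) * v (ts ! k)) =
      (\<Sum>us\<in>lists_n A k. \<Sum>x\<in>A. \<Sum>vs\<in>lists_n A (n - Suc k).
         prod_list (map u us) * ((u x * v x) * prod_list (map u vs)))"
    by (subst n, simp only: sum_lists_n_add sum_lists_n_1)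
       (intro sum.cong refl, auto simp: lists_n_def nth_append algebra_simps)
  also have "\<dots> = sum u A ^ k * ((\<Sum>x\<in>A. u x * v x) * sum u A ^ (n - Suc k))"
    by (simp add: sum_distrib_left[symmetric] sum_distrib_right[symmetric] sum_prod_lists_n)
  also have "\<dots> = (\<Sum>x\<in>A. u x * v x) * sum u A ^ (n - 1)"
    using assms by (subst mult.left_commute, subst power_add[symmetric]) simp
  finally show ?thesis .
qed

definition trees_upto :: "nat \<Rightarrow> ptree set" where
  "trees_upto N = {t. nv t \<le> N}"

lemma trees_upto_mono: "M \<le> N \<Longrightarrow> trees_upto M \<subseteq> trees_upto N"
  by (auto simp: trees_upto_def)

lemma trees_Suc_subset: "trees_upto (Suc N) \<subseteq> Node ` (\<Union>D\<le>N. lists_n (trees_upto N) D)"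
proof
  fix t assume "t \<in> trees_upto (Suc N)"
  moreover obtain ts where t: "t = Node ts" by (cases t)
  ultimately have "nv (Node ts) \<le> Suc N" by (simp add: trees_upto_def)
  then have "ts \<in> lists_n (trees_upto N) (length ts)" "length ts \<le> N"
    using nv_mem_less length_less_nv[of ts] by (force simp: lists_n_def trees_upto_def)+
  then show "t \<in> Node ` (\<Union>D\<le>N. lists_n (trees_upto N) D)"
    using t by blast
qed

lemma finite_trees_upto [simp]: "finite (trees_upto N)"
proof (induction N)
  case 0
  have "trees_upto 0 = {}" using nv_pos by (auto simp: trees_upto_def)
  then show ?case by simp
next
  case (Suc N)
  then show ?case
    by (intro finite_subset[OF trees_Suc_subset] finite_imageI) auto
qed

lemma finite_nv_eq [simp]: "finite {t. nv t = n}"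
  by (rule finite_subset[OF _ finite_trees_upto[of n]]) (auto simp: trees_upto_def)

lemma sum_forests:
  fixes F :: "ptree \<Rightarrow> real"
  assumes "finite A"
  shows "sum F (Node ` (\<Union>D\<le>K. lists_n A D)) = (\<Sum>D\<le>K. \<Sum>ts\<in>lists_n A D. F (Node ts))"
proof -
  have "sum F (Node ` (\<Union>D\<le>K. lists_n A D)) = sum (F \<circ> Node) (\<Union>D\<le>K. lists_n A D)"
    by (intro sum.reindex) (auto simp: inj_on_def)
  also have "\<dots> = (\<Sum>D\<le>K. \<Sum>ts\<in>lists_n A D. F (Node ts))"
    using assms by (subst sum.UNION_disjoint) (auto simp: lists_n_def finite_lists_length_eq)
  finally show ?thesis .
qed

lemma sum_trees_Suc_le:
  fixes F :: "ptree \<Rightarrow> real"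
  assumes "\<And>t. F t \<ge> 0"
  shows "sum F (trees_upto (Suc N)) \<le> (\<Sum>D\<le>N. \<Sum>ts\<in>lists_n (trees_upto N) D. F (Node ts))"
  unfolding sum_forests[OF finite_trees_upto, symmetric]
  by (intro sum_mono2 trees_Suc_subset) (auto simp: assms)

lemma sum_trees_ge:
  fixes F :: "ptree \<Rightarrow> real"
  assumes "\<And>t. F t \<ge> 0"
  shows "(\<Sum>D\<le>K. \<Sum>ts\<in>lists_n (trees_upto N) D. F (Node ts)) \<le> sum F (trees_upto (Suc (K * N)))"
  unfolding sum_forests[OF finite_trees_upto, symmetric]
proof (intro sum_mono2)
  show "Node ` (\<Union>D\<le>K. lists_n (trees_upto N) D) \<subseteq> trees_upto (Suc (K * N))"
  proof clarsimp
    fix ts D assume D: "D \<le> K" "ts \<in> lists_n (trees_upto N) D"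
    have "sum_list (map nv ts) \<le> length ts * N"
      using sum_list_mono[of ts nv "\<lambda>_. N"] D by (auto simp: lists_n_def trees_upto_def sum_list_triv)
    also have "\<dots> \<le> K * N" using D by (auto simp: lists_n_def)
    finally show "Node ts \<in> trees_upto (Suc (K * N))" by (simp add: trees_upto_def)
  qed
qed (auto simp: assms)

subsection \<open>The growth rate of the partition function\<close>

lemma additive_semigroup_eventually:
  fixes S :: "nat set"
  assumes add: "\<And>a b. a \<in> S \<Longrightarrow> b \<in> S \<Longrightarrow> a + b \<in> S" and zero: "0 \<in> S" and b: "b \<in> S" "b > 0"
  shows "\<exists>N0. \<forall>N\<ge>N0. Gcd S dvd N \<longrightarrow> N \<in> S"
proof -
  have mult: "k * a \<in> S" if "a \<in> S" for a k
    using that by (induction k) (auto intro: add zero)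
  define P where "P g \<longleftrightarrow> g > 0 \<and> (\<exists>c\<in>S. c + g \<in> S)" for g
  define g where "g = (LEAST g. P g)"
  have "P b" using zero b by (auto simp: P_def intro: bexI[of _ 0])
  then have Pg: "P g" unfolding g_def by (rule LeastI)
  then obtain c where c: "c \<in> S" "c + g \<in> S" and g0: "g > 0" by (auto simp: P_def)
  have gdvd: "g dvd s" if s: "s \<in> S" for s
  proof (rule ccontr)
    assume "\<not> g dvd s"
    then have r: "s mod g > 0" by (simp add: mod_greater_zero_iff_not_dvd)
    have "s div g * (c + g) + s mod g = s + s div g * c"
      by (metis add.commute add.left_commute add_mult_distrib2 div_mult_mod_eq)
    also have "\<dots> \<in> S" by (intro add mult s c)
    finally have "P (s mod g)" using r mult[OF c(2)] by (auto simp: P_def)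
    moreover have "s mod g < g" using g0 by simp
    ultimately show False unfolding g_def using not_less_Least by blast
  qed
  have "g dvd Gcd S" using gdvd by (auto intro: Gcd_greatest)
  moreover have "Gcd S dvd g" using c by (metis Gcd_dvd dvd_add_right_iff)
  ultimately have geq: "Gcd S = g" by (simp add: dvd_antisym)
  have "N \<in> S" if N: "N \<ge> c * c" "g dvd N" for N
  proof (cases "c = 0")
    case True
    then show ?thesis using mult[OF c(2), of "N div g"] N by simp
  next
    case False
    obtain c' where c': "c = g * c'" using gdvd[OF c(1)] by blast
    obtain k where k: "N = g * k" using N by blast
    have c0: "c' > 0" using False c' by auto
    have "k mod c' < c'" using c0 by simp
    also have "c' \<le> c" using c' g0 by simp
    also have "c \<le> N div c"
      using N(1) False by (simp add: less_eq_div_iff_mult_less_eq)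
    also have "N div c = k div c'" using k c' g0 by simp
    finally have qr: "k mod c' \<le> k div c'" by simp
    have "(k div c' - k mod c') * c + k mod c' * (c + g) = (k div c' - k mod c' + k mod c') * c + k mod c' * g"
      by (simp add: algebra_simps del: le_add_diff_inverse2)
    also have "\<dots> = k div c' * c + k mod c' * g"
      using qr by simp
    also have "\<dots> = g * (k div c' * c' + k mod c')"
      unfolding c' by (simp only: distrib_left mult_ac)
    also have "\<dots> = N" using k by (simp only: div_mult_mod_eq)
    finally show ?thesis using add[OF mult[OF c(1)] mult[OF c(2)]] by metis
  qed
  then show ?thesis unfolding geq by blast
qed

fun graft :: "ptree \<Rightarrow> ptree \<Rightarrow> ptree" where
  "graft (Node []) s = s"
| "graft (Node (t # ts)) s = Node (graft t s # ts)"

lemma nv_graft: "Suc (nv (graft t s)) = nv t + nv s"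
  by (induction t s rule: graft.induct) auto

lemma wt_graft: "w 0 * wt w (graft t s) = wt w t * wt w s"
proof (induction t s rule: graft.induct)
  case (2 t ts s)
  have "w 0 * wt w (graft (Node (t # ts)) s) = w (Suc (length ts)) * prod_list (map (wt w) ts) * (w 0 * wt w (graft t s))"
    by (simp add: mult_ac)
  then show ?case using 2 by (simp add: mult_ac)
qed simp

lemma graft_inject:
  assumes "graft t s = graft t' s'" "nv s = nv s'"
  shows "t = t' \<and> s = s'"
  using assms
proof (induction t s arbitrary: t' rule: graft.induct)
  case (1 s)
  show ?case
  proof (cases t')
    case (Node us)
    then show ?thesis
      using 1 nv_graft[of t' s'] length_less_nv[of us] by (cases us) auto
  qed
next
  case (2 t ts s)
  show ?case
  proof (cases t')
    case (Node us)
    show ?thesis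
    proof (cases us)
      case Nil
      then show ?thesis
        using 2(2,3) Node nv_graft[of "Node (t # ts)" s] nv_pos[of t] by auto
    next
      case (Cons u vs)
      then show ?thesis using 2 Node by auto
    qed
  qed
qed

lemma wt_nonneg: "(\<And>k. w k \<ge> 0) \<Longrightarrow> wt w t \<ge> 0"
  unfolding wt_conv_prod by (simp add: prod_nonneg)

lemma Zn_nonneg: "(\<And>k. w k \<ge> 0) \<Longrightarrow> Zn w n \<ge> 0"
  unfolding Zn_def by (simp add: sum_nonneg wt_nonneg)

lemma Zn_supermultiplicative:
  assumes "\<And>k. w k \<ge> 0"
  shows "Zn w (Suc n) * Zn w (Suc m) \<le> w 0 * Zn w (Suc (n + m))"
proof -
  have inj: "inj_on (\<lambda>(t, s). graft t s) ({t. nv t = Suc n} \<times> {t. nv t = Suc m})"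
    by (auto simp: inj_on_def dest: graft_inject)
  have "Zn w (Suc n) * Zn w (Suc m) =
      (\<Sum>(t, s)\<in>{t. nv t = Suc n} \<times> {t. nv t = Suc m}. w 0 * wt w (graft t s))"
    by (simp add: Zn_def sum_product sum.cartesian_product wt_graft)
  also have "\<dots> = (\<Sum>t\<in>(\<lambda>(t, s). graft t s) ` ({t. nv t = Suc n} \<times> {t. nv t = Suc m}). w 0 * wt w t)"
    by (subst sum.reindex[OF inj]) (simp add: case_prod_beta)
  also have "\<dots> \<le> (\<Sum>t\<in>{t. nv t = Suc (n + m)}. w 0 * wt w t)"
  proof (intro sum_mono2)
    show "(\<lambda>(t, s). graft t s) ` ({t. nv t = Suc n} \<times> {t. nv t = Suc m}) \<subseteq> {t. nv t = Suc (n + m)}"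
      using nv_graft by (auto simp: nat_arith.suc1[symmetric]) (metis add_Suc add_Suc_right nat.inject)
  qed (use assms in \<open>auto intro!: wt_nonneg mult_nonneg_nonneg\<close>)
  finally show ?thesis by (simp add: Zn_def sum_distrib_left)
qed

lemma wt_pos_dvd:
  assumes "weight_seq w" "wt w t > 0"
  shows "span w dvd nv t - 1"
  using assms(2)
proof (induction t)
  case (Node ts)
  have w0: "w k \<ge> 0" for k using assms(1) by (simp add: weight_seq_def)
  have ne: "wt w (Node ts) \<noteq> 0" using Node.prems by (metis less_irrefl)
  have "w (length ts) > 0" using ne w0[of "length ts"] by (simp add: less_le)
  then have l: "span w dvd length ts" by (auto simp: span_def intro: Gcd_dvd)
  have "nv (Node ts) - 1 = (\<Sum>i<length ts. nv (ts ! i) - 1) + length ts"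
  proof -
    have "(\<Sum>i<length ts. nv (ts ! i)) = (\<Sum>i<length ts. (nv (ts ! i) - 1) + 1)"
      by (intro sum.cong) (auto simp: Suc_leI)
    also have "\<dots> = (\<Sum>i<length ts. nv (ts ! i) - 1) + length ts"
      by (subst sum.distrib) simp
    finally show ?thesis by (simp add: sum_list_conv_lessThan)
  qed
  moreover have "span w dvd nv (ts ! i) - 1" if "i < length ts" for i
  proof (rule Node.IH)
    show "ts ! i \<in> set ts" using that by simp
    then have "wt w (ts ! i) \<noteq> 0" using ne by (auto simp: prod_list_zero_iff image_iff)
    then show "wt w (ts ! i) > 0" using wt_nonneg[of w, OF w0] by (simp add: less_le)
  qed
  ultimately show ?case using l by (auto intro!: dvd_add dvd_sum simp del: One_nat_def)
qed

lemma Zn_1: "Zn w 1 = w 0"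
proof -
  have "{t. nv t = 1} = {Node []}"
  proof (intro equalityI subsetI)
    fix t assume "t \<in> {t. nv t = 1}"
    then show "t \<in> {Node []}" using length_less_nv[of "kids t"] by (cases t) auto
  qed auto
  then show ?thesis by (simp add: Zn_def)
qed

lemma Zn_star_pos:
  assumes "weight_seq w" "w i > 0"
  shows "Zn w (Suc i) > 0"
proof -
  have w0: "w k \<ge> 0" for k using assms(1) by (simp add: weight_seq_def)
  have "0 < wt w (Node (replicate i (Node [])))"
    using assms by (simp add: weight_seq_def)
  also have "\<dots> \<le> Zn w (Suc i)" unfolding Zn_def
    by (rule member_le_sum) (auto simp: sum_list_replicate wt_nonneg w0)
  finally show ?thesis .
qed

lemma Zn_support:
  assumes "weight_seq w"
  shows "\<exists>N0. \<forall>N\<ge>N0. span w dvd N \<longrightarrow> Zn w (Suc N) > 0"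
    and "Zn w (Suc N) > 0 \<Longrightarrow> span w dvd N"
proof -
  have w0: "w k \<ge> 0" for k using assms(1) by (simp add: weight_seq_def)
  have w00: "w 0 > 0" using assms by (simp add: weight_seq_def)
  define S where "S = {N. Zn w (Suc N) > 0}"
  obtain k where k: "k \<ge> 2" "w k > 0" using assms by (auto simp: weight_seq_def)
  have "\<exists>N0. \<forall>N\<ge>N0. Gcd S dvd N \<longrightarrow> N \<in> S"
  proof (rule additive_semigroup_eventually)
    show "a + b \<in> S" if "a \<in> S" "b \<in> S" for a b
    proof -
      have "0 < Zn w (Suc a) * Zn w (Suc b)" using that by (simp add: S_def)
      also have "\<dots> \<le> w 0 * Zn w (Suc (a + b))" by (rule Zn_supermultiplicative[OF w0])
      finally show ?thesis using w00 by (simp add: S_def zero_less_mult_iff)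
    qed
    show "0 \<in> S" using w00 Zn_1 by (simp add: S_def)
    show "k \<in> S" using Zn_star_pos[OF assms k(2)] by (simp add: S_def)
    show "k > 0" using k by simp
  qed
  moreover have "Gcd S dvd span w"
    unfolding span_def by (intro Gcd_greatest) (auto simp: S_def intro!: Gcd_dvd Zn_star_pos[OF assms])
  ultimately show "\<exists>N0. \<forall>N\<ge>N0. span w dvd N \<longrightarrow> Zn w (Suc N) > 0"
    unfolding S_def by (meson dvd_trans mem_Collect_eq)
  assume "Zn w (Suc N) > 0"
  then have "\<exists>t\<in>{t. nv t = Suc N}. wt w t > 0"
    unfolding Zn_def using sum_nonpos[of "{t. nv t = Suc N}" "wt w"] by (meson not_less)
  then show "span w dvd N" using wt_pos_dvd[OF assms] by fastforce
qed

lemma eventually_admF: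
  assumes "\<exists>N0. \<forall>N\<ge>N0. span w dvd N \<longrightarrow> P (Suc N)"
  shows "eventually P (admF w)"
proof -
  obtain N0 where N0: "\<And>N. N \<ge> N0 \<Longrightarrow> span w dvd N \<Longrightarrow> P (Suc N)" using assms by blast
  have "P n" if "n \<ge> Suc N0" "n mod span w = 1 mod span w" for n
  proof -
    have "span w dvd n - 1" using that by (subst mod_eq_dvd_iff_nat[symmetric]) auto
    then show ?thesis using N0[of "n - 1"] that by simp
  qed
  then show ?thesis
    unfolding admF_def eventually_inf_principal eventually_sequentially by (intro exI[of _ "Suc N0"]) simp
qed

lemma Zn_pos_eventually:
  assumes "weight_seq w"
  shows "eventually (\<lambda>n. Zn w n > 0) (admF w)"
  using eventually_admF[OF Zn_support(1)[OF assms]] .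

lemma Zn_power_lower:
  assumes "weight_seq w"
  shows "(Zn w (Suc n) / w 0) ^ k * Zn w (Suc r) \<le> Zn w (Suc (k * n + r))"
proof (induction k)
  case (Suc k)
  have w0: "w k \<ge> 0" for k using assms(1) by (simp add: weight_seq_def)
  have w00: "w 0 > 0" using assms by (simp add: weight_seq_def)
  have "(Zn w (Suc n) / w 0) ^ Suc k * Zn w (Suc r) \<le> Zn w (Suc n) / w 0 * Zn w (Suc (k * n + r))"
    using mult_left_mono[OF Suc, of "Zn w (Suc n) / w 0"] w00 Zn_nonneg[OF w0] by (simp add: mult_ac)
  also have "\<dots> \<le> Zn w (Suc (n + (k * n + r)))"
    using Zn_supermultiplicative[of w n "k * n + r", OF w0] w00 by (simp add: field_simps)
  finally show ?case by (simp add: add_ac)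
qed simp

lemma Zn_exp_lower:
  assumes w: "weight_seq w" and n0: "n0 \<ge> 1" "Zn w (Suc n0) \<ge> w 0 * exp (- (e * real n0))" and e: "e \<ge> 0"
  shows "\<exists>b>0. eventually (\<lambda>n. Zn w n \<ge> b * exp (- (e * real n))) (admF w)"
proof -
  have w00: "w 0 > 0" using w by (simp add: weight_seq_def)
  have z0: "Zn w (Suc n0) > 0" using n0(2) w00 by (meson exp_gt_zero less_le_trans mult_pos_pos)
  have d: "span w dvd n0" using Zn_support(2)[OF w z0] .
  obtain R where R: "\<And>N. N \<ge> R \<Longrightarrow> span w dvd N \<Longrightarrow> Zn w (Suc N) > 0" using Zn_support(1)[OF w] by blast
  define b where "b = Min ((\<lambda>r. Zn w (Suc r)) ` {r\<in>{R..<R+n0}. span w dvd r} \<union> {1})"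
  have b: "b > 0" unfolding b_def by (subst Min_gr_iff) (auto intro: R)
  have "Zn w (Suc N) \<ge> b * exp (- (e * real (Suc N)))" if N: "N \<ge> R" "span w dvd N" for N
  proof -
    define k r where "k = (N - R) div n0" and "r = R + (N - R) mod n0"
    have Nkr: "N = k * n0 + r" using N by (simp add: k_def r_def)
    then have dr: "span w dvd r" using N(2) d by (metis dvd_add_right_iff dvd_mult)
    have bZ: "b \<le> Zn w (Suc r)" unfolding b_def using dr n0(1)
      by (intro Min_le) (auto simp: r_def intro!: imageI)
    have "0 \<le> e * (1 + real r)" using e by simp
    then have "exp (- (e * real (Suc N))) \<le> exp (- (e * real n0)) ^ k"
      by (auto simp: exp_of_nat_mult[symmetric] Nkr algebra_simps)
    also have "\<dots> \<le> (Zn w (Suc n0) / w 0) ^ k"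
      using n0(2) w00 by (intro power_mono) (auto simp: field_simps)
    finally have "exp (- (e * real (Suc N))) * b \<le> (Zn w (Suc n0) / w 0) ^ k * Zn w (Suc r)"
      using bZ b z0 w00 by (intro mult_mono) auto
    also have "\<dots> \<le> Zn w (Suc N)" unfolding Nkr by (rule Zn_power_lower[OF w])
    finally show ?thesis by (simp add: mult_ac)
  qed
  then show ?thesis using b eventually_admF[of w "\<lambda>n. Zn w n \<ge> b * exp (- (e * real n))"] by blast
qed

subsection \<open>Subcritical Galton--Watson trees\<close>

lemma sums_pmf_nat: "pmf p sums 1" for p :: "nat pmf"
proof -
  have "(\<lambda>k. measure_pmf.prob p {k}) sums measure_pmf.prob p (\<Union>k. {k})"
    by (rule measure_pmf.finite_measure_UNION) (auto simp: disjoint_family_on_def)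
  moreover have "(\<Union>k. {k}) = (UNIV :: nat set)" by auto
  ultimately show ?thesis by (simp add: measure_pmf_single)
qed

lemma prod_list_mult_power:
  "prod_list (map (\<lambda>t. u t * x ^ f t) ts) = prod_list (map u ts) * x ^ sum_list (map f ts)"
  for u :: "'a \<Rightarrow> 'b :: comm_monoid_mult"
  by (induction ts) (simp_all add: mult_ac power_add)

locale subcritical =
  fixes \<xi> :: "nat pmf" and \<mu> :: real
  assumes mean: "(\<lambda>k. real k * pmf \<xi> k) sums \<mu>" and mean_less_1: "\<mu> < 1"
begin

abbreviation gwt :: "ptree \<Rightarrow> real" where "gwt \<equiv> wt (pmf \<xi>)"

lemma gwt_nonneg [simp]: "gwt t \<ge> 0"
  by (rule wt_nonneg) simp

definition gf :: "nat \<Rightarrow> real \<Rightarrow> real" where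
  "gf N x = (\<Sum>t\<in>trees_upto N. gwt t * x ^ nv t)"

lemma gf_nonneg: "x \<ge> 0 \<Longrightarrow> gf N x \<ge> 0"
  by (simp add: gf_def sum_nonneg)

lemma incseq_gf: "x \<ge> 0 \<Longrightarrow> incseq (\<lambda>N. gf N x)"
  unfolding gf_def by (intro monoI sum_mono2 trees_upto_mono) auto

lemma sum_forest_gf:
  "(\<Sum>ts\<in>lists_n (trees_upto N) D. gwt (Node ts) * x ^ nv (Node ts)) = x * (pmf \<xi> D * gf N x ^ D)"
proof -
  have "(\<Sum>ts\<in>lists_n (trees_upto N) D. gwt (Node ts) * x ^ nv (Node ts)) =
     (\<Sum>ts\<in>lists_n (trees_upto N) D. x * pmf \<xi> D * prod_list (map (\<lambda>t. gwt t * x ^ nv t) ts))"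
    by (intro sum.cong refl) (simp add: prod_list_mult_power lists_n_def)
  also have "\<dots> = x * (pmf \<xi> D * gf N x ^ D)"
    by (simp add: sum_distrib_left[symmetric] sum_prod_lists_n gf_def)
  finally show ?thesis .
qed

lemma gf_recursion_le:
  "x \<ge> 0 \<Longrightarrow> x * (\<Sum>D\<le>K. pmf \<xi> D * gf N x ^ D) \<le> gf (Suc (K * N)) x"
  using sum_trees_ge[of "\<lambda>t. gwt t * x ^ nv t" N K]
  by (simp only: sum_forest_gf) (simp add: gf_def sum_distrib_left)

lemma gf_1_le: "gf N 1 \<le> 1"
proof (induction N)
  case 0
  have "trees_upto 0 = {}" by (auto simp: trees_upto_def)
  then show ?case by (simp add: gf_def)
next
  case (Suc N)
  have "gf (Suc N) 1 \<le> (\<Sum>D\<le>N. pmf \<xi> D * gf N 1 ^ D)"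
    using sum_trees_Suc_le[of "\<lambda>t. gwt t * 1 ^ nv t" N]
    by (simp only: sum_forest_gf) (simp add: gf_def)
  also have "\<dots> \<le> (\<Sum>D\<le>N. pmf \<xi> D)"
    using Suc gf_nonneg[of 1 N] by (intro sum_mono mult_left_le power_le_one) auto
  also have "\<dots> \<le> 1"
    using sum_le_suminf[OF sums_summable[OF sums_pmf_nat], of "{..N}" \<xi>] sums_unique[OF sums_pmf_nat, of \<xi>] by simp
  finally show ?case .
qed

lemma gf_limit:
  assumes x: "x \<ge> 0" and f: "(\<lambda>N. gf N x) \<longlonglongrightarrow> f"
  shows "x * (\<Sum>D\<le>K. pmf \<xi> D * f ^ D) \<le> f"
proof (rule LIMSEQ_le_const2)
  show "(\<lambda>N. x * (\<Sum>D\<le>K. pmf \<xi> D * gf N x ^ D)) \<longlonglongrightarrow> x * (\<Sum>D\<le>K. pmf \<xi> D * f ^ D)"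
    by (intro tendsto_intros f)
  have "gf N x \<le> f" for N using incseq_le[OF incseq_gf[OF x] f] .
  then show "\<exists>N. \<forall>n\<ge>N. x * (\<Sum>D\<le>K. pmf \<xi> D * gf n x ^ D) \<le> f"
    using gf_recursion_le[OF x] order_trans by blast
qed

lemma gf_1_tendsto: "(\<lambda>N. gf N 1) \<longlonglongrightarrow> 1"
proof -
  obtain e where e: "(\<lambda>N. gf N 1) \<longlonglongrightarrow> e"
    using incseq_convergent[OF incseq_gf, of 1 1] gf_1_le by (metis zero_le_one)
  have e1: "e \<le> 1" by (rule LIMSEQ_le_const2[OF e]) (use gf_1_le in auto)
  have e0: "e \<ge> 0" by (rule LIMSEQ_le_const[OF e]) (use gf_nonneg in auto)
  have "(\<Sum>D\<le>K. pmf \<xi> D) - e \<le> (\<Sum>D\<le>K. real D * pmf \<xi> D) * (1 - e)" for K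
  proof -
    have "(\<Sum>D\<le>K. pmf \<xi> D) - e \<le> (\<Sum>D\<le>K. pmf \<xi> D * (1 - e ^ D))"
      using gf_limit[OF _ e, of K] by (simp add: algebra_simps sum_subtractf)
    also have "\<dots> \<le> (\<Sum>D\<le>K. pmf \<xi> D * (real D * (1 - e)))"
    proof (intro sum_mono mult_left_mono)
      fix D show "1 - e ^ D \<le> real D * (1 - e)"
        using Bernoulli_inequality[of "e - 1" D] e0 by (simp add: algebra_simps)
    qed simp
    also have "\<dots> = (\<Sum>D\<le>K. real D * pmf \<xi> D) * (1 - e)"
      unfolding sum_distrib_right by (intro sum.cong) auto
    finally show ?thesis .
  qed
  moreover have "(\<lambda>K. (\<Sum>D\<le>K. pmf \<xi> D) - e) \<longlonglongrightarrow> 1 - e"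
    using sums_pmf_nat[of \<xi>] by (intro tendsto_intros) (simp add: sums_def_le)
  moreover have "(\<lambda>K. (\<Sum>D\<le>K. real D * pmf \<xi> D) * (1 - e)) \<longlonglongrightarrow> \<mu> * (1 - e)"
    using mean by (intro tendsto_intros) (simp add: sums_def_le)
  ultimately have "1 - e \<le> \<mu> * (1 - e)" by (intro LIMSEQ_le) auto
  then have "(1 - \<mu>) * (1 - e) \<le> 0" by (simp add: algebra_simps)
  then have "e = 1" using e1 mean_less_1 by (simp add: mult_le_0_iff)
  then show ?thesis using e by simp
qed

definition mean_size :: "nat \<Rightarrow> real" where
  "mean_size N = (\<Sum>t\<in>trees_upto N. gwt t * real (nv t))"

lemma incseq_mean_size: "incseq mean_size"
  unfolding mean_size_def by (intro monoI sum_mono2 trees_upto_mono) auto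

lemma mean_size_recursion_le:
  "(\<Sum>D\<le>K. pmf \<xi> D * (gf N 1 ^ D + real D * mean_size N * gf N 1 ^ (D - 1))) \<le> mean_size (Suc (K * N))"
proof -
  have "(\<Sum>ts\<in>lists_n (trees_upto N) D. gwt (Node ts) * real (nv (Node ts))) =
      pmf \<xi> D * (gf N 1 ^ D + real D * mean_size N * gf N 1 ^ (D - 1))" for D
  proof -
    have "(\<Sum>ts\<in>lists_n (trees_upto N) D. gwt (Node ts) * real (nv (Node ts))) =
        (\<Sum>ts\<in>lists_n (trees_upto N) D. pmf \<xi> D * (prod_list (map gwt ts) +
           (\<Sum>k<D. prod_list (map gwt ts) * real (nv (ts ! k)))))"
      by (intro sum.cong refl)
        (auto simp: lists_n_def sum_list_conv_lessThan algebra_simps sum_distrib_left)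
    also have "\<dots> = pmf \<xi> D * ((\<Sum>ts\<in>lists_n (trees_upto N) D. prod_list (map gwt ts)) +
        (\<Sum>k<D. \<Sum>ts\<in>lists_n (trees_upto N) D. prod_list (map gwt ts) * real (nv (ts ! k))))"
      by (simp add: sum_distrib_left[symmetric] sum.distrib) (subst sum.swap, simp add: sum_distrib_left)
    also have "\<dots> = pmf \<xi> D * (gf N 1 ^ D + (\<Sum>k<D. mean_size N * gf N 1 ^ (D - 1)))"
      by (intro arg_cong2[of _ _ _ _ "\<lambda>a b. pmf \<xi> D * (a + b)"] sum.cong refl)
        (auto simp: sum_prod_lists_n sum_prod_nth_lists_n[where v = "\<lambda>t. real (nv t)"] gf_def mean_size_def)
    finally show ?thesis by simp
  qed
  then show ?thesis
    using sum_trees_ge[of "\<lambda>t. gwt t * real (nv t)" N K] by (simp add: mean_size_def del: nv.simps wt.simps)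
qed

lemma mean_size_lower:
  assumes "e > 0"
  shows "eventually (\<lambda>N. (1 - \<mu>) * mean_size N > 1 - e) sequentially"
proof (cases "\<exists>C. \<forall>N. mean_size N \<le> C")
  case False
  then obtain N where N: "mean_size N > 1 / (1 - \<mu>)" by (meson not_le)
  have "(1 - \<mu>) * mean_size M > 1 - e" if "M \<ge> N" for M
  proof -
    have "mean_size M > 1 / (1 - \<mu>)" using N incseq_mean_size that by (meson less_le_trans monoD)
    then show ?thesis using mean_less_1 assms by (simp add: field_simps)
  qed
  then show ?thesis unfolding eventually_sequentially by blast
next
  case True
  then obtain s where s: "mean_size \<longlonglongrightarrow> s"
    using incseq_convergent[OF incseq_mean_size] by blast
  have le: "(\<Sum>D\<le>K. pmf \<xi> D * (1 ^ D + real D * s * 1 ^ (D - 1))) \<le> s" for K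
  proof (rule LIMSEQ_le_const2)
    show "(\<lambda>N. \<Sum>D\<le>K. pmf \<xi> D * (gf N 1 ^ D + real D * mean_size N * gf N 1 ^ (D - 1)))
       \<longlonglongrightarrow> (\<Sum>D\<le>K. pmf \<xi> D * (1 ^ D + real D * s * 1 ^ (D - 1)))"
      by (intro tendsto_intros s gf_1_tendsto)
    have "mean_size N \<le> s" for N using incseq_le[OF incseq_mean_size s] .
    then show "\<exists>N. \<forall>n\<ge>N. (\<Sum>D\<le>K. pmf \<xi> D * (gf n 1 ^ D + real D * mean_size n * gf n 1 ^ (D - 1))) \<le> s"
      using mean_size_recursion_le order_trans by blast
  qed
  have le': "(\<Sum>D\<le>K. pmf \<xi> D) + (\<Sum>D\<le>K. real D * pmf \<xi> D) * s \<le> s" for K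
    using le[of K] by (simp add: algebra_simps sum.distrib sum_distrib_left sum_distrib_right)
  have "1 + \<mu> * s \<le> s"
  proof (rule LIMSEQ_le_const2)
    show "(\<lambda>K. (\<Sum>D\<le>K. pmf \<xi> D) + (\<Sum>D\<le>K. real D * pmf \<xi> D) * s) \<longlonglongrightarrow> 1 + \<mu> * s"
      using mean sums_pmf_nat[of \<xi>] by (intro tendsto_intros) (simp_all add: sums_def_le)
  qed (use le' in auto)
  then have "(1 - \<mu>) * s > 1 - e" using assms by (simp add: algebra_simps)
  moreover have "(\<lambda>N. (1 - \<mu>) * mean_size N) \<longlonglongrightarrow> (1 - \<mu>) * s"
    by (intro tendsto_intros s)
  ultimately show ?thesis using order_tendstoD(1) by blast
qed

lemma gf_conv_Zn: "gf N x = (\<Sum>n\<le>N. Zn (pmf \<xi>) n * x ^ n)"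
proof -
  have "gf N x = (\<Sum>n\<le>N. \<Sum>t\<in>{t. nv t = n}. gwt t * x ^ nv t)"
    unfolding gf_def by (subst sum.UNION_disjoint[symmetric]) (auto simp: trees_upto_def intro!: sum.cong)
  also have "\<dots> = (\<Sum>n\<le>N. Zn (pmf \<xi>) n * x ^ n)"
    by (intro sum.cong refl) (auto simp: Zn_def sum_distrib_right)
  finally show ?thesis .
qed

lemma gf_ge: "x \<ge> 1 \<Longrightarrow> gf (Suc N) x \<ge> gf (Suc N) 1 + pmf \<xi> 0 * (x - 1)"
proof -
  assume x: "x \<ge> 1"
  have "pmf \<xi> 0 * (x - 1) = gwt (Node []) * (x ^ nv (Node []) - 1)" by simp
  also have "\<dots> \<le> (\<Sum>t\<in>trees_upto (Suc N). gwt t * (x ^ nv t - 1))"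
  proof (rule member_le_sum)
    show "Node [] \<in> trees_upto (Suc N)" by (simp add: trees_upto_def)
  qed (use x in auto)
  also have "\<dots> = gf (Suc N) x - gf (Suc N) 1"
    by (simp add: gf_def sum_subtractf algebra_simps)
  finally show ?thesis by simp
qed

text \<open>An exponentially small partition function would let the generating function of the total
  progeny extend beyond 1, and then so would that of the offspring law.\<close>
lemma Zn_not_exp_small:
  assumes p0: "pmf \<xi> 0 > 0" and rad: "\<And>r. r > 1 \<Longrightarrow> \<not> summable (\<lambda>k. pmf \<xi> k * r ^ k)" and e: "e > 0"
  shows "\<exists>n\<ge>1. Zn (pmf \<xi>) (Suc n) \<ge> pmf \<xi> 0 * exp (- (e * real n))"
proof (rule ccontr)
  assume "\<not> ?thesis"
  then have small: "Zn (pmf \<xi>) (Suc n) \<le> pmf \<xi> 0 * exp (- (e * real n))" for n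
    using Zn_1[of "pmf \<xi>"] by (cases "n \<ge> 1") (auto simp: not_le dest!: spec[of _ n])
  define x where "x = exp (e / 2)"
  have x1: "x > 1" using e by (simp add: x_def)
  have "{t. nv t = 0} = {}" by auto
  then have Z0: "Zn (pmf \<xi>) 0 = 0" by (simp only: Zn_def) simp
  have bd: "gf N x \<le> (\<Sum>n. pmf \<xi> 0 * x * exp (- (e / 2)) ^ n)" for N
  proof -
    have "gf N x \<le> gf (Suc N) x" using incseq_gf[of x] x1 by (simp add: incseq_Suc_iff)
    also have "\<dots> = (\<Sum>n\<le>N. Zn (pmf \<xi>) (Suc n) * x ^ Suc n)"
      unfolding gf_conv_Zn by (subst sum.atMost_Suc_shift) (simp add: Z0)
    also have "\<dots> \<le> (\<Sum>n\<le>N. pmf \<xi> 0 * exp (- (e * real n)) * x ^ Suc n)"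
      using small x1 by (intro sum_mono mult_right_mono) auto
    also have "\<dots> = (\<Sum>n\<le>N. pmf \<xi> 0 * x * exp (- (e / 2)) ^ n)"
    proof (intro sum.cong refl)
      fix n
      have "exp (- (e * real n)) * x ^ n = exp (- (e / 2)) ^ n"
        unfolding x_def by (simp add: exp_of_nat_mult[symmetric] exp_add[symmetric] algebra_simps)
      then show "pmf \<xi> 0 * exp (- (e * real n)) * x ^ Suc n = pmf \<xi> 0 * x * exp (- (e / 2)) ^ n"
        by (simp add: mult_ac)
    qed
    also have "\<dots> \<le> (\<Sum>n. pmf \<xi> 0 * x * exp (- (e / 2)) ^ n)"
      using e x1 by (intro sum_le_suminf summable_mult summable_geometric) auto
    finally show ?thesis .
  qed
  have x0: "x \<ge> 0" using x1 by simp
  obtain f where f: "(\<lambda>N. gf N x) \<longlonglongrightarrow> f"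
    using incseq_convergent[OF incseq_gf[OF x0], of "(\<Sum>n. pmf \<xi> 0 * x * exp (- (e / 2)) ^ n)"] bd by blast
  have "1 + pmf \<xi> 0 * (x - 1) \<le> f"
  proof (rule LIMSEQ_le)
    show "(\<lambda>N. gf (Suc N) 1 + pmf \<xi> 0 * (x - 1)) \<longlonglongrightarrow> 1 + pmf \<xi> 0 * (x - 1)"
      by (intro tendsto_intros LIMSEQ_Suc gf_1_tendsto)
    show "(\<lambda>N. gf (Suc N) x) \<longlonglongrightarrow> f" by (rule LIMSEQ_Suc[OF f])
  qed (use gf_ge x1 in auto)
  then have f1: "f > 1" using p0 x1 by (smt (verit) mult_pos_pos)
  have "summable (\<lambda>k. pmf \<xi> k * f ^ k)"
  proof (rule summableI_nonneg_bounded)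
    show "(\<Sum>k<n. pmf \<xi> k * f ^ k) \<le> f" for n
    proof -
      have nn: "0 \<le> (\<Sum>k\<le>n. pmf \<xi> k * f ^ k)" using f1 by (intro sum_nonneg) auto
      have "(\<Sum>k<n. pmf \<xi> k * f ^ k) \<le> (\<Sum>k\<le>n. pmf \<xi> k * f ^ k)"
        using f1 by (intro sum_mono2) auto
      also have "\<dots> \<le> x * (\<Sum>k\<le>n. pmf \<xi> k * f ^ k)"
        using x1 nn by (simp add: mult_le_cancel_right1)
      also have "\<dots> \<le> f" by (rule gf_limit[OF x0 f])
      finally show ?thesis .
    qed
  qed (use f1 in auto)
  then show False using rad[OF f1] by blast
qed

end

subsection \<open>Patterns among the children of vertices with large outdegree\<close>

lemma Tn_props:
  assumes w: "\<And>k. w k \<ge> 0" and Z: "Zn w n > 0"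
  shows pmf_Tn: "pmf (Tn w n) t = (if nv t = n then wt w t / Zn w n else 0)"
    and set_pmf_Tn: "set_pmf (Tn w n) \<subseteq> {t. nv t = n}"
    and prob_Tn: "measure_pmf.prob (Tn w n) A = (\<Sum>t\<in>{t. nv t = n \<and> t \<in> A}. wt w t) / Zn w n"
proof -
  have nn: "0 \<le> (if nv t = n then wt w t / Zn w n else 0)" for t
    using wt_nonneg[of w, OF w] Z by simp
  have "(\<integral>\<^sup>+ t. ennreal (if nv t = n then wt w t / Zn w n else 0) \<partial>count_space UNIV) =
     (\<Sum>t\<in>{t. nv t = n}. ennreal (if nv t = n then wt w t / Zn w n else 0))"
    by (rule nn_integral_count_space') auto
  also have "\<dots> = ennreal (\<Sum>t\<in>{t. nv t = n}. wt w t / Zn w n)"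
    using wt_nonneg[of w, OF w] Z by (subst sum_ennreal) auto
  also have "(\<Sum>t\<in>{t. nv t = n}. wt w t / Zn w n) = 1"
    using Z by (simp add: sum_divide_distrib[symmetric] Zn_def)
  finally show pmf: "pmf (Tn w n) t = (if nv t = n then wt w t / Zn w n else 0)" for t
    unfolding Tn_def using nn by (subst pmf_embed_pmf) auto
  show set: "set_pmf (Tn w n) \<subseteq> {t. nv t = n}"
    by (auto simp: set_pmf_eq pmf split: if_splits)
  have "measure_pmf.prob (Tn w n) A = measure_pmf.prob (Tn w n) {t. nv t = n \<and> t \<in> A}"
    using set by (intro measure_pmf.finite_measure_eq_AE AE_pmfI) auto
  also have "\<dots> = (\<Sum>t\<in>{t. nv t = n \<and> t \<in> A}. pmf (Tn w n) t)"
    by (rule measure_measure_pmf_finite) (rule finite_subset[OF _ finite_nv_eq[of n]], auto)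
  also have "\<dots> = (\<Sum>t\<in>{t. nv t = n \<and> t \<in> A}. wt w t) / Zn w n"
    by (simp add: pmf sum_divide_distrib)
  finally show "measure_pmf.prob (Tn w n) A = (\<Sum>t\<in>{t. nv t = n \<and> t \<in> A}. wt w t) / Zn w n" .
qed

definition big :: "real \<Rightarrow> (ptree list \<Rightarrow> nat) \<Rightarrow> ptree \<Rightarrow> nat" where
  "big Om h s = (if real (outdeg s) > Om then h (kids s) else 0)"

lemma big_Node: "big Om h (Node ts) = (if real (length ts) > Om then h ts else 0)"
  by (simp add: big_def outdeg_def)

definition matches :: "'a list \<Rightarrow> 'a list \<Rightarrow> nat" where
  "matches cs ts = card {i. i + length cs \<le> length ts \<and> take (length cs) (drop i ts) = cs}"

definition block_matches :: "'a list \<Rightarrow> 'a list \<Rightarrow> nat" where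
  "block_matches cs ts = card {j. Suc j * length cs \<le> length ts \<and> take (length cs) (drop (j * length cs) ts) = cs}"

lemma block_matches_append:
  assumes "length us = length cs" "cs \<noteq> []"
  shows "block_matches cs (us @ vs) = (if us = cs then 1 else 0) + block_matches cs vs"
proof -
  let ?M = "length cs"
  let ?S = "{j. Suc j * ?M \<le> length vs \<and> take ?M (drop (j * ?M) vs) = cs}"
  have fin: "finite ?S"
  proof (rule finite_subset[of _ "{..length vs}"], clarsimp)
    fix j assume "?M + j * ?M \<le> length vs"
    moreover have "j * 1 \<le> j * ?M" using assms(2) by (intro mult_le_mono2) (simp add: Suc_le_eq)
    ultimately show "j \<le> length vs" by linarith
  qed simp
  have eq: "{j. Suc j * ?M \<le> length (us @ vs) \<and> take ?M (drop (j * ?M) (us @ vs)) = cs} =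
      (if us = cs then {0} else {}) \<union> Suc ` ?S" (is "?L = ?R")
  proof (intro set_eqI)
    fix j show "j \<in> ?L \<longleftrightarrow> j \<in> ?R"
      using assms by (cases j) (auto simp: image_iff)
  qed
  show ?thesis
    unfolding block_matches_def eq using fin
    by (subst card_Un_disjoint) (auto simp: card_image)
qed

lemma matches_conv_block_matches:
  assumes "cs \<noteq> []"
  shows "matches cs ts = (\<Sum>r<length cs. block_matches cs (drop r ts))"
proof -
  let ?M = "length cs"
  let ?S = "\<lambda>r. {j. Suc j * ?M \<le> length (drop r ts) \<and> take ?M (drop (j * ?M) (drop r ts)) = cs}"
  have M: "?M > 0" using assms by simp
  have fin: "finite (?S r)" for r
  proof (rule finite_subset[of _ "{..length ts}"], clarsimp)
    fix j assume "?M + j * ?M \<le> length ts - r"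
    moreover have "j * 1 \<le> j * ?M" using M by (intro mult_le_mono2) (simp only: Suc_leI One_nat_def)
    ultimately show "j \<le> length ts" by linarith
  qed simp
  have "bij_betw (\<lambda>(r, j). j * ?M + r) (Sigma {..<?M} ?S) {i. i + ?M \<le> length ts \<and> take ?M (drop i ts) = cs}"
  proof (rule bij_betw_byWitness[where f' = "\<lambda>i. (i mod ?M, i div ?M)"])
    show "(\<lambda>(r, j). j * ?M + r) ` Sigma {..<?M} ?S \<subseteq> {i. i + ?M \<le> length ts \<and> take ?M (drop i ts) = cs}"
    proof clarsimp
      fix r j assume "?M + j * ?M \<le> length ts - r" "r < ?M"
      then show "j * ?M + r + ?M \<le> length ts" using M by linarith
    qed
    show "(\<lambda>i. (i mod ?M, i div ?M)) ` {i. i + ?M \<le> length ts \<and> take ?M (drop i ts) = cs} \<subseteq> Sigma {..<?M} ?S"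
    proof
      fix p assume "p \<in> (\<lambda>i. (i mod ?M, i div ?M)) ` {i. i + ?M \<le> length ts \<and> take ?M (drop i ts) = cs}"
      then obtain i where p: "p = (i mod ?M, i div ?M)" and i: "i + ?M \<le> length ts" "take ?M (drop i ts) = cs"
        by blast
      have "Suc (i div ?M) * ?M + i mod ?M = i + ?M" by simp
      then have "Suc (i div ?M) * ?M \<le> length (drop (i mod ?M) ts)"
        using i unfolding length_drop by linarith
      then show "p \<in> Sigma {..<?M} ?S" using p i M by (simp add: add.commute)
    qed
  qed (use M in auto)
  then have "matches cs ts = card (Sigma {..<?M} ?S)"
    unfolding matches_def by (simp add: bij_betw_same_card)
  also have "\<dots> = (\<Sum>r<?M. block_matches cs (drop r ts))"
    using fin by (simp add: card_SigmaI block_matches_def)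
  finally show ?thesis .
qed

lemma block_matches_short: "length ts < length cs \<Longrightarrow> block_matches cs ts = 0"
  by (auto simp: block_matches_def)

text \<open>The factor \<open>y\<close> per block exactly offsets the penalty \<open>z\<close> per matching block.\<close>
lemma sum_blocks_le_1:
  fixes u :: "'a \<Rightarrow> real"
  assumes A: "finite A" and u: "\<And>x. u x \<ge> 0" "sum u A \<le> 1" and cs: "set cs \<subseteq> A" "cs \<noteq> []"
    and q: "q = prod_list (map u cs)" and z: "0 < z" "z \<le> 1" and y: "y = 1 / (1 - q * (1 - z))"
  shows "(\<Sum>ts\<in>lists_n A n. prod_list (map u ts) * (y ^ (length ts div length cs) * z ^ block_matches cs ts)) \<le> 1"
proof (induction n rule: less_induct)
  case (less n)
  let ?M = "length cs"
  have su: "sum u A \<ge> 0" using u by (simp add: sum_nonneg)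
  have pu: "prod_list (map u ts) \<ge> 0" for ts by (induction ts) (auto simp: u)
  have "prod_list (map u cs) \<le> (\<Sum>ts\<in>lists_n A ?M. prod_list (map u ts))"
    using A cs pu by (intro member_le_sum) (auto simp: lists_n_def[of A ?M] finite_lists_length_eq)
  then have q1: "q \<le> 1" using su u(2) by (simp add: q sum_prod_lists_n power_le_one order_trans)
  have "q * (1 - z) \<le> 1 * (1 - z)" using q1 z by (intro mult_right_mono) auto
  then have pos: "1 - q * (1 - z) > 0" using z by simp
  then have y0: "y > 0" using y by simp
  show ?case
  proof (cases "n < ?M")
    case True
    have "(\<Sum>ts\<in>lists_n A n. prod_list (map u ts) * (y ^ (length ts div length cs) * z ^ block_matches cs ts)) =
        (\<Sum>ts\<in>lists_n A n. prod_list (map u ts))"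
      using True by (intro sum.cong refl) (auto simp: lists_n_def block_matches_short)
    then show ?thesis using su u by (simp add: sum_prod_lists_n power_le_one)
  next
    case False
    let ?g = "\<lambda>ts. prod_list (map u ts) * (y ^ (length ts div length cs) * z ^ block_matches cs ts)"
    have n: "n = ?M + (n - ?M)" using False by simp
    have pull: "(\<Sum>us\<in>X. y * f us * c) = y * (\<Sum>us\<in>X. f us) * c" for X :: "'a list set" and f c
      by (simp add: sum_distrib_right sum_distrib_left)
    have "sum ?g (lists_n A n) = (\<Sum>us\<in>lists_n A ?M. \<Sum>vs\<in>lists_n A (n - ?M). ?g (us @ vs))"
      by (subst n, rule sum_lists_n_add)
    also have "\<dots> = (\<Sum>us\<in>lists_n A ?M. y * (prod_list (map u us) * (if us = cs then z else 1)) * sum ?g (lists_n A (n - ?M)))"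
      unfolding sum_distrib_left using cs(2)
      by (intro sum.cong refl) (auto simp: lists_n_def block_matches_append)
    also have "\<dots> = y * (\<Sum>us\<in>lists_n A ?M. prod_list (map u us) * (if us = cs then z else 1)) * sum ?g (lists_n A (n - ?M))"
      by (rule pull)
    also have "(\<Sum>us\<in>lists_n A ?M. prod_list (map u us) * (if us = cs then z else 1)) =
       (\<Sum>us\<in>lists_n A ?M. prod_list (map u us) - (if us = cs then q * (1 - z) else 0))"
      by (intro sum.cong refl) (auto simp: q algebra_simps)
    also have "\<dots> = sum u A ^ ?M - q * (1 - z)"
    proof -
      have "cs \<in> lists_n A ?M" using cs by (simp add: lists_n_def)
      then show ?thesis using A by (simp add: sum_subtractf sum_prod_lists_n)
    qed
    also have "y * (sum u A ^ ?M - q * (1 - z)) * sum ?g (lists_n A (n - ?M)) \<le> y * (1 - q * (1 - z)) * 1"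
    proof (rule mult_mono[OF mult_left_mono])
      show "sum ?g (lists_n A (n - ?M)) \<le> 1" 
        using False cs(2) length_greater_0_conv[of cs] by (intro less) linarith
      show "sum u A ^ ?M - q * (1 - z) \<le> 1 - q * (1 - z)" using su u by (simp add: power_le_one)
      show "0 \<le> sum ?g (lists_n A (n - ?M))" using pu y0 z by (intro sum_nonneg mult_nonneg_nonneg) auto
    qed (use y0 pos in auto)
    also have "\<dots> = 1" using y pos by simp
    finally show ?thesis .
  qed
qed

lemma sum_blocks_drop_le_1:
  fixes u :: "'a \<Rightarrow> real"
  assumes A: "finite A" and u: "\<And>x. u x \<ge> 0" "sum u A \<le> 1" and cs: "set cs \<subseteq> A" "cs \<noteq> []"
    and q: "q = prod_list (map u cs)" and z: "0 < z" "z \<le> 1" and y: "y = 1 / (1 - q * (1 - z))"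
  shows "(\<Sum>ts\<in>lists_n A n. prod_list (map u ts) *
      (y ^ (length (drop r ts) div length cs) * z ^ block_matches cs (drop r ts))) \<le> 1"
proof (cases "n < r")
  case True
  have su: "sum u A \<ge> 0" using u by (simp add: sum_nonneg)
  have "(\<Sum>ts\<in>lists_n A n. prod_list (map u ts) *
      (y ^ (length (drop r ts) div length cs) * z ^ block_matches cs (drop r ts))) = (\<Sum>ts\<in>lists_n A n. prod_list (map u ts))"
    using True cs by (intro sum.cong refl) (auto simp: lists_n_def block_matches_short)
  then show ?thesis using su u by (simp add: sum_prod_lists_n power_le_one)
next
  case False
  have su: "sum u A \<ge> 0" using u by (simp add: sum_nonneg)
  let ?g = "\<lambda>ts. prod_list (map u ts) * (y ^ (length ts div length cs) * z ^ block_matches cs ts)"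
  have n: "n = r + (n - r)" using False by simp
  have "(\<Sum>ts\<in>lists_n A n. prod_list (map u ts) *
      (y ^ (length (drop r ts) div length cs) * z ^ block_matches cs (drop r ts))) =
      (\<Sum>us\<in>lists_n A r. \<Sum>vs\<in>lists_n A (n - r). prod_list (map u us) * ?g vs)"
    by (subst n, subst sum_lists_n_add, intro sum.cong refl) (auto simp: lists_n_def mult_ac)
  also have "\<dots> = sum u A ^ r * sum ?g (lists_n A (n - r))"
    by (simp add: sum_distrib_left[symmetric] sum_distrib_right[symmetric] sum_prod_lists_n)
  also have "\<dots> \<le> sum u A ^ r * 1"
    using sum_blocks_le_1[OF assms] su by (intro mult_left_mono) auto
  also have "\<dots> \<le> 1" using su u by (simp add: power_le_one)
  finally show ?thesis .
qed

lemma tot_big_small: "real (nv t) \<le> Om \<Longrightarrow> tot (big Om h) t = 0"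
proof -
  assume t: "real (nv t) \<le> Om"
  have "big Om h (the (subt t p)) = 0" if p: "p \<in> verts t" for p
  proof -
    obtain s where s: "subt t p = Some s" using p by (auto simp: verts_def)
    have "outdeg s < nv t" using nv_subt[OF s] outdeg_less_nv[of s] by simp
    then show ?thesis using s t by (simp add: big_def)
  qed
  then show ?thesis by (simp add: tot_def)
qed

context subcritical
begin

text \<open>The induction starts at \<open>N = B\<close>: up to this size no vertex is big, so the trees in \<open>cs\<close> are already
  counted, with weight unchanged, and the probability of a match is \<open>q\<close> at every later stage.\<close>
lemma sum_block_weights_le_1:
  assumes cs: "cs \<noteq> []" "\<And>c. c \<in> set cs \<Longrightarrow> nv c \<le> B" and Om: "real B \<le> Om"
    and q: "q = prod_list (map gwt cs)" and z: "0 < z" "z \<le> 1" and y: "y = 1 / (1 - q * (1 - z))" and N: "N \<ge> B"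
  shows "(\<Sum>t\<in>trees_upto N. gwt t * y ^ tot (big Om (\<lambda>ts. length (drop r ts) div length cs)) t *
           z ^ tot (big Om (\<lambda>ts. block_matches cs (drop r ts))) t) \<le> 1" (is "(\<Sum>t\<in>_. ?u t) \<le> 1")
  using N
proof (induction N rule: dec_induct)
  case base
  have "(\<Sum>t\<in>trees_upto B. ?u t) = gf B 1"
    unfolding gf_def using Om by (intro sum.cong refl) (auto simp: trees_upto_def tot_big_small)
  then show ?case using gf_1_le by simp
next
  case (step N)
  let ?A = "trees_upto N"
  have q0: "q \<ge> 0" unfolding q by (induction cs) auto
  have csA: "set cs \<subseteq> ?A" using cs step by (force simp: trees_upto_def)
  have ucs: "?u c = gwt c" if "c \<in> set cs" for c
    using cs(2)[OF that] Om by (simp add: tot_big_small)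
  have q': "q = prod_list (map ?u cs)" unfolding q using ucs by (metis (no_types, lifting) map_eq_conv)
  have "q \<le> 1"
  proof -
    have "q \<le> (\<Sum>ts\<in>lists_n ?A (length cs). prod_list (map gwt ts))"
      unfolding q by (intro member_le_sum) (auto simp: lists_n_def csA finite_lists_length_eq prod_list_conv_lessThan prod_nonneg subsetD[OF csA])
    also have "\<dots> = gf N 1 ^ length cs" by (simp add: sum_prod_lists_n gf_def)
    also have "\<dots> \<le> 1" using gf_1_le gf_nonneg by (simp add: power_le_one)
    finally show ?thesis .
  qed
  then have "q * (1 - z) \<le> 1 * (1 - z)" using z by (intro mult_right_mono) auto
  then have y0: "y > 0" using y z by simp
  have u0: "?u t \<ge> 0" for t using y0 z by simp
  have node: "?u (Node ts) = pmf \<xi> (length ts) * (prod_list (map ?u ts) * (if real (length ts) > Om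
      then y ^ (length (drop r ts) div length cs) * z ^ block_matches cs (drop r ts) else 1))" for ts
  proof -
    have "prod_list (map ?u ts) = prod_list (map gwt ts) *
       y ^ sum_list (map (tot (big Om (\<lambda>ts. length (drop r ts) div length cs))) ts) *
       z ^ sum_list (map (tot (big Om (\<lambda>ts. block_matches cs (drop r ts)))) ts)"
      by (simp only: prod_list_mult_power)
    then show ?thesis
      by (simp add: tot_Node big_Node sum_list_conv_lessThan power_add)
  qed
  have "(\<Sum>t\<in>trees_upto (Suc N). ?u t) \<le> (\<Sum>D\<le>N. \<Sum>ts\<in>lists_n ?A D. ?u (Node ts))"
    by (rule sum_trees_Suc_le) (rule u0)
  also have "\<dots> \<le> (\<Sum>D\<le>N. pmf \<xi> D * 1)"
  proof (intro sum_mono)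
    fix D
    have "(\<Sum>ts\<in>lists_n ?A D. ?u (Node ts)) = pmf \<xi> D * (\<Sum>ts\<in>lists_n ?A D. prod_list (map ?u ts) * (if real D > Om
      then y ^ (length (drop r ts) div length cs) * z ^ block_matches cs (drop r ts) else 1))"
      unfolding node sum_distrib_left by (intro sum.cong refl) (auto simp: lists_n_def)
    also have "\<dots> \<le> pmf \<xi> D * 1"
    proof (intro mult_left_mono)
      show "(\<Sum>ts\<in>lists_n ?A D. prod_list (map ?u ts) * (if real D > Om
        then y ^ (length (drop r ts) div length cs) * z ^ block_matches cs (drop r ts) else 1)) \<le> 1"
      proof (cases "real D > Om")
        case True
        then show ?thesis
          using sum_blocks_drop_le_1[OF finite_trees_upto u0 step.IH csA cs(1) q' z y, of r D] by simp
      next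
        case False
        have "sum ?u ?A ^ D \<le> 1" using step.IH by (intro power_le_one sum_nonneg u0)
        then show ?thesis using False by (simp add: sum_prod_lists_n)
      qed
    qed simp
    finally show "(\<Sum>ts\<in>lists_n ?A D. ?u (Node ts)) \<le> pmf \<xi> D * 1" .
  qed
  also have "\<dots> \<le> 1"
    using sum_le_suminf[OF sums_summable[OF sums_pmf_nat], of "{..N}" \<xi>] sums_unique[OF sums_pmf_nat, of \<xi>] by simp
  finally show ?case .
qed

end

lemma suminf_big_degrees:
  "(\<Sum>k. if real k > Om then real k * Nk t k else 0) = real (tot (big Om length) t)"
proof -
  let ?d = "\<lambda>p. outdeg (the (subt t p))"
  let ?f = "\<lambda>k. if real k > Om then real k * Nk t k else 0"
  have le: "?d p < nv t" if p: "p \<in> verts t" for p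
  proof -
    obtain s where s: "subt t p = Some s" using p by (auto simp: verts_def)
    show ?thesis using nv_subt[OF s] outdeg_less_nv[of s] s by simp
  qed
  have "(\<Sum>k. ?f k) = (\<Sum>k<nv t. ?f k)"
  proof (rule suminf_finite)
    fix k assume "k \<notin> {..<nv t}"
    then have "{p \<in> verts t. ?d p = k} = {}" using le by fastforce
    then have "Nk t k = 0" unfolding Nk_def by (simp only:) simp
    then show "?f k = 0" by simp
  qed simp
  also have "\<dots> = (\<Sum>k<nv t. \<Sum>p\<in>{p \<in> verts t. ?d p = k}. if real (?d p) > Om then real (?d p) else 0)"
    by (intro sum.cong refl) (simp add: Nk_def mult.commute)
  also have "\<dots> = (\<Sum>p\<in>verts t. if real (?d p) > Om then real (?d p) else 0)"
    by (rule sum.group) (use le in auto)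
  also have "\<dots> = real (tot (big Om length) t)"
    unfolding tot_def big_def of_nat_sum by (intro sum.cong refl) (simp add: outdeg_def)
  finally show ?thesis .
qed

lemma tot_mono_nat: "(\<And>s. h s \<le> g s) \<Longrightarrow> tot h t \<le> tot g t" for h g :: "ptree \<Rightarrow> nat"
  unfolding tot_def by (intro sum_mono)

lemma tot_big_length_le: "tot (big Om length) t < nv t"
proof -
  have "tot (big Om length) t \<le> tot outdeg t"
    by (intro tot_mono_nat) (simp add: big_def outdeg_def)
  then show ?thesis using tot_outdeg[of t] by simp
qed

lemma tot_big_count_le: "Om * real (tot (big Om (\<lambda>_. 1)) t) \<le> real (tot (big Om length) t)"
  unfolding tot_def of_nat_sum sum_distrib_left by (intro sum_mono) (auto simp: big_def outdeg_def)

lemma tot_big_sum: "tot (big Om (\<lambda>ts. \<Sum>r\<in>R. h r ts)) t = (\<Sum>r\<in>R. tot (big Om (h r)) t)"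
  unfolding tot_def by (subst sum.swap) (auto simp: big_def intro!: sum.cong)

definition windows :: "real \<Rightarrow> ptree list \<Rightarrow> ptree \<Rightarrow> real" where
  "windows Om cs t = real (tot (big Om (matches cs)) t)"

lemma windows_nonneg: "windows Om cs t \<ge> 0"
  by (simp add: windows_def)

lemma windows_conv_blocks:
  "cs \<noteq> [] \<Longrightarrow> windows Om cs t = (\<Sum>r<length cs. real (tot (big Om (\<lambda>ts. block_matches cs (drop r ts))) t))"
proof -
  assume cs: "cs \<noteq> []"
  have "matches cs = (\<lambda>ts. \<Sum>r<length cs. block_matches cs (drop r ts))"
    using matches_conv_block_matches[OF cs] by blast
  then show ?thesis by (simp add: windows_def tot_big_sum)
qed

lemma tot_blocks_ge:
  assumes "r < M"
  shows "real (tot (big Om (\<lambda>ts. length (drop r ts) div M)) t) \<ge>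
    real (tot (big Om length) t) / real M - 2 * real (tot (big Om (\<lambda>_. 1)) t)"
proof -
  have M: "M > 0" using assms by simp
  have *: "real D / real M - 2 \<le> real ((D - r) div M)" for D
  proof -
    have "D < ((D - r) div M + 2) * M"
      unfolding add_mult_distrib
      using div_mult_mod_eq[of "D - r" M] mod_less_divisor[OF M, of "D - r"] assms by linarith
    then have "real D < (real ((D - r) div M) + 2) * real M"
      by (metis of_nat_add of_nat_less_iff of_nat_mult of_nat_numeral)
    then show ?thesis using M by (simp add: field_simps)
  qed
  show ?thesis
    unfolding tot_def of_nat_sum sum_divide_distrib sum_distrib_left sum_subtractf[symmetric]
    by (intro sum_mono) (use * in \<open>auto simp: big_def\<close>)
qed

lemma windows_ge:
  assumes cs: "cs \<noteq> []" and q: "0 \<le> q" "q \<le> 1" and Om: "Om > 0"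
    and blocks: "\<And>r. r < length cs \<Longrightarrow> real (tot (big Om (\<lambda>ts. block_matches cs (drop r ts))) t) \<ge>
      q * real (tot (big Om (\<lambda>ts. length (drop r ts) div length cs)) t) - d"
  shows "windows Om cs t \<ge> q * real (tot (big Om length) t) - real (length cs) * (2 * real (nv t) / Om + d)"
proof -
  let ?M = "real (length cs)" and ?L = "real (tot (big Om length) t)" and ?C = "real (tot (big Om (\<lambda>_. 1)) t)"
  have C: "?C \<le> real (nv t) / Om"
    using tot_big_count_le[of Om t] tot_big_length_le[of Om t] Om by (simp add: field_simps)
  have "q * ?C \<le> ?C" using q by (simp add: mult_left_le_one_le)
  also note C
  finally have qC: "q * ?C \<le> real (nv t) / Om" .
  define X where "X = real (nv t) / Om"
  have "q * ?L / ?M - 2 * X - d \<le> real (tot (big Om (\<lambda>ts. block_matches cs (drop r ts))) t)"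
    if r: "r < length cs" for r
  proof -
    have "q * (?L / ?M - 2 * ?C) \<le> q * real (tot (big Om (\<lambda>ts. length (drop r ts) div length cs)) t)"
      using tot_blocks_ge[OF r, of Om t] q by (intro mult_left_mono) auto
    then show ?thesis using blocks[OF r] qC unfolding X_def[symmetric] by (simp add: algebra_simps)
  qed
  then have "(\<Sum>r<length cs. q * ?L / ?M - 2 * X - d) \<le> windows Om cs t"
    unfolding windows_conv_blocks[OF cs] by (intro sum_mono) auto
  moreover have "(\<Sum>r<length cs. q * ?L / ?M - 2 * X - d) =
      q * ?L - ?M * (2 * real (nv t) / Om + d)"
    using cs by (simp add: X_def algebra_simps)
  ultimately show ?thesis by simp
qed

context subcritical
begin

lemma gwt_le_1: "gwt t \<le> 1"
  unfolding wt_conv_prod by (intro prod_le_1) (auto simp: pmf_le_1)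

lemma prod_list_gwt: "0 \<le> prod_list (map gwt cs)" "prod_list (map gwt cs) \<le> 1"
  by (induction cs) (auto intro!: mult_le_one gwt_le_1)

text \<open>Chernoff's bound, with \<open>d\<close> serving both as the exponential parameter and as the deviation.\<close>
lemma prob_few_block_matches:
  assumes cs: "cs \<noteq> []" "\<And>c. c \<in> set cs \<Longrightarrow> nv c \<le> B" and Om: "real B \<le> Om"
    and q: "q = prod_list (map gwt cs)" and d: "0 < d" and n: "n \<ge> B" and Z: "Zn (pmf \<xi>) n > 0"
  shows "measure_pmf.prob (Tn (pmf \<xi>) n) {t. real (tot (big Om (\<lambda>ts. block_matches cs (drop r ts))) t) <
      q * real (tot (big Om (\<lambda>ts. length (drop r ts) div length cs)) t) - 2 * d * real n}
    \<le> exp (- (d * d * real n)) / Zn (pmf \<xi>) n"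
proof -
  define z y where "z = exp (- d)" and "y = 1 / (1 - q * (1 - z))"
  define S where "S = {t. nv t = n \<and> real (tot (big Om (\<lambda>ts. block_matches cs (drop r ts))) t) <
      q * real (tot (big Om (\<lambda>ts. length (drop r ts) div length cs)) t) - 2 * d * real n}"
  have q01: "0 \<le> q" "q \<le> 1" using prod_list_gwt q by auto
  have z: "0 < z" "z < 1" using d by (auto simp: z_def)
  let ?C = "\<lambda>t. tot (big Om (\<lambda>ts. block_matches cs (drop r ts))) t"
  let ?N = "\<lambda>t. tot (big Om (\<lambda>ts. length (drop r ts) div length cs)) t"
  have xlt: "q * (1 - z) < 1" using q01 z by (smt (verit) mult_left_le_one_le)
  have "1 + d \<le> exp d" by (rule exp_ge_add_one_self)
  then have "z \<le> 1 / (1 + d)" using d by (simp add: z_def exp_minus divide_inverse le_imp_inverse_le)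
  then have "d / (1 + d) \<le> 1 - z" using d by (simp add: field_simps)
  moreover have "d * (1 - d) \<le> d / (1 + d)" using d by (simp add: field_simps)
  ultimately have "q * (d * (1 - d)) \<le> q * (1 - z)" using q01 by (intro mult_left_mono) auto
  moreover have "exp (q * (1 - z)) \<le> y"
  proof -
    have "exp x \<le> 1 / (1 - x)" if "x < 1" for x :: real
      using exp_ge_add_one_self[of "- x"] that by (simp add: exp_minus field_simps)
    then show ?thesis using xlt by (simp add: y_def)
  qed
  ultimately have y: "exp (q * (d * (1 - d))) \<le> y" by (meson exp_le_cancel_iff order_trans)
  have y0: "y > 0" using xlt by (simp add: y_def)
  have S: "S \<subseteq> trees_upto n" "finite S"
    using finite_subset[of S "trees_upto n"] by (auto simp: S_def trees_upto_def)
  have "exp (d * d * real n) * (\<Sum>t\<in>S. gwt t) = (\<Sum>t\<in>S. gwt t * exp (d * d * real n))"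
    by (subst mult.commute) (rule sum_distrib_right)
  also have "\<dots> \<le> (\<Sum>t\<in>S. gwt t * (y ^ ?N t * z ^ ?C t))"
  proof (intro sum_mono mult_left_mono)
    fix t assume t: "t \<in> S"
    have "?N t \<le> tot (big Om length) t" by (intro tot_mono_nat) (auto simp: big_def intro: order_trans[OF div_le_dividend])
    then have Nn: "real (?N t) \<le> real n" using tot_big_length_le[of Om t] t by (simp add: S_def)
    have "q * real (?N t) \<le> 1 * real n" using q01 Nn by (intro mult_mono) auto
    then have qN: "d * (q * real (?N t)) \<le> d * real n" using d by simp
    have "real (?C t) \<le> q * real (?N t) - 2 * d * real n" using t by (simp add: S_def)
    then have "d * real n \<le> q * (1 - d) * real (?N t) - real (?C t)"
      using qN by (simp add: algebra_simps)
    then have "d * (d * real n) \<le> d * (q * (1 - d) * real (?N t) - real (?C t))"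
      using d by (intro mult_left_mono) auto
    then have "exp (d * d * real n) \<le> exp (real (?N t) * (q * (d * (1 - d))) + real (?C t) * (- d))"
      by (simp add: algebra_simps)
    also have "\<dots> = exp (q * (d * (1 - d))) ^ ?N t * z ^ ?C t"
      by (simp only: exp_add exp_of_nat_mult z_def)
    also have "\<dots> \<le> y ^ ?N t * z ^ ?C t"
      using y z by (intro mult_right_mono power_mono) auto
    finally show "exp (d * d * real n) \<le> y ^ ?N t * z ^ ?C t" .
  qed simp
  also have "\<dots> \<le> (\<Sum>t\<in>trees_upto n. gwt t * (y ^ ?N t * z ^ ?C t))"
    using S y0 z by (intro sum_mono2) auto
  also have "\<dots> \<le> 1"
    using sum_block_weights_le_1[OF cs Om q z(1) less_imp_le[OF z(2)] y_def n, of r] by (simp only: mult.assoc)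
  finally have "(\<Sum>t\<in>S. gwt t) \<le> exp (- (d * d * real n))"
    by (simp add: exp_minus field_simps)
  moreover have "measure_pmf.prob (Tn (pmf \<xi>) n) {t. real (?C t) < q * real (?N t) - 2 * d * real n} = (\<Sum>t\<in>S. gwt t) / Zn (pmf \<xi>) n"
    by (subst prob_Tn) (simp_all add: Z S_def)
  ultimately show ?thesis using Z by (simp add: divide_right_mono)
qed

lemma windows_prob_tendsto:
  fixes \<Omega> :: "nat \<Rightarrow> real"
  assumes F: "F \<le> sequentially" and Om: "filterlim \<Omega> at_top sequentially"
    and low: "\<And>e. e > 0 \<Longrightarrow> \<exists>b>0. eventually (\<lambda>n. Zn (pmf \<xi>) n \<ge> b * exp (- (e * real n))) F"
    and conc: "\<And>\<epsilon>. \<epsilon> > 0 \<Longrightarrow> ((\<lambda>n. measure_pmf.prob (Tn (pmf \<xi>) n)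
        {t. \<bar>real (tot (big (\<Omega> n) length) t) - (1 - \<mu>) * real n\<bar> > \<epsilon> * real n}) \<longlongrightarrow> 0) F"
    and cs: "cs \<noteq> []" and d: "d > 0"
  shows "((\<lambda>n. measure_pmf.prob (Tn (pmf \<xi>) n)
        {t. windows (\<Omega> n) cs t < ((1 - \<mu>) * prod_list (map gwt cs) - d) * real n}) \<longlongrightarrow> 0) F"
proof -
  define q where "q = prod_list (map gwt cs)"
  define M where "M = length cs"
  define e where "e = d / (1 + 4 * real M)"
  have M: "M > 0" using cs by (simp add: M_def)
  have e: "e > 0" using d by (simp add: e_def add_pos_nonneg)
  have "1 + 4 * real M > 0" by (simp add: add_pos_nonneg)
  then have "e * (1 + 4 * real M) = d" unfolding e_def by simp
  then have de: "d = e + 4 * real M * e" by (simp add: algebra_simps)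
  have q01: "0 \<le> q" "q \<le> 1" using prod_list_gwt q_def by auto
  define B where "B = Max (nv ` set cs)"
  have B: "nv c \<le> B" if "c \<in> set cs" for c using that by (simp add: B_def)
  obtain b where b: "b > 0" and Zb: "eventually (\<lambda>n. Zn (pmf \<xi>) n \<ge> b * exp (- (e * e / 2 * real n))) F"
    using low[of "e * e / 2"] e by auto
  let ?P = "\<lambda>n. measure_pmf.prob (Tn (pmf \<xi>) n)"
  let ?A = "\<lambda>n. {t. \<bar>real (tot (big (\<Omega> n) length) t) - (1 - \<mu>) * real n\<bar> > e * real n}"
  let ?E = "\<lambda>n r. {t. real (tot (big (\<Omega> n) (\<lambda>ts. block_matches cs (drop r ts))) t) <
      q * real (tot (big (\<Omega> n) (\<lambda>ts. length (drop r ts) div length cs)) t) - 2 * e * real n}"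
  let ?W = "\<lambda>n. {t. windows (\<Omega> n) cs t < ((1 - \<mu>) * q - d) * real n}"
  have evs: "eventually (\<lambda>n. \<Omega> n \<ge> real B \<and> \<Omega> n \<ge> 1 / e \<and> n \<ge> B) F"
    using Om F by (intro filter_leD[OF F] eventually_conj eventually_ge_at_top)
      (auto simp: filterlim_at_top)
  have "eventually (\<lambda>n. ?P n (?W n) \<le> ?P n (?A n) + real M * (exp (- (e * e / 2 * real n)) / b)) F"
    using evs Zb
  proof eventually_elim
    case (elim n)
    have Z: "Zn (pmf \<xi>) n > 0" using elim(2) b by (smt (verit) exp_gt_zero mult_pos_pos)
    have Om0: "\<Omega> n > 0" using elim(1) e by (smt (verit) divide_pos_pos)
    have sub: "{t. nv t = n \<and> t \<in> ?W n} \<subseteq> ?A n \<union> (\<Union>r<M. ?E n r)"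
    proof (rule subsetI, rule ccontr)
      fix t assume t: "t \<in> {t. nv t = n \<and> t \<in> ?W n}" and nt: "t \<notin> ?A n \<union> (\<Union>r<M. ?E n r)"
      let ?L = "real (tot (big (\<Omega> n) length) t)"
      have "windows (\<Omega> n) cs t \<ge> q * ?L - real (length cs) * (2 * real (nv t) / \<Omega> n + 2 * e * real n)"
        using nt by (intro windows_ge cs q01 Om0) (auto simp: not_less M_def)
      moreover have "2 * real (nv t) / \<Omega> n \<le> 2 * e * real n"
      proof -
        have "1 \<le> e * \<Omega> n" using elim(1) e by (simp add: field_simps)
        then have "real n \<le> e * \<Omega> n * real n" by (simp add: mult_le_cancel_right1)
        then show ?thesis using Om0 t by (simp add: field_simps)
      qed
      then have "real M * (2 * real (nv t) / \<Omega> n + 2 * e * real n) \<le> real M * (4 * e * real n)"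
        by (intro mult_left_mono) auto
      moreover have "q * ?L \<ge> q * ((1 - \<mu>) * real n - e * real n)"
        using nt q01 by (intro mult_left_mono) auto
      moreover have "q * (e * real n) \<le> 1 * (e * real n)" using q01 e by (intro mult_right_mono) auto
      ultimately have "windows (\<Omega> n) cs t \<ge> ((1 - \<mu>) * q - d) * real n"
        by (simp add: de M_def algebra_simps)
      then show False using t by simp
    qed
    have "?P n (?W n) = ?P n {t. nv t = n \<and> t \<in> ?W n}"
      using set_pmf_Tn[of "pmf \<xi>" n] Z by (intro measure_pmf.finite_measure_eq_AE AE_pmfI) auto
    also have "\<dots> \<le> ?P n (?A n \<union> (\<Union>r<M. ?E n r))"
      using sub by (intro measure_pmf.finite_measure_mono) auto
    also have "\<dots> \<le> ?P n (?A n) + ?P n (\<Union>r<M. ?E n r)"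
      by (rule measure_Un_le) auto
    also have "?P n (\<Union>r<M. ?E n r) \<le> (\<Sum>r<M. ?P n (?E n r))"
      by (rule measure_UNION_le) auto
    also have "\<dots> \<le> (\<Sum>r<M. exp (- (e * e / 2 * real n)) / b)"
    proof (intro sum_mono)
      fix r
      have "?P n (?E n r) \<le> exp (- (e * e * real n)) / Zn (pmf \<xi>) n"
        using elim(1) by (intro prob_few_block_matches[where B = B] cs B q_def e Z) auto
      also have "\<dots> \<le> exp (- (e * e * real n)) / (b * exp (- (e * e / 2 * real n)))"
        using elim(2) b Z by (intro divide_left_mono) auto
      also have "\<dots> = exp (- (e * e / 2 * real n)) / b"
      proof -
        have "exp (- (e * e * real n)) = exp (- (e * e / 2 * real n)) * exp (- (e * e / 2 * real n))"
          by (simp add: exp_add[symmetric])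
        then show ?thesis by simp
      qed
      finally show "?P n (?E n r) \<le> exp (- (e * e / 2 * real n)) / b" .
    qed
    finally show ?case by simp
  qed
  note ev = this
  have "((\<lambda>n. ?P n (?A n) + real M * (exp (- (e * e / 2 * real n)) / b)) \<longlongrightarrow> 0 + real M * (0 / b)) F"
  proof (intro tendsto_intros conc e)
    have "(\<lambda>n. exp (- (e * e / 2)) ^ n) \<longlonglongrightarrow> 0" using e by (intro LIMSEQ_realpow_zero) auto
    then have "((\<lambda>n. exp (- (e * e / 2 * real n))) \<longlongrightarrow> 0) sequentially"
      by (simp add: exp_of_nat_mult[symmetric] mult.commute)
    then show "((\<lambda>n. exp (- (e * e / 2 * real n))) \<longlongrightarrow> 0) F" using F by (rule tendsto_mono[rotated])
  qed (use b in auto)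
  then have lim: "((\<lambda>n. ?P n (?A n) + real M * (exp (- (e * e / 2 * real n)) / b)) \<longlongrightarrow> 0) F"
    by simp
  show ?thesis
    unfolding q_def[symmetric] by (rule tendsto_sandwich[OF _ ev tendsto_const lim]) simp
qed

end

subsection \<open>Condensation with almost all vertices being leaves\<close>

lemma card_matches_replicate:
  "length ts \<le> matches (replicate M c) ts + M + M * card {j. j < length ts \<and> ts ! j \<noteq> c}"
proof -
  let ?n = "length ts" and ?B = "{j. j < length ts \<and> ts ! j \<noteq> c}"
  let ?W = "{i. i + length (replicate M c) \<le> ?n \<and> take (length (replicate M c)) (drop i ts) = replicate M c}"
  have "{..<?n} \<subseteq> ?W \<union> ((\<lambda>k. ?n - Suc k) ` {..<M} \<union> (\<Union>j\<in>?B. (\<lambda>k. j - k) ` {..<M}))"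
  proof
    fix i assume i: "i \<in> {..<?n}"
    consider "i + M > ?n" | "i + M \<le> ?n" "\<forall>k<M. ts ! (i + k) = c" | k where "i + M \<le> ?n" "k < M" "ts ! (i + k) \<noteq> c"
      by fastforce
    then show "i \<in> ?W \<union> ((\<lambda>k. ?n - Suc k) ` {..<M} \<union> (\<Union>j\<in>?B. (\<lambda>k. j - k) ` {..<M}))"
    proof cases
      case 1
      then have "i = ?n - Suc (?n - Suc i)" "?n - Suc i < M" using i by auto
      then show ?thesis by blast
    next
      case 2
      then have "i \<in> ?W" by (auto intro!: nth_equalityI)
      then show ?thesis by blast
    next
      case 3
      then have "i + k \<in> ?B" "i = (i + k) - k" by auto
      then show ?thesis using 3 by blast
    qed
  qed
  then have "card {..<?n} \<le> card (?W \<union> ((\<lambda>k. ?n - Suc k) ` {..<M} \<union> (\<Union>j\<in>?B. (\<lambda>k. j - k) ` {..<M})))"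
    by (rule card_mono[rotated]) (auto intro: finite_subset[of _ "{..?n}"])
  also have "\<dots> \<le> card ?W + (card ((\<lambda>k. ?n - Suc k) ` {..<M}) + card (\<Union>j\<in>?B. (\<lambda>k. j - k) ` {..<M}))"
    by (meson add_left_mono card_Un_le order_trans)
  also have "card ((\<lambda>k. ?n - Suc k) ` {..<M}) \<le> M" using card_image_le[of "{..<M}"] by force
  also have "card (\<Union>j\<in>?B. (\<lambda>k. j - k) ` {..<M}) \<le> (\<Sum>j\<in>?B. card ((\<lambda>k. j - k) ` {..<M}))"
    by (rule card_UN_le) simp
  also have "\<dots> \<le> (\<Sum>j\<in>?B. M)"
    by (intro sum_mono order_trans[OF card_image_le]) auto
  finally show ?thesis by (simp add: matches_def mult.commute)
qed

lemma tot_children: "tot (\<lambda>s. \<Sum>j<length (kids s). h (kids s ! j)) t + h t = tot h t"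
  for h :: "ptree \<Rightarrow> nat"
proof (induction t)
  case (Node ts)
  have "(\<Sum>i<length ts. tot (\<lambda>s. \<Sum>j<length (kids s). h (kids s ! j)) (ts ! i)) + (\<Sum>j<length ts. h (ts ! j)) =
     (\<Sum>i<length ts. tot h (ts ! i))"
    unfolding sum.distrib[symmetric] using Node by (intro sum.cong) auto
  then show ?case by (simp add: tot_Node)
qed

lemma windows_leaves_ge:
  assumes Om: "Om > 0"
  shows "windows Om (replicate M (Node [])) t \<ge>
    real (tot (big Om length) t) - real M * (real (nv t) - real (tot (big Om length) t) + 2 * (real (nv t) / Om))"
proof -
  define h :: "ptree \<Rightarrow> nat" where "h s = (if s = Node [] then 0 else 1)" for s
  let ?L = "tot (big Om length) t" and ?C = "tot (big Om (\<lambda>_. 1)) t"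
  have h_le: "h s \<le> outdeg s" for s by (cases s) (auto simp: h_def outdeg_def Suc_le_eq)
  have pt: "big Om length s \<le> big Om (matches (replicate M (Node []))) s + M * big Om (\<lambda>_. 1) s
      + M * (\<Sum>j<length (kids s). h (kids s ! j))" for s
  proof -
    have "(\<Sum>j<length (kids s). h (kids s ! j)) = card {j. j < length (kids s) \<and> kids s ! j \<noteq> Node []}"
    proof -
      have "(\<Sum>j<length (kids s). h (kids s ! j)) = (\<Sum>j\<in>{j\<in>{..<length (kids s)}. kids s ! j \<noteq> Node []}. 1)"
        unfolding h_def by (subst sum.inter_filter) (auto intro!: sum.cong)
      then show ?thesis by simp
    qed
    then show ?thesis using card_matches_replicate[of "kids s" M "Node []"] by (simp add: big_def)
  qed
  have "?L \<le> tot (\<lambda>s. big Om (matches (replicate M (Node []))) s + M * big Om (\<lambda>_. 1) s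
      + M * (\<Sum>j<length (kids s). h (kids s ! j))) t"
    by (intro tot_mono_nat pt)
  also have "\<dots> = tot (big Om (matches (replicate M (Node [])))) t + M * ?C + M * tot (\<lambda>s. \<Sum>j<length (kids s). h (kids s ! j)) t"
    by (simp add: tot_def sum.distrib sum_distrib_left)
  also have "\<dots> \<le> tot (big Om (matches (replicate M (Node [])))) t + M * ?C + M * tot h t"
    using tot_children[of h t] by simp
  finally have 1: "real ?L \<le> windows Om (replicate M (Node [])) t + real M * real ?C + real M * real (tot h t)"
    unfolding windows_def by (simp only: of_nat_add[symmetric] of_nat_mult[symmetric] of_nat_le_iff)
  have "tot h t + ?L \<le> ?C + tot outdeg t"
    unfolding tot_def sum.distrib[symmetric]
  proof (intro sum_mono)
    fix p show "h (the (subt t p)) + big Om length (the (subt t p)) \<le> big Om (\<lambda>_. 1) (the (subt t p)) + outdeg (the (subt t p))"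
      using h_le[of "the (subt t p)"] by (auto simp: big_def h_def outdeg_def)
  qed
  then have 2: "real (tot h t) \<le> real ?C + (real (nv t) - real ?L)" using tot_outdeg[of t] by linarith
  have 3: "real ?C \<le> real (nv t) / Om"
    using tot_big_count_le[of Om t] tot_big_length_le[of Om t] Om by (simp add: field_simps)
  have "real M * real (tot h t) \<le> real M * (real ?C + (real (nv t) - real ?L))"
    using 2 by (intro mult_left_mono) auto
  moreover have "real M * real ?C \<le> real M * (real (nv t) / Om)"
    using 3 by (intro mult_left_mono) auto
  moreover define X where "X = real (nv t) / Om"
  ultimately show ?thesis using 1 unfolding X_def[symmetric] by (simp add: algebra_simps)
qed

lemma windows_leaves_prob_tendsto:
  fixes \<Omega> :: "nat \<Rightarrow> real"
  assumes w: "\<And>k. w k \<ge> 0" and F: "F \<le> sequentially" and Om: "filterlim \<Omega> at_top sequentially"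
    and Z: "eventually (\<lambda>n. Zn w n > 0) F"
    and conc: "\<And>\<epsilon>. \<epsilon> > 0 \<Longrightarrow> ((\<lambda>n. measure_pmf.prob (Tn w n)
        {t. \<bar>real (tot (big (\<Omega> n) length) t) - real n\<bar> > \<epsilon> * real n}) \<longlongrightarrow> 0) F"
    and d: "d > 0"
  shows "((\<lambda>n. measure_pmf.prob (Tn w n)
        {t. windows (\<Omega> n) (replicate M (Node [])) t < (1 - d) * real n}) \<longlongrightarrow> 0) F"
proof -
  define e where "e = d / (1 + 3 * real M)"
  have e: "e > 0" using d by (simp add: e_def add_pos_nonneg)
  have "1 + 3 * real M > 0" by (simp add: add_pos_nonneg)
  then have "e * (1 + 3 * real M) = d" unfolding e_def by simp
  then have de: "d = e + 3 * real M * e" by (simp add: algebra_simps)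
  let ?A = "\<lambda>n. {t. \<bar>real (tot (big (\<Omega> n) length) t) - real n\<bar> > e * real n}"
  let ?W = "\<lambda>n. {t. windows (\<Omega> n) (replicate M (Node [])) t < (1 - d) * real n}"
  have "eventually (\<lambda>n. \<Omega> n \<ge> 1 / e) F"
    using Om by (intro filter_leD[OF F]) (auto simp: filterlim_at_top)
  then have "eventually (\<lambda>n. measure_pmf.prob (Tn w n) (?W n) \<le> measure_pmf.prob (Tn w n) (?A n)) F"
    using Z
  proof eventually_elim
    case (elim n)
    have Om0: "\<Omega> n > 0" using elim(1) e by (smt (verit) divide_pos_pos)
    have "t \<in> ?A n" if t: "nv t = n" "t \<in> ?W n" for t
    proof (rule ccontr)
      assume nt: "t \<notin> ?A n"
      let ?L = "real (tot (big (\<Omega> n) length) t)"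
      have "1 \<le> e * \<Omega> n" using elim(1) e by (simp add: field_simps)
      then have "real n \<le> e * \<Omega> n * real n" by (simp add: mult_le_cancel_right1)
      then have 1: "real (nv t) / \<Omega> n \<le> e * real n" using Om0 t by (simp add: field_simps)
      have "real M * (real (nv t) - ?L + 2 * (real (nv t) / \<Omega> n)) \<le> real M * (3 * e * real n)"
        using nt t 1 by (intro mult_left_mono) auto
      moreover have "?L \<ge> real n - e * real n" using nt by auto
      ultimately have "windows (\<Omega> n) (replicate M (Node [])) t \<ge> (1 - d) * real n"
        using windows_leaves_ge[OF Om0, of t M] by (simp add: de algebra_simps)
      then show False using t by simp
    qed
    then show ?case
      using set_pmf_Tn[OF w elim(2)] by (intro measure_pmf.finite_measure_mono_AE AE_pmfI) auto
  qed
  then show ?thesis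
    by (rule tendsto_sandwich[OF _ _ tendsto_const conc[OF e], rotated]) simp
qed

subsection \<open>Local encodings along the backward spine\<close>

definition sib :: "nat \<Rightarrow> bool \<Rightarrow> nat \<Rightarrow> nat" where
  "sib k l j = (if l then k - Suc j else k + Suc j)"

definition sibs :: "nat \<Rightarrow> nat \<Rightarrow> (bool \<times> nat) set" where
  "sibs k D = {(l, j). if l then j < k else k + Suc j < D}"

lemma finite_sibs [simp]: "finite (sibs k D)"
  by (rule finite_subset[of _ "UNIV \<times> {..k + D}"]) (auto simp: sibs_def split: if_splits)

lemma bij_betw_sib: "k < D \<Longrightarrow> bij_betw (\<lambda>(l, j). sib k l j) (sibs k D) ({..<D} - {k})"
  by (rule bij_betw_byWitness[where f' = "\<lambda>i. (i < k, if i < k then k - Suc i else i - Suc k)"])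
    (auto simp: sib_def sibs_def split: if_splits)

lemma prod_sibs:
  fixes f :: "nat \<Rightarrow> 'a :: comm_monoid_mult"
  assumes "k < D"
  shows "f k * (\<Prod>(l, j)\<in>sibs k D. f (sib k l j)) = (\<Prod>i<D. f i)"
proof -
  have "(\<Prod>(l, j)\<in>sibs k D. f (sib k l j)) = prod f ({..<D} - {k})"
    using prod.reindex_bij_betw[OF bij_betw_sib[OF assms], of f] by (simp add: case_prod_beta)
  then show ?thesis using assms by (simp add: prod.remove[of "{..<D}" k f])
qed

lemma sib_cases:
  assumes "i < D" "i \<noteq> k"
  obtains l j where "(l, j) \<in> sibs k D" "i = sib k l j"
proof (cases "i < k")
  case True
  then show ?thesis using that[of True "k - Suc i"] by (auto simp: sibs_def sib_def)
next
  case False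
  then show ?thesis using that[of False "i - Suc k"] assms by (auto simp: sibs_def sib_def)
qed

fun below :: "nat \<Rightarrow> uvert \<Rightarrow> bool" where
  "below n (Dn xs) = True"
| "below n (Sp i) = (i < n)"
| "below n (Sd i l j xs) = (i < n)"

lemma degv_Cons: "degv t (k # p) = (if k < length (kids t) then degv (kids t ! k) p else Deg 0)"
  by (simp add: degv_def)

lemma degv_in_verts: "p \<in> verts t \<Longrightarrow> degv t p = Deg (enat (outdeg (the (subt t p))))"
  by (auto simp: degv_def verts_def)

lemma enc_Nil: "enc t [] (Dn xs) = degv t xs"
  by (simp add: enc_def)

lemma enc_Cons_below:
  assumes "k < length (kids t)" "below (length q) u"
  shows "enc t (k # q) u = enc (kids t ! k) q u"
proof -
  have "take (length q - i) (k # q) = k # take (length q - Suc i) q" if "i < length q" for i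
    using that by (simp add: take_Cons')
  then show ?thesis
    using assms by (cases u) (auto simp: enc_def degv_Cons Let_def)
qed

lemma enc_Cons_Sp: "enc t (k # q) (Sp (length q)) = SPair (enat k) (enat (outdeg t - 1 - k))"
  by (simp add: enc_def)

lemma enc_Cons_Sd:
  assumes "k < length (kids t)"
  shows "enc t (k # q) (Sd (length q) l j xs) =
     (if (l, j) \<in> sibs k (outdeg t) then degv (kids t ! sib k l j) xs else Deg 0)"
  using assms by (auto simp: enc_def sibs_def sib_def degv_Cons outdeg_def)

lemma enc_above:
  "length q \<le> i \<Longrightarrow> enc t q (Sp i) = Star" "length q \<le> i \<Longrightarrow> enc t q (Sd i l j xs) = Deg 0"
  by (simp_all add: enc_def)

lemma degv_in_Deg: "degv t p \<in> range Deg"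
  by (simp add: degv_def split: option.splits)

lemma enc_in_TS: "enc t q \<in> TS"
  using degv_in_Deg by (fastforce simp: TS_def enc_def Let_def)

fun coords :: "ptree \<Rightarrow> nat list \<Rightarrow> uvert set" where
  "coords t [] = Dn ` verts t"
| "coords t (k # q) = coords (kids t ! k) q \<union>
     (\<Union>(l, j)\<in>sibs k (outdeg t). Sd (length q) l j ` verts (kids t ! sib k l j))"

fun spine :: "ptree \<Rightarrow> nat list \<Rightarrow> (nat \<times> nat) list" where
  "spine t [] = []"
| "spine t (k # q) = spine (kids t ! k) q @ [(k, outdeg t - 1 - k)]"

lemma length_spine [simp]: "length (spine t q) = length q"
  by (induction t q rule: spine.induct) auto

fun deg_of :: "tval \<Rightarrow> nat" where
  "deg_of (Deg d) = the_enat d"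
| "deg_of _ = 0"

lemma finite_coords [simp]: "finite (coords t q)"
  by (induction t q rule: coords.induct) auto

lemma coords_below: "u \<in> coords t q \<Longrightarrow> below (length q) u"
proof (induction t q rule: coords.induct)
  case (2 t k q)
  then show ?case by (cases u) auto
qed auto

lemma prod_coords_Cons:
  fixes p :: "nat \<Rightarrow> real"
  assumes k: "k < outdeg t"
  shows "(\<Prod>u\<in>coords t (k # q). p (deg_of (enc t (k # q) u))) =
     (\<Prod>u\<in>coords (kids t ! k) q. p (deg_of (enc (kids t ! k) q u))) *
     (\<Prod>(l, j)\<in>sibs k (outdeg t). wt p (kids t ! sib k l j))"
proof -
  let ?D = "outdeg t" and ?s = "kids t ! k" and ?e = "enc t (k # q)"
  let ?S = "\<Union>(l, j)\<in>sibs k ?D. Sd (length q) l j ` verts (kids t ! sib k l j)"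
  have k': "k < length (kids t)" using k by (simp add: outdeg_def)
  have "coords ?s q \<inter> ?S = {}" using coords_below by fastforce
  then have "(\<Prod>u\<in>coords t (k # q). p (deg_of (?e u))) =
      (\<Prod>u\<in>coords ?s q. p (deg_of (?e u))) * (\<Prod>u\<in>?S. p (deg_of (?e u)))"
    by (simp, subst prod.union_disjoint) auto
  also have "(\<Prod>u\<in>coords ?s q. p (deg_of (?e u))) = (\<Prod>u\<in>coords ?s q. p (deg_of (enc ?s q u)))"
    by (intro prod.cong refl) (simp add: enc_Cons_below k' coords_below)
  also have "(\<Prod>u\<in>?S. p (deg_of (?e u))) =
       (\<Prod>x\<in>sibs k ?D. \<Prod>u\<in>(case x of (l, j) \<Rightarrow> Sd (length q) l j ` verts (kids t ! sib k l j)). p (deg_of (?e u)))"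
    by (intro prod.UNION_disjoint) auto
  also have "\<dots> = (\<Prod>(l, j)\<in>sibs k ?D. wt p (kids t ! sib k l j))"
  proof (intro prod.cong refl, clarsimp)
    fix l j assume lj: "(l, j) \<in> sibs k ?D"
    have "(\<Prod>u\<in>Sd (length q) l j ` verts (kids t ! sib k l j). p (deg_of (?e u))) =
        (\<Prod>x\<in>verts (kids t ! sib k l j). p (deg_of (?e (Sd (length q) l j x))))"
      by (subst prod.reindex) (auto simp: inj_on_def)
    also have "\<dots> = wt p (kids t ! sib k l j)"
      unfolding wt_conv_prod using lj k' by (intro prod.cong refl) (simp add: enc_Cons_Sd degv_in_verts)
    finally show "(\<Prod>u\<in>Sd (length q) l j ` verts (kids t ! sib k l j). p (deg_of (?e u))) = wt p (kids t ! sib k l j)" .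
  qed
  finally show ?thesis .
qed

lemma prod_coords:
  fixes p :: "nat \<Rightarrow> real"
  assumes "q \<in> verts t"
  shows "(\<Prod>u\<in>coords t q. p (deg_of (enc t q u))) * (\<Prod>i<length q. p (Suc (fst (spine t q ! i) + snd (spine t q ! i)))) = wt p t"
  using assms
proof (induction t q rule: coords.induct)
  case (1 t)
  have "(\<Prod>u\<in>Dn ` verts t. p (deg_of (enc t [] u))) = (\<Prod>x\<in>verts t. p (deg_of (enc t [] (Dn x))))"
    by (subst prod.reindex) (auto simp: inj_on_def)
  also have "\<dots> = wt p t"
    unfolding wt_conv_prod by (intro prod.cong refl) (simp add: enc_Nil degv_in_verts)
  finally show ?case by simp
next
  case (2 t k q)
  let ?D = "outdeg t" and ?s = "kids t ! k"
  let ?sp = "\<lambda>i. p (Suc (fst (spine ?s q ! i) + snd (spine ?s q ! i)))"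
  have k: "k < ?D" "q \<in> verts ?s" using 2(2) by (auto simp: Cons_in_verts outdeg_def)
  have B: "(\<Prod>i<length (k # q). p (Suc (fst (spine t (k # q) ! i) + snd (spine t (k # q) ! i)))) =
      (\<Prod>i<length q. ?sp i) * p ?D"
    using k by (simp add: nth_append)
  have "wt p t = p ?D * (\<Prod>i<?D. wt p (kids t ! i))"
    by (cases t) (simp add: outdeg_def prod_list_conv_lessThan)
  also have "\<dots> = p ?D * (wt p ?s * (\<Prod>(l, j)\<in>sibs k ?D. wt p (kids t ! sib k l j)))"
    using prod_sibs[OF k(1), of "\<lambda>i. wt p (kids t ! i)"] by simp
  also have "wt p ?s = (\<Prod>u\<in>coords ?s q. p (deg_of (enc ?s q u))) * (\<Prod>i<length q. ?sp i)"
    using 2(1)[OF k(2)] by simp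
  finally show ?case unfolding prod_coords_Cons[OF k(1)] B by (simp add: mult_ac)
qed

definition fits :: "(nat list \<Rightarrow> nat) \<Rightarrow> ptree \<Rightarrow> bool" where
  "fits f t \<longleftrightarrow> (\<forall>p\<in>verts t. f p = outdeg (the (subt t p)))"

lemma fits_Node: "fits f (Node ts) \<longleftrightarrow> f [] = length ts \<and> (\<forall>i<length ts. fits (\<lambda>p. f (i # p)) (ts ! i))"
  by (auto simp: fits_def verts_Node outdeg_def)

lemma fits_unique: "fits f t \<Longrightarrow> fits f t' \<Longrightarrow> t = t'"
proof (induction t arbitrary: f t')
  case (Node ts)
  obtain us where t': "t' = Node us" by (cases t')
  have "ts = us"
    using Node by (intro nth_equalityI) (auto simp: fits_Node t')
  then show ?case by (simp add: t')
qed

lemma gw_fits: "fits f t \<Longrightarrow> gw f xs = degv t xs"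
proof (induction xs arbitrary: f t)
  case Nil
  then show ?case by (cases t) (simp add: gw_def degv_def fits_Node outdeg_def)
next
  case (Cons k xs)
  obtain ts where t: "t = Node ts" by (cases t)
  have f0: "f [] = length ts" using Cons.prems by (simp add: t fits_Node)
  have split: "(\<forall>j<length (k # xs). (k # xs) ! j < f (take j (k # xs))) \<longleftrightarrow>
      k < length ts \<and> (\<forall>j<length xs. xs ! j < f (k # take j xs))"
    using f0 by (auto simp: All_less_Suc2 less_Suc_eq_0_disj)
  show ?case
  proof (cases "k < length ts")
    case True
    then have "gw (\<lambda>p. f (k # p)) xs = degv (ts ! k) xs"
      using Cons by (simp add: t fits_Node)
    then show ?thesis using True split by (simp add: t degv_Cons gw_def)
  next
    case False
    then show ?thesis using split by (auto simp: t degv_Cons gw_def)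
  qed
qed

fun agree :: "(uvert \<Rightarrow> nat) \<Rightarrow> (nat \<Rightarrow> (nat \<times> nat) option) \<Rightarrow> ptree \<Rightarrow> nat list \<Rightarrow> bool" where
  "agree X Y t [] \<longleftrightarrow> fits (\<lambda>p. X (Dn p)) t"
| "agree X Y t (k # q) \<longleftrightarrow> agree X Y (kids t ! k) q \<and>
     (\<forall>(l, j)\<in>sibs k (outdeg t). fits (\<lambda>p. X (Sd (length q) l j p)) (kids t ! sib k l j)) \<and>
     Y (length q) = Some (k, outdeg t - 1 - k)"

lemma agree_iff_coords:
  assumes "q \<in> verts t"
  shows "agree X Y t q \<longleftrightarrow> (\<forall>u\<in>coords t q. X u = deg_of (enc t q u)) \<and> (\<forall>i<length q. Y i = Some (spine t q ! i))"
  using assms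
proof (induction t q rule: coords.induct)
  case (1 t)
  then show ?case by (auto simp: fits_def enc_Nil degv_in_verts)
next
  case (2 t k q)
  have k: "k < length (kids t)" "q \<in> verts (kids t ! k)" using 2(2) by (auto simp: Cons_in_verts)
  have "(\<forall>u\<in>coords (kids t ! k) q. X u = deg_of (enc t (k # q) u)) \<longleftrightarrow>
     (\<forall>u\<in>coords (kids t ! k) q. X u = deg_of (enc (kids t ! k) q u))"
    by (intro ball_cong refl) (simp add: enc_Cons_below k coords_below)
  moreover have "(\<forall>i<length (k # q). Y i = Some (spine t (k # q) ! i)) \<longleftrightarrow>
      (\<forall>i<length q. Y i = Some (spine (kids t ! k) q ! i)) \<and> Y (length q) = Some (k, outdeg t - 1 - k)"
    by (auto simp: nth_append less_Suc_eq)
  moreover have "(\<forall>(l, j)\<in>sibs k (outdeg t). fits (\<lambda>p. X (Sd (length q) l j p)) (kids t ! sib k l j)) \<longleftrightarrow>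
     (\<forall>u\<in>(\<Union>(l, j)\<in>sibs k (outdeg t). Sd (length q) l j ` verts (kids t ! sib k l j)). X u = deg_of (enc t (k # q) u))"
    by (auto simp: fits_def enc_Cons_Sd k degv_in_verts)
  ultimately show ?case using 2(1)[OF k(2)] by (simp add: ball_Un) blast
qed

lemma agree_Y: "agree X Y t q \<Longrightarrow> i < length q \<Longrightarrow> Y i \<noteq> None"
  by (induction t q rule: coords.induct) (auto simp: less_Suc_eq)

lemma agree_unique:
  "agree X Y t q \<Longrightarrow> agree X Y t' q' \<Longrightarrow> q \<in> verts t \<Longrightarrow> q' \<in> verts t' \<Longrightarrow> length q = length q' \<Longrightarrow> t = t' \<and> q = q'"
proof (induction t q arbitrary: t' q' rule: coords.induct)
  case (1 t)
  then show ?case using fits_unique by auto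
next
  case (2 t k q)
  obtain k' r where q': "q' = k' # r" using 2(6) by (cases q') auto
  have k: "k < outdeg t" "q \<in> verts (kids t ! k)" "k' < outdeg t'" "r \<in> verts (kids t' ! k')"
    using 2(4,5) by (auto simp: q' Cons_in_verts outdeg_def)
  have len: "length r = length q" using 2(6) by (simp add: q')
  have "Y (length q) = Some (k, outdeg t - 1 - k)" "Y (length q) = Some (k', outdeg t' - 1 - k')"
    using 2(2,3) by (auto simp: q' len)
  then have kk: "k' = k" "outdeg t' = outdeg t" using k by auto
  have ag: "agree X Y (kids t ! k) q" "agree X Y (kids t' ! k) r"
    using 2(2,3) unfolding q' kk agree.simps by blast+
  have same: "kids t ! k = kids t' ! k \<and> q = r"
    by (rule 2(1)[OF ag]) (use k len kk in auto)
  have "kids t ! i = kids t' ! i" if i: "i < outdeg t" for i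
  proof (cases "i = k")
    case False
    then obtain l j where lj: "(l, j) \<in> sibs k (outdeg t)" "i = sib k l j"
      using sib_cases[OF i False] by blast
    then have "fits (\<lambda>p. X (Sd (length q) l j p)) (kids t ! i)" "fits (\<lambda>p. X (Sd (length q) l j p)) (kids t' ! i)"
      using 2(2,3) by (auto simp: q' kk len)
    then show ?thesis by (rule fits_unique)
  qed (use same in simp)
  then have "kids t = kids t'" using kk by (intro nth_equalityI) (auto simp: outdeg_def)
  then have "t = t'" by (metis Node_kids)
  then show ?case using same by (simp add: q' kk)
qed

definition spine_val :: "(uvert \<Rightarrow> nat) \<Rightarrow> (nat \<Rightarrow> (nat \<times> nat) option) \<Rightarrow> uvert \<Rightarrow> tval" where
  "spine_val X Y v = (case v of
       Dn xs \<Rightarrow> gw (\<lambda>u. X (Dn u)) xs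
     | Sp i \<Rightarrow> (case Y i of Some (a, b) \<Rightarrow> SPair (enat a) (enat b) | None \<Rightarrow> Star)
     | Sd i l m xs \<Rightarrow> (case Y i of Some (a, b) \<Rightarrow>
            (if (if l then m < a else m < b) then gw (\<lambda>u. X (Sd i l m u)) xs else Deg 0) | None \<Rightarrow> Deg 0))"

lemma agree_spine_val:
  "agree X Y t q \<Longrightarrow> q \<in> verts t \<Longrightarrow> below (length q) u \<Longrightarrow> spine_val X Y u = enc t q u"
proof (induction t q rule: coords.induct)
  case (1 t)
  then show ?case by (cases u) (auto simp: spine_val_def enc_Nil gw_fits)
next
  case (2 t k q)
  have k: "k < length (kids t)" "q \<in> verts (kids t ! k)" using 2(3) by (auto simp: Cons_in_verts)
  show ?case
  proof (cases "below (length q) u")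
    case True
    then show ?thesis using 2(1)[OF _ k(2)] 2(2) k by (simp add: enc_Cons_below)
  next
    case False
    then consider "u = Sp (length q)" | l j xs where "u = Sd (length q) l j xs"
      using 2(4) by (cases u) auto
    then show ?thesis
    proof cases
      case 1
      then show ?thesis using 2(2) by (simp add: enc_Cons_Sp spine_val_def)
    next
      case (2 l j xs)
      have "(l, j) \<in> sibs k (outdeg t) \<longleftrightarrow> (if l then j < k else j < outdeg t - 1 - k)"
        using k by (auto simp: sibs_def outdeg_def)
      then have "spine_val X Y u = (if (l, j) \<in> sibs k (outdeg t) then gw (\<lambda>p. X (Sd (length q) l j p)) xs else Deg 0)"
        using \<open>agree X Y t (k # q)\<close> by (simp add: 2 spine_val_def)
      moreover have "(l, j) \<in> sibs k (outdeg t) \<Longrightarrow> gw (\<lambda>p. X (Sd (length q) l j p)) xs = degv (kids t ! sib k l j) xs"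
        using \<open>agree X Y t (k # q)\<close> by (intro gw_fits) auto
      ultimately show ?thesis
        using k by (simp add: 2 enc_Cons_Sd)
    qed
  qed
qed

lemma Tstarbar_below:
  "below (LEAST i. Y i = None) u \<Longrightarrow> Tstarbar (X, Y) u = spine_val X Y u"
  by (cases u) (auto simp: Tstarbar_def spine_val_def)

subsection \<open>Cylinder sets\<close>

text \<open>A pattern \<open>(cs, v)\<close> consists of \<open>2 * m + 1\<close> consecutive siblings \<open>cs\<close> and a vertex \<open>v\<close> of the
  middle one; their parent plays the role of the vertex of infinite degree.\<close>
definition patterns :: "nat \<Rightarrow> (ptree list \<times> nat list) set" where
  "patterns m = {(cs, v). length cs = 2 * m + 1 \<and> v \<in> verts (cs ! m)}"

definition cyl :: "nat \<Rightarrow> ptree list \<times> nat list \<Rightarrow> (uvert \<Rightarrow> tval) set" where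
  "cyl m x = (case x of (cs, v) \<Rightarrow> {g \<in> TS.
     (\<forall>u. below (length v) u \<longrightarrow> g u = enc (cs ! m) v u) \<and>
     (\<forall>l j xs. j < m \<longrightarrow> g (Sd (length v) l j xs) = degv (cs ! sib m l j) xs) \<and>
     (\<exists>a b. g (Sp (length v)) = SPair a b \<and> enat m \<le> a \<and> enat m \<le> b) \<and>
     (\<forall>i>length v. g (Sp i) = Star \<and> (\<forall>l j xs. g (Sd i l j xs) = Deg 0))})"

definition event :: "nat \<Rightarrow> ptree list \<times> nat list \<Rightarrow> (uvert \<Rightarrow> nat) \<times> (nat \<Rightarrow> (nat \<times> nat) option) \<Rightarrow> bool" where
  "event m x \<omega> = (case (x, \<omega>) of ((cs, v), (X, Y)) \<Rightarrow> agree X Y (cs ! m) v \<and>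
     (\<forall>(l, j)\<in>sibs m (2 * m + 1). fits (\<lambda>p. X (Sd (length v) l j p)) (cs ! sib m l j)) \<and> Y (length v) = None)"

lemma sibs_middle: "(l, j) \<in> sibs m (2 * m + 1) \<longleftrightarrow> j < m"
  by (auto simp: sibs_def)

lemma event_least:
  assumes "event m (cs, v) (X, Y)"
  shows "(LEAST i. Y i = None) = length v"
proof (rule Least_equality)
  show "Y (length v) = None" using assms by (simp add: event_def)
  fix y assume "Y y = None"
  then show "length v \<le> y" using assms agree_Y[of X Y "cs ! m" v y] by (auto simp: event_def not_le[symmetric])
qed

lemma gw_in_Deg: "gw f xs \<in> range Deg"
  by (simp add: gw_def)

lemma Tstarbar_in_TS: "Tstarbar \<omega> \<in> TS"
  using gw_in_Deg by (auto simp: TS_def Tstarbar_def Let_def split: option.splits)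

lemma event_imp_cyl:
  assumes "event m x \<omega>" "x \<in> patterns m"
  shows "Tstarbar \<omega> \<in> cyl m x"
proof -
  obtain cs v X Y where x: "x = (cs, v)" "\<omega> = (X, Y)" by (metis surj_pair)
  have L: "(LEAST i. Y i = None) = length v" using assms event_least by (simp add: x)
  have ev: "agree X Y (cs ! m) v" "v \<in> verts (cs ! m)"
    and fits: "\<forall>(l, j)\<in>sibs m (2 * m + 1). fits (\<lambda>p. X (Sd (length v) l j p)) (cs ! sib m l j)"
    using assms by (auto simp: x event_def patterns_def)
  have fit: "fits (\<lambda>p. X (Sd (length v) l j p)) (cs ! sib m l j)" if "j < m" for l j
    using bspec[OF fits, of "(l, j)"] that sibs_middle[of l j m] by simp
  have "Tstarbar (X, Y) u = enc (cs ! m) v u" if "below (length v) u" for u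
    using that Tstarbar_below[of Y u X] agree_spine_val[OF ev that] by (simp add: L)
  moreover have "Tstarbar (X, Y) (Sd (length v) l j xs) = degv (cs ! sib m l j) xs" if "j < m" for l j xs
    using gw_fits[OF fit[OF that]] by (simp add: Tstarbar_def L)
  moreover have "Tstarbar (X, Y) (Sp (length v)) = SPair \<infinity> \<infinity>" by (simp add: Tstarbar_def L)
  ultimately show ?thesis
    unfolding cyl_def x using Tstarbar_in_TS by (auto simp: Tstarbar_def L)
qed

lemma event_unique:
  assumes "event m x \<omega>" "event m x' \<omega>" "x \<in> patterns m" "x' \<in> patterns m"
  shows "x = x'"
proof -
  obtain cs v cs' v' X Y where x: "x = (cs, v)" "x' = (cs', v')" "\<omega> = (X, Y)" by (metis surj_pair)
  have len: "length v' = length v"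
    using event_least[of m cs v X Y] event_least[of m cs' v' X Y] assms by (simp add: x)
  have same: "cs ! m = cs' ! m \<and> v = v'"
    using assms len by (intro agree_unique[of X Y]) (auto simp: x event_def patterns_def)
  have "cs ! i = cs' ! i" if i: "i < 2 * m + 1" for i
  proof (cases "i = m")
    case False
    then obtain l j where lj: "(l, j) \<in> sibs m (2 * m + 1)" "i = sib m l j"
      using sib_cases[OF i False] by blast
    then have "fits (\<lambda>p. X (Sd (length v) l j p)) (cs ! i)" "fits (\<lambda>p. X (Sd (length v) l j p)) (cs' ! i)"
      using assms(1,2) by (auto simp: x event_def len)
    then show ?thesis by (rule fits_unique)
  qed (use same in simp)
  then have "cs = cs'" using assms by (intro nth_equalityI) (auto simp: x patterns_def)
  then show ?thesis using same by (simp add: x)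
qed

subsection \<open>Windows in a finite tree and the truncated pointed fringe subtree\<close>

lemma enc_window_in_cyl:
  assumes cs: "length cs = 2 * m + 1" "i + length cs \<le> length ts" "take (length cs) (drop i ts) = cs"
  shows "enc (Node ts) ((i + m) # v) \<in> cyl m (cs, v)"
proof -
  have nth: "ts ! (i + j) = cs ! j" if "j < 2 * m + 1" for j
    using cs that by (metis nth_drop nth_take add_leD1)
  have k: "i + m < length (kids (Node ts))" using cs by simp
  have mid: "kids (Node ts) ! (i + m) = cs ! m" using nth[of m] by simp
  let ?g = "enc (Node ts) ((i + m) # v)"
  have "?g u = enc (cs ! m) v u" if "below (length v) u" for u
    using enc_Cons_below[OF k that] mid by simp
  moreover have "?g (Sd (length v) l j xs) = degv (cs ! sib m l j) xs" if "j < m" for l j xs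
  proof -
    have "(l, j) \<in> sibs (i + m) (outdeg (Node ts))" using that cs by (auto simp: sibs_def outdeg_def)
    moreover have "sib (i + m) l j = i + sib m l j" "sib m l j < 2 * m + 1"
      using that by (auto simp: sib_def)
    ultimately show ?thesis using enc_Cons_Sd[OF k] nth by simp
  qed
  moreover have "?g (Sp (length v)) = SPair (enat (i + m)) (enat (length ts - 1 - (i + m)))"
    using enc_Cons_Sp[of "Node ts" "i + m" v] by (simp add: outdeg_def)
  moreover have "?g (Sp j) = Star \<and> (\<forall>l j' xs. ?g (Sd j l j' xs) = Deg 0)" if "j > length v" for j
    using that by (simp add: enc_above)
  ultimately show ?thesis
    unfolding cyl_def using cs enc_in_TS by auto
qed

definition window_points :: "real \<Rightarrow> nat \<Rightarrow> ptree list \<times> nat list \<Rightarrow> ptree \<Rightarrow> nat list set" where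
  "window_points Om m x t = (case x of (cs, v) \<Rightarrow> {a @ (i + m) # v | a ts i.
      subt t a = Some (Node ts) \<and> Om < real (length ts) \<and> i + length cs \<le> length ts \<and>
      take (length cs) (drop i ts) = cs})"

lemma window_pointsE:
  assumes "p \<in> window_points Om m (cs, v) t"
  obtains a ts i where "p = a @ (i + m) # v" "subt t a = Some (Node ts)" "Om < real (length ts)"
    "i + length cs \<le> length ts" "take (length cs) (drop i ts) = cs"
  using assms by (auto simp: window_points_def)

lemma window_points_level:
  assumes pat: "(cs, v) \<in> patterns m" and Om: "real (nv (cs ! m)) \<le> Om"
    and a: "subt t a = Some (Node ts)" "Om < real (length ts)"
    and i: "i + length cs \<le> length ts" "take (length cs) (drop i ts) = cs"
  defines "p \<equiv> a @ (i + m) # v"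
  defines "J \<equiv> {j. j < length p \<and> Om < real (outdeg (the (subt t (take j p))))}"
  shows "J \<noteq> {}" "Max J = length a" "p \<in> verts t"
proof -
  have cs: "length cs = 2 * m + 1" "v \<in> verts (cs ! m)" using pat by (auto simp: patterns_def)
  have mid: "i + m < length ts" "ts ! (i + m) = cs ! m"
  proof -
    show "i + m < length ts" using cs i by simp
    have "cs ! m = take (length cs) (drop i ts) ! m" using i(2) by simp
    also have "\<dots> = ts ! (i + m)" using cs i(1) by simp
    finally show "ts ! (i + m) = cs ! m" by simp
  qed
  have sub: "subt t (a @ (i + m) # q) = subt (cs ! m) q" for q
    using a mid by (simp add: subt_append)
  show "p \<in> verts t" using cs(2) by (simp add: p_def verts_def sub)
  have aJ: "length a \<in> J" using a by (simp add: J_def p_def outdeg_def)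
  then show "J \<noteq> {}" by blast
  have "j \<le> length a" if j: "j \<in> J" for j
  proof (rule ccontr)
    assume "\<not> j \<le> length a"
    then have tk: "take j p = a @ (i + m) # take (j - Suc (length a)) v"
      by (simp add: p_def take_Cons' not_le)
    have "take (j - Suc (length a)) v \<in> verts (cs ! m)"
      using cs(2) append_in_verts[of "take (j - Suc (length a)) v" "drop (j - Suc (length a)) v"] by simp
    then obtain s where s: "subt (cs ! m) (take (j - Suc (length a)) v) = Some s" by (auto simp: verts_def)
    have "real (outdeg s) < real (nv (cs ! m))" using nv_subt[OF s] outdeg_less_nv[of s] by simp
    then show False using j Om by (simp add: J_def tk sub s)
  qed
  moreover have "finite J" by (simp add: J_def)
  ultimately show "Max J = length a" using aJ by (intro Max_eqI) auto
qed

lemma Hfr_window_points: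
  assumes pat: "x \<in> patterns m" and Om: "real (nv (fst x ! m)) \<le> Om" and p: "p \<in> window_points Om m x t"
  shows "\<exists>g\<in>cyl m x. Hfr t p Om = Some g"
proof -
  obtain cs v where x: "x = (cs, v)" by (cases x)
  from p obtain a ts i where p': "p = a @ (i + m) # v" "subt t a = Some (Node ts)" "Om < real (length ts)"
    "i + length cs \<le> length ts" "take (length cs) (drop i ts) = cs"
    unfolding x by (rule window_pointsE)
  note lev = window_points_level[OF pat[unfolded x] _ p'(2-5)]
  have "Hfr t p Om = Some (enc (Node ts) ((i + m) # v))"
    using lev Om p'(2) unfolding Hfr_def p'(1) by (simp add: x Let_def)
  then show ?thesis using enc_window_in_cyl[of cs m i ts v] p' pat by (auto simp: x patterns_def)
qed

lemma window_points_subset_verts: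
  assumes pat: "x \<in> patterns m" and Om: "real (nv (fst x ! m)) \<le> Om"
  shows "window_points Om m x t \<subseteq> verts t"
proof
  fix p assume p: "p \<in> window_points Om m x t"
  obtain cs v where x: "x = (cs, v)" by (cases x)
  from p obtain a ts i where p': "p = a @ (i + m) # v" "subt t a = Some (Node ts)" "Om < real (length ts)"
    "i + length cs \<le> length ts" "take (length cs) (drop i ts) = cs"
    unfolding x by (rule window_pointsE)
  show "p \<in> verts t" using window_points_level(3)[OF pat[unfolded x] _ p'(2-5)] Om p'(1) by (simp add: x)
qed

lemma window_points_disjoint:
  assumes pat: "x \<in> patterns m" "x' \<in> patterns m"
    and Om: "real (nv (fst x ! m)) \<le> Om" "real (nv (fst x' ! m)) \<le> Om"
    and p: "p \<in> window_points Om m x t" "p \<in> window_points Om m x' t"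
  shows "x = x'"
proof -
  obtain cs v cs' v' where x: "x = (cs, v)" "x' = (cs', v')" by (metis surj_pair)
  from p(1) obtain a ts i where p1: "p = a @ (i + m) # v" "subt t a = Some (Node ts)" "Om < real (length ts)"
    "i + length cs \<le> length ts" "take (length cs) (drop i ts) = cs"
    unfolding x by (rule window_pointsE)
  from p(2) obtain a' ts' i' where p2: "p = a' @ (i' + m) # v'" "subt t a' = Some (Node ts')" "Om < real (length ts')"
    "i' + length cs' \<le> length ts'" "take (length cs') (drop i' ts') = cs'"
    unfolding x by (rule window_pointsE)
  have "length a = length a'"
    using window_points_level(2)[OF pat(1)[unfolded x] _ p1(2-5)] window_points_level(2)[OF pat(2)[unfolded x] _ p2(2-5)] Om
    by (simp add: x p1(1)[symmetric] p2(1)[symmetric])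
  then have "a = a'" "i = i'" "v = v'" using p1(1) p2(1) by auto
  then show ?thesis using p1 p2 pat by (auto simp: x patterns_def)
qed

lemma card_window_points: "real (card (window_points Om m (cs, v) t)) = windows Om cs t"
proof -
  let ?A = "{a \<in> verts t. Om < real (outdeg (the (subt t a)))}"
  let ?I = "\<lambda>a. {i. i + length cs \<le> length (kids (the (subt t a))) \<and> take (length cs) (drop i (kids (the (subt t a)))) = cs}"
  have eq: "window_points Om m (cs, v) t = (\<lambda>(a, i). a @ (i + m) # v) ` Sigma ?A ?I"
  proof (intro set_eqI iffI)
    fix p assume "p \<in> window_points Om m (cs, v) t"
    then obtain a ts i where "p = a @ (i + m) # v" "subt t a = Some (Node ts)" "Om < real (length ts)"
      "i + length cs \<le> length ts" "take (length cs) (drop i ts) = cs" by (rule window_pointsE)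
    then show "p \<in> (\<lambda>(a, i). a @ (i + m) # v) ` Sigma ?A ?I"
      by (intro image_eqI[of _ _ "(a, i)"]) (auto simp: verts_def outdeg_def)
  next
    fix p assume "p \<in> (\<lambda>(a, i). a @ (i + m) # v) ` Sigma ?A ?I"
    then obtain a i where ai: "a \<in> ?A" "i \<in> ?I a" "p = a @ (i + m) # v" by auto
    then obtain s where s: "subt t a = Some s" by (auto simp: verts_def)
    show "p \<in> window_points Om m (cs, v) t"
      unfolding window_points_def using ai s
      by (auto simp: outdeg_def intro!: exI[of _ a] exI[of _ "kids s"] exI[of _ i])
  qed
  have fin: "finite (?I a)" for a
    by (rule finite_subset[of _ "{..length (kids (the (subt t a)))}"]) auto
  have "card (window_points Om m (cs, v) t) = card (Sigma ?A ?I)"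
    unfolding eq by (rule card_image) (auto simp: inj_on_def)
  also have "\<dots> = (\<Sum>a\<in>?A. card (?I a))" using fin by (intro card_SigmaI) auto
  also have "\<dots> = tot (big Om (matches cs)) t"
    unfolding tot_def by (subst sum.inter_filter) (auto simp: big_def matches_def intro!: sum.cong)
  finally show ?thesis by (simp add: windows_def)
qed

lemma Hfr_in_TS: "Hfr t p Om = Some g \<Longrightarrow> g \<in> TS"
  using enc_in_TS by (auto simp: Hfr_def Let_def split: if_splits)

lemma sum_windows_le:
  fixes f :: "(uvert \<Rightarrow> tval) \<Rightarrow> real"
  assumes S: "finite S" "S \<subseteq> patterns m" and Om: "\<And>x. x \<in> S \<Longrightarrow> real (nv (fst x ! m)) \<le> Om"
    and f: "\<And>g. g \<in> TS \<Longrightarrow> f g \<ge> 0" and c: "c \<ge> 0" and h: "\<And>x g. x \<in> S \<Longrightarrow> g \<in> cyl m x \<Longrightarrow> h x \<le> f g"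
  shows "(\<Sum>x\<in>S. h x * windows Om (fst x) t) \<le> (\<Sum>p\<in>verts t. case Hfr t p Om of None \<Rightarrow> c | Some g \<Rightarrow> f g)"
proof -
  let ?val = "\<lambda>p. case Hfr t p Om of None \<Rightarrow> c | Some g \<Rightarrow> f g"
  let ?W = "\<lambda>x. window_points Om m x t"
  have pat: "x \<in> patterns m" if "x \<in> S" for x using S that by blast
  have W: "?W x \<subseteq> verts t" "finite (?W x)" if "x \<in> S" for x
    using window_points_subset_verts[OF pat[OF that] Om[OF that]] finite_subset[OF _ finite_verts[of t]] by auto
  have "(\<Sum>x\<in>S. h x * windows Om (fst x) t) = (\<Sum>x\<in>S. \<Sum>p\<in>?W x. h x)"
    using card_window_points[of Om m "fst x" "snd x" t for x] by (intro sum.cong refl) (simp add: mult.commute)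
  also have "\<dots> \<le> (\<Sum>x\<in>S. \<Sum>p\<in>?W x. ?val p)"
  proof (intro sum_mono)
    fix x p assume xp: "x \<in> S" "p \<in> ?W x"
    obtain g where "g \<in> cyl m x" "Hfr t p Om = Some g" using Hfr_window_points[OF pat Om xp(2)] xp(1) by blast
    then show "h x \<le> ?val p" using h xp(1) by simp
  qed
  also have "\<dots> = (\<Sum>p\<in>(\<Union>x\<in>S. ?W x). ?val p)"
  proof (rule sum.UNION_disjoint[symmetric])
    show "\<forall>x\<in>S. \<forall>y\<in>S. x \<noteq> y \<longrightarrow> ?W x \<inter> ?W y = {}"
      using window_points_disjoint[OF pat pat Om Om] by blast
  qed (use S W in auto)
  also have "\<dots> \<le> (\<Sum>p\<in>verts t. ?val p)"
    using W f c Hfr_in_TS by (intro sum_mono2) (auto split: option.split)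
  finally show ?thesis .
qed

lemma expectation_pointedTn:
  fixes g :: "ptree \<times> nat list \<Rightarrow> real"
  assumes fin: "finite (set_pmf (Tn w n))"
  shows "measure_pmf.expectation (pointedTn w n) g =
     measure_pmf.expectation (Tn w n) (\<lambda>t. (\<Sum>p\<in>verts t. g (t, p)) / real (nv t))"
proof -
  have ne: "verts t \<noteq> {}" for t using Nil_in_verts by blast
  have "measure_pmf.expectation (pointedTn w n) g = (\<Sum>t\<in>set_pmf (Tn w n). pmf (Tn w n) t *\<^sub>R
      measure_pmf.expectation (map_pmf (\<lambda>p. (t, p)) (pmf_of_set (verts t))) g)"
    unfolding pointedTn_def by (rule pmf_expectation_bind) (auto simp: fin ne)
  also have "\<dots> = measure_pmf.expectation (Tn w n) (\<lambda>t. (\<Sum>p\<in>verts t. g (t, p)) / real (nv t))"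
    by (rule sym, subst integral_measure_pmf[OF fin]) (auto simp: integral_pmf_of_set ne card_verts)
  finally show ?thesis .
qed

lemma expectation_pointedTn_ge:
  fixes f :: "(uvert \<Rightarrow> tval) \<Rightarrow> real"
  assumes S: "finite S" "S \<subseteq> patterns m" and Om: "\<And>x. x \<in> S \<Longrightarrow> real (nv (fst x ! m)) \<le> Om"
    and f: "\<And>g. g \<in> TS \<Longrightarrow> 0 \<le> f g" and c: "0 \<le> c"
    and h: "\<And>x g. x \<in> S \<Longrightarrow> g \<in> cyl m x \<Longrightarrow> h x \<le> f g"
    and supp: "set_pmf (Tn w n) \<subseteq> {t. nv t = n}"
  shows "(\<Sum>x\<in>S. h x * (measure_pmf.expectation (Tn w n) (windows Om (fst x)) / real n)) \<le>
     measure_pmf.expectation (pointedTn w n) (\<lambda>(t, p). case Hfr t p Om of None \<Rightarrow> c | Some g \<Rightarrow> f g)"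
proof -
  let ?val = "\<lambda>(t, p). case Hfr t p Om of None \<Rightarrow> c | Some g \<Rightarrow> f g"
  have fin: "finite (set_pmf (Tn w n))" using supp finite_subset finite_nv_eq by blast
  have "measure_pmf.expectation (pointedTn w n) ?val =
     measure_pmf.expectation (Tn w n) (\<lambda>t. (\<Sum>p\<in>verts t. ?val (t, p)) / real (nv t))"
    using fin by (rule expectation_pointedTn)
  moreover have "(\<Sum>x\<in>S. h x * (measure_pmf.expectation (Tn w n) (windows Om (fst x)) / real n)) =
     measure_pmf.expectation (Tn w n) (\<lambda>t. \<Sum>x\<in>S. h x * (windows Om (fst x) t / real n))"
    by (subst Bochner_Integration.integral_sum) (auto intro!: integrable_measure_pmf_finite fin)
  moreover have "\<dots> \<le> measure_pmf.expectation (Tn w n) (\<lambda>t. (\<Sum>p\<in>verts t. ?val (t, p)) / real (nv t))"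
  proof (intro integral_mono_AE integrable_measure_pmf_finite fin AE_pmfI)
    fix t assume "t \<in> set_pmf (Tn w n)"
    then have n: "nv t = n" using supp by auto
    have "(\<Sum>x\<in>S. h x * (windows Om (fst x) t / real n)) = (\<Sum>x\<in>S. h x * windows Om (fst x) t) / real n"
      by (simp add: sum_divide_distrib)
    also have "\<dots> \<le> (\<Sum>p\<in>verts t. ?val (t, p)) / real (nv t)"
      unfolding n using sum_windows_le[OF S Om _ c, of f h t] f h by (intro divide_right_mono) auto
    finally show "(\<Sum>x\<in>S. h x * (windows Om (fst x) t / real n)) \<le> (\<Sum>p\<in>verts t. ?val (t, p)) / real (nv t)" .
  qed
  ultimately show ?thesis by simp
qed

lemma expectation_windows_ge:
  assumes lim: "((\<lambda>n. measure_pmf.prob (Tn w n) {t. windows (\<Omega> n) cs t < r * real n}) \<longlongrightarrow> 0) F"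
    and supp: "eventually (\<lambda>n. set_pmf (Tn w n) \<subseteq> {t. nv t = n}) F" and e: "e > 0"
  shows "eventually (\<lambda>n. measure_pmf.expectation (Tn w n) (windows (\<Omega> n) cs) / real n \<ge> r - e) F"
proof -
  define r' where "r' = max r 0"
  have "((\<lambda>n. r' * measure_pmf.prob (Tn w n) {t. windows (\<Omega> n) cs t < r * real n}) \<longlongrightarrow> r' * 0) F"
    by (intro tendsto_intros lim)
  then have "eventually (\<lambda>n. r' * measure_pmf.prob (Tn w n) {t. windows (\<Omega> n) cs t < r * real n} < e) F"
    using e by (intro order_tendstoD) auto
  then show ?thesis using supp
  proof eventually_elim
    case (elim n)
    let ?B = "{t. windows (\<Omega> n) cs t < r * real n}"
    have fin: "finite (set_pmf (Tn w n))" using elim(2) finite_subset finite_nv_eq by blast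
    have n0: "n > 0"
    proof -
      obtain t where "t \<in> set_pmf (Tn w n)" using set_pmf_not_empty by fast
      then show ?thesis using elim(2) nv_pos[of t] by auto
    qed
    have "r' * real n * (1 - measure_pmf.prob (Tn w n) ?B) = measure_pmf.expectation (Tn w n) (\<lambda>t. r' * real n * indicator (- ?B) t)"
      by (simp add: measure_pmf.prob_compl[of ?B, simplified] Compl_eq_Diff_UNIV)
    also have "\<dots> \<le> measure_pmf.expectation (Tn w n) (windows (\<Omega> n) cs)"
    proof (intro integral_mono integrable_measure_pmf_finite fin)
      fix t show "r' * real n * indicator (- ?B) t \<le> windows (\<Omega> n) cs t"
        using windows_nonneg[of "\<Omega> n" cs t] by (auto simp: indicator_def r'_def max_def)
    qed
    finally have "r' * (1 - measure_pmf.prob (Tn w n) ?B) \<le> measure_pmf.expectation (Tn w n) (windows (\<Omega> n) cs) / real n"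
      using n0 by (simp add: field_simps)
    moreover have "r \<le> r'" by (simp add: r'_def)
    ultimately show ?case using elim(1) by (simp add: algebra_simps)
  qed
qed

subsection \<open>The law of the limit tree\<close>

lemma tendsto_fun_coordinatewise:
  fixes f :: "'c \<Rightarrow> 'a \<Rightarrow> 'b :: topological_space"
  assumes "\<And>u. ((\<lambda>n. f n u) \<longlongrightarrow> l u) F"
  shows "(f \<longlongrightarrow> l) F"
proof -
  have "limitin (product_topology (\<lambda>_. euclidean) UNIV) f l F"
    using assms by (subst limitin_componentwise) (auto simp: euclidean_product_topology)
  then show ?thesis by (simp add: euclidean_product_topology)
qed

lemma tendsto_SPair_infinity:
  assumes "\<And>n. enat n \<le> a n" "\<And>n. enat n \<le> b n"
  shows "(\<lambda>n. SPair (a n) (b n)) \<longlonglongrightarrow> SPair \<infinity> \<infinity>"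
proof (rule topological_tendstoI)
  fix S assume S: "open S" "SPair \<infinity> \<infinity> \<in> S"
  have inf: "c \<longlonglongrightarrow> \<infinity>" if "\<And>n. enat n \<le> c n" for c :: "nat \<Rightarrow> enat"
  proof (rule tendsto_sandwich[OF _ _ _ tendsto_const])
    show "(\<lambda>n. enat n) \<longlonglongrightarrow> \<infinity>"
    proof (rule order_tendstoI)
      fix c :: enat assume "c < \<infinity>"
      then obtain k where "c = enat k" by auto
      then show "eventually (\<lambda>n. c < enat n) sequentially"
        using eventually_gt_at_top[of k] by simp
    qed auto
  qed (use that in auto)
  have "(\<lambda>n. (a n, b n)) \<longlonglongrightarrow> (\<infinity>, \<infinity>)"
    by (intro tendsto_Pair inf assms)
  moreover have "open ((\<lambda>(a, b). SPair a b) -` S)" using S(1) by (simp add: open_tval_def)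
  ultimately show "eventually (\<lambda>n. SPair (a n) (b n) \<in> S) sequentially"
    using S(2) by (auto dest: topological_tendstoD)
qed

lemma cyl_tendsto:
  assumes T: "\<And>n. T \<in> cyl n (cs n, v n)" "\<And>n. length (v n) = L" "T (Sp L) = SPair \<infinity> \<infinity>"
    and g: "\<And>n. g n \<in> cyl n (cs n, v n)"
  shows "g \<longlonglongrightarrow> T"
proof (rule tendsto_fun_coordinatewise)
  fix u
  have eq: "g n u = T u" if "u \<noteq> Sp L" "\<And>l j xs. u = Sd L l j xs \<Longrightarrow> j < n" for n
  proof -
    have both: "h \<in> cyl n (cs n, v n) \<Longrightarrow> h u = (if below L u then enc (cs n ! n) (v n) u
        else case u of Sd i l j xs \<Rightarrow> if i = L then degv (cs n ! sib n l j) xs else Deg 0 | _ \<Rightarrow> Star)" for h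
      using that T(2)[of n] by (cases u) (simp_all add: cyl_def)
    show ?thesis by (simp only: both[OF g] both[OF T(1)])
  qed
  show "(\<lambda>n. g n u) \<longlonglongrightarrow> T u"
  proof (cases "u = Sp L")
    case True
    have "\<exists>a b. g n u = SPair a b \<and> enat n \<le> a \<and> enat n \<le> b" for n
      using g[of n] T(2)[of n] by (simp add: cyl_def True)
    then obtain a b where "\<And>n. g n u = SPair (a n) (b n) \<and> enat n \<le> a n \<and> enat n \<le> b n" by metis
    then show ?thesis using tendsto_SPair_infinity[of a b] T(3) True by simp
  next
    case False
    define k where "k = (case u of Sd i l j xs \<Rightarrow> Suc j | _ \<Rightarrow> 0)"
    have "g n u = T u" if "n \<ge> k" for n
      by (rule eq[OF False]) (use that in \<open>auto simp: k_def\<close>)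
    then have "eventually (\<lambda>n. g n u = T u) sequentially"
      unfolding eventually_sequentially by blast
    then show ?thesis by (rule tendsto_eventually)
  qed
qed

lemma countable_patterns: "countable (patterns m)"
  by (rule countableI_type)

locale limit_tree = subcritical +
  fixes \<eta> :: "(nat \<times> nat) option pmf"
  assumes pmf_None: "pmf \<eta> None = 1 - \<mu>" and pmf_Some: "\<And>a b. pmf \<eta> (Some (a, b)) = pmf \<xi> (Suc (a + b))"
begin

definition M :: "((uvert \<Rightarrow> nat) \<times> (nat \<Rightarrow> (nat \<times> nat) option)) measure" where
  "M = PiM UNIV (\<lambda>_. measure_pmf \<xi>) \<Otimes>\<^sub>M PiM UNIV (\<lambda>_. measure_pmf \<eta>)"

sublocale X: product_prob_space "\<lambda>_ :: uvert. measure_pmf \<xi>" UNIV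
  by (intro product_prob_spaceI prob_space_measure_pmf)

sublocale Y: product_prob_space "\<lambda>_ :: nat. measure_pmf \<eta>" UNIV
  by (intro product_prob_spaceI prob_space_measure_pmf)

sublocale M: prob_space M
  unfolding M_def by (intro prob_space_pair prob_space_PiM prob_space_measure_pmf)

lemma space_M [simp]: "space M = UNIV"
  by (simp add: M_def space_pair_measure space_PiM)

lemma measurable_X [measurable]: "(\<lambda>\<omega>. fst \<omega> u) \<in> measurable M (count_space UNIV)"
proof -
  have "(\<lambda>\<omega>. fst \<omega> u) \<in> measurable M (measure_pmf \<xi>)"
    unfolding M_def by measurable
  then show ?thesis by (subst (asm) measurable_cong_sets[OF refl sets_measure_pmf_count_space])
qed

lemma measurable_Y [measurable]: "(\<lambda>\<omega>. snd \<omega> i) \<in> measurable M (count_space UNIV)"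
proof -
  have "(\<lambda>\<omega>. snd \<omega> i) \<in> measurable M (measure_pmf \<eta>)"
    unfolding M_def by measurable
  then show ?thesis by (subst (asm) measurable_cong_sets[OF refl sets_measure_pmf_count_space])
qed

lemma measurable_gw:
  assumes [measurable]: "\<And>p. (\<lambda>\<omega>. F \<omega> p) \<in> measurable M (count_space UNIV)"
  shows "(\<lambda>\<omega>. gw (F \<omega>) xs) \<in> measurable M (count_space UNIV)"
  unfolding gw_def by measurable

lemma measurable_Tstarbar: "(\<lambda>\<omega>. Tstarbar \<omega> u) \<in> measurable M (count_space UNIV)"
proof -
  have L: "(\<lambda>\<omega>. LEAST i. snd \<omega> i = None) \<in> measurable M (count_space UNIV)"
    by measurable
  have gw: "(\<lambda>\<omega>. gw (\<lambda>p. fst \<omega> (D p)) xs) \<in> measurable M (count_space UNIV)" for D xs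
    by (rule measurable_gw) measurable
  show ?thesis
  proof (cases u)
    case (Dn xs)
    then show ?thesis using gw by (simp add: Tstarbar_def)
  next
    case (Sp i)
    have "(\<lambda>\<omega>. if i < L then (case y of Some (a, b) \<Rightarrow> SPair (enat a) (enat b) | None \<Rightarrow> Star)
        else if i = L then SPair \<infinity> \<infinity> else Star) \<in> measurable M (count_space UNIV)" for L y
      by simp
    from measurable_compose_countable[OF measurable_compose_countable[OF this measurable_Y[of i]] L]
    show ?thesis by (simp add: Tstarbar_def Sp Let_def)
  next
    case (Sd i l j xs)
    have "(\<lambda>\<omega>. if i < L then
             (case y of Some (a, b) \<Rightarrow> (if (if l then j < a else j < b) then gw (\<lambda>u. fst \<omega> (Sd i l j u)) xs else Deg 0)
              | None \<Rightarrow> Deg 0)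
           else if i = L then gw (\<lambda>u. fst \<omega> (Sd i l j u)) xs else Deg 0) \<in> measurable M (count_space UNIV)" for L y
      using gw[of "Sd i l j" xs] by (cases y) auto
    from measurable_compose_countable[OF measurable_compose_countable[OF this measurable_Y[of i]] L]
    show ?thesis by (simp add: Tstarbar_def Sd Let_def)
  qed
qed

text \<open>The values at the first \<open>k\<close> vertices range over a countable set, and truncating a
  configuration after these vertices converges to it as \<open>k\<close> grows.\<close>
lemma measurable_continuous_Tstarbar:
  fixes f :: "(uvert \<Rightarrow> tval) \<Rightarrow> real"
  assumes f: "continuous_on TS f"
  shows "(\<lambda>\<omega>. f (Tstarbar \<omega>)) \<in> borel_measurable M"
proof -
  define dflt :: "uvert \<Rightarrow> tval" where "dflt u = (case u of Sp i \<Rightarrow> Star | _ \<Rightarrow> Deg 0)" for u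
  define vals :: "nat \<Rightarrow> (uvert \<Rightarrow> nat) \<times> (nat \<Rightarrow> (nat \<times> nat) option) \<Rightarrow> tval list" where
    "vals k \<omega> = map (\<lambda>i. Tstarbar \<omega> (from_nat i)) [0..<k]" for k \<omega>
  define ext where "ext k xs u = (if to_nat u < k then xs ! to_nat u else dflt u)" for k :: nat and xs :: "tval list" and u :: uvert
  have ext: "ext k (vals k \<omega>) u = (if to_nat u < k then Tstarbar \<omega> u else dflt u)" for k \<omega> u
    by (simp add: ext_def vals_def)
  have vals_nth: "length (vals k \<omega>) = k" "i < k \<Longrightarrow> vals k \<omega> ! i = Tstarbar \<omega> (from_nat i)" for k \<omega> i
    by (simp_all add: vals_def)
  have "vals k \<in> measurable M (count_space UNIV)" for k
  proof -
    have "vals k -` {xs} \<inter> space M \<in> sets M" for xs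
    proof -
      have "vals k -` {xs} \<inter> space M = {\<omega> \<in> space M. length xs = k \<and> (\<forall>i\<in>{..<k}. Tstarbar \<omega> (from_nat i) = xs ! i)}"
        by (auto simp: vals_nth intro!: nth_equalityI)
      moreover have "{\<omega> \<in> space M. Tstarbar \<omega> (from_nat i) = xs ! i} \<in> sets M" for i
        using measurable_sets[OF measurable_Tstarbar[of "from_nat i"], of "{xs ! i}"]
        by (simp add: vimage_def)
      then have "{\<omega> \<in> space M. length xs = k \<and> (\<forall>i\<in>{..<k}. Tstarbar \<omega> (from_nat i) = xs ! i)} \<in> sets M"
        using sets.sets_Collect_finite_All[of "{..<k}" M "\<lambda>i \<omega>. Tstarbar \<omega> (from_nat i) = xs ! i"]
        by (cases "length xs = k") simp_all
      ultimately show ?thesis by simp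
    qed
    then show ?thesis by (simp add: measurable_count_space_eq2_countable)
  qed
  then have meas: "(\<lambda>\<omega>. f (ext k (vals k \<omega>))) \<in> borel_measurable M" for k
    by (rule measurable_compose) simp
  show ?thesis
  proof (rule borel_measurable_LIMSEQ_real[OF _ meas])
    fix \<omega>
    have "(\<lambda>k. ext k (vals k \<omega>)) \<longlonglongrightarrow> Tstarbar \<omega>"
    proof (rule tendsto_fun_coordinatewise)
      fix u
      have "eventually (\<lambda>k. ext k (vals k \<omega>) u = Tstarbar \<omega> u) sequentially"
        using eventually_gt_at_top[of "to_nat u"] by eventually_elim (simp add: ext)
      then show "(\<lambda>k. ext k (vals k \<omega>) u) \<longlonglongrightarrow> Tstarbar \<omega> u" by (rule tendsto_eventually)
    qed
    moreover have "ext k (vals k \<omega>) \<in> TS" for k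
      using Tstarbar_in_TS[of \<omega>] by (auto simp: TS_def ext dflt_def)
    ultimately show "(\<lambda>k. f (ext k (vals k \<omega>))) \<longlonglongrightarrow> f (Tstarbar \<omega>)"
      by (rule continuous_on_tendsto_compose[OF f _ Tstarbar_in_TS always_eventually[OF allI]])
  qed
qed

lemma agree_cong: "(\<And>i. i < length q \<Longrightarrow> Y i = Y' i) \<Longrightarrow> agree X Y t q = agree X Y' t q"
  by (induction t q rule: coords.induct) auto

lemma event_iff_agree:
  assumes "length cs = 2 * m + 1"
  shows "event m (cs, v) (X, Y) \<longleftrightarrow> agree X (Y(length v := Some (m, m))) (Node cs) (m # v) \<and> Y (length v) = None"
proof -
  have "agree X (Y(length v := Some (m, m))) (cs ! m) v = agree X Y (cs ! m) v"
    by (rule agree_cong) auto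
  then show ?thesis using assms by (auto simp: event_def outdeg_def)
qed

lemma event_prob:
  assumes x: "x \<in> patterns m"
  shows event_sets: "{\<omega>. event m x \<omega>} \<in> sets M"
    and measure_event: "measure M {\<omega>. event m x \<omega>} = (1 - \<mu>) * prod_list (map gwt (fst x))"
proof -
  obtain cs v where xcv: "x = (cs, v)" by (cases x)
  have cs: "length cs = 2 * m + 1" "v \<in> verts (cs ! m)" using x by (auto simp: patterns_def xcv)
  let ?t = "Node cs" and ?s = "cs ! m"
  have mv: "m # v \<in> verts ?t" using cs by (simp add: Cons_in_verts)
  define J where "J = coords ?t (m # v)"
  define a where "a = (\<lambda>u. deg_of (enc ?t (m # v) u))"
  define b where "b i = (if i < length v then Some (spine ?s v ! i) else None)" for i
  define A where "A = {X \<in> space (PiM UNIV (\<lambda>_ :: uvert. measure_pmf \<xi>)). \<forall>u\<in>J. X u \<in> {a u}}"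
  define B where "B = {Y \<in> space (PiM UNIV (\<lambda>_ :: nat. measure_pmf \<eta>)). \<forall>i\<in>{..length v}. Y i \<in> {b i}}"
  have "event m x (X, Y) \<longleftrightarrow> (X, Y) \<in> A \<times> B" for X Y
  proof -
    have "event m x (X, Y) \<longleftrightarrow> (\<forall>u\<in>J. X u = a u) \<and>
       (\<forall>i<length (m # v). (Y(length v := Some (m, m))) i = Some (spine ?t (m # v) ! i)) \<and> Y (length v) = None"
      unfolding xcv event_iff_agree[OF cs(1)] agree_iff_coords[OF mv] J_def a_def by simp
    also have "(\<forall>i<length (m # v). (Y(length v := Some (m, m))) i = Some (spine ?t (m # v) ! i)) \<longleftrightarrow>
       (\<forall>i<length v. Y i = Some (spine ?s v ! i))"
      using cs by (auto simp: nth_append less_Suc_eq outdeg_def)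
    finally show ?thesis by (auto simp: A_def B_def space_PiM b_def le_less)
  qed
  then have ev: "{\<omega>. event m x \<omega>} = A \<times> B" by auto
  have fin: "finite J" unfolding J_def by (rule finite_coords)
  have As: "A \<in> sets (PiM UNIV (\<lambda>_ :: uvert. measure_pmf \<xi>))"
    unfolding A_def using fin by (intro sets.sets_Collect_finite_All) auto
  have Bs: "B \<in> sets (PiM UNIV (\<lambda>_ :: nat. measure_pmf \<eta>))"
    unfolding B_def by (intro sets.sets_Collect_finite_All) auto
  show "{\<omega>. event m x \<omega>} \<in> sets M" unfolding ev M_def using As Bs by simp
  have "emeasure (PiM UNIV (\<lambda>_ :: uvert. measure_pmf \<xi>)) A = ennreal (\<Prod>u\<in>J. pmf \<xi> (a u))"
    unfolding A_def using fin by (subst X.emeasure_PiM_Collect) (auto simp: emeasure_pmf_single prod_ennreal)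
  moreover have "emeasure (PiM UNIV (\<lambda>_ :: nat. measure_pmf \<eta>)) B = ennreal (\<Prod>i\<le>length v. pmf \<eta> (b i))"
    unfolding B_def by (subst Y.emeasure_PiM_Collect) (auto simp: emeasure_pmf_single prod_ennreal)
  moreover have "emeasure M (A \<times> B) =
      emeasure (PiM UNIV (\<lambda>_ :: uvert. measure_pmf \<xi>)) A * emeasure (PiM UNIV (\<lambda>_ :: nat. measure_pmf \<eta>)) B"
    unfolding M_def by (rule Y.P.emeasure_pair_measure_Times[OF As Bs])
  ultimately have em: "emeasure M (A \<times> B) = ennreal ((\<Prod>u\<in>J. pmf \<xi> (a u)) * (\<Prod>i\<le>length v. pmf \<eta> (b i)))"
    by (simp add: ennreal_mult prod_nonneg)
  have mo: "m < outdeg ?t" using cs by (simp add: outdeg_def)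
  have "(\<Prod>i\<le>length v. pmf \<eta> (b i)) = (\<Prod>i<length v. pmf \<xi> (Suc (fst (spine ?s v ! i) + snd (spine ?s v ! i)))) * (1 - \<mu>)"
  proof -
    have "(\<Prod>i\<le>length v. pmf \<eta> (b i)) = (\<Prod>i<length v. pmf \<eta> (b i)) * pmf \<eta> (b (length v))"
      by (simp add: lessThan_Suc_atMost[symmetric])
    also have "(\<Prod>i<length v. pmf \<eta> (b i)) = (\<Prod>i<length v. pmf \<xi> (Suc (fst (spine ?s v ! i) + snd (spine ?s v ! i))))"
      by (intro prod.cong refl) (simp add: b_def pmf_Some[symmetric])
    finally show ?thesis by (simp add: b_def pmf_None)
  qed
  moreover have "(\<Prod>u\<in>J. pmf \<xi> (a u)) =
     (\<Prod>u\<in>coords ?s v. pmf \<xi> (deg_of (enc ?s v u))) * (\<Prod>(l, j)\<in>sibs m (outdeg ?t). gwt (cs ! sib m l j))"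
    using prod_coords_Cons[OF mo, of "pmf \<xi>" v] by (simp add: J_def a_def)
  ultimately have "(\<Prod>u\<in>J. pmf \<xi> (a u)) * (\<Prod>i\<le>length v. pmf \<eta> (b i)) =
      (1 - \<mu>) * (gwt ?s * (\<Prod>(l, j)\<in>sibs m (outdeg ?t). gwt (cs ! sib m l j)))"
    using prod_coords[OF cs(2), of "pmf \<xi>"] by (simp add: mult_ac)
  also have "\<dots> = (1 - \<mu>) * (\<Prod>i<outdeg ?t. gwt (cs ! i))"
    using prod_sibs[OF mo, of "\<lambda>i. gwt (cs ! i)"] by simp
  also have "\<dots> = (1 - \<mu>) * prod_list (map gwt cs)"
    by (simp add: prod_list_conv_lessThan outdeg_def)
  finally show "measure M {\<omega>. event m x \<omega>} = (1 - \<mu>) * prod_list (map gwt (fst x))"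
    unfolding ev measure_def em using mean_less_1 prod_list_gwt[of cs] by (simp add: xcv)
qed

lemma patterns_mass:
  assumes e: "e > 0"
  shows "\<exists>S. finite S \<and> S \<subseteq> patterns m \<and> (\<Sum>x\<in>S. (1 - \<mu>) * prod_list (map gwt (fst x))) > 1 - e"
proof -
  define S where "S N = (SIGMA cs : lists_n (trees_upto N) (2 * m + 1). verts (cs ! m))" for N
  have sum: "(\<Sum>x\<in>S N. (1 - \<mu>) * prod_list (map gwt (fst x))) = (1 - \<mu>) * mean_size N * gf N 1 ^ (2 * m)" for N
  proof -
    have "(\<Sum>x\<in>S N. (1 - \<mu>) * prod_list (map gwt (fst x))) =
        (\<Sum>cs\<in>lists_n (trees_upto N) (2 * m + 1). \<Sum>v\<in>verts (cs ! m). (1 - \<mu>) * prod_list (map gwt cs))"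
      unfolding S_def by (subst sum.Sigma) (auto simp: case_prod_beta)
    also have "\<dots> = (1 - \<mu>) * (\<Sum>cs\<in>lists_n (trees_upto N) (2 * m + 1). prod_list (map gwt cs) * real (nv (cs ! m)))"
      by (simp add: card_verts sum_distrib_left mult_ac)
    also have "\<dots> = (1 - \<mu>) * (mean_size N * gf N 1 ^ (2 * m))"
      by (subst sum_prod_nth_lists_n[where v = "\<lambda>t. real (nv t)"]) (auto simp: mean_size_def gf_def)
    finally show ?thesis by simp
  qed
  define d where "d = min (e / 2) (1 / 2)"
  have d: "0 < d" "d < 1" "2 * d \<le> e" using e by (auto simp: d_def)
  have "(\<lambda>N. gf N 1 ^ (2 * m)) \<longlonglongrightarrow> 1 ^ (2 * m)" by (intro tendsto_intros gf_1_tendsto)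
  then have "eventually (\<lambda>N. gf N 1 ^ (2 * m) > 1 - d) sequentially"
    using d by (intro order_tendstoD) auto
  then have "eventually (\<lambda>N. (1 - \<mu>) * mean_size N > 1 - d \<and> gf N 1 ^ (2 * m) > 1 - d) sequentially"
    using mean_size_lower[OF d(1)] by (rule eventually_conj[rotated])
  then obtain N where N: "(1 - \<mu>) * mean_size N > 1 - d" "gf N 1 ^ (2 * m) > 1 - d"
    unfolding eventually_sequentially by blast
  have "(1 - d) * (1 - d) < ((1 - \<mu>) * mean_size N) * gf N 1 ^ (2 * m)"
    using N d by (intro mult_strict_mono) auto
  moreover have "(1 - d) * (1 - d) = 1 - 2 * d + d * d" by (simp add: algebra_simps)
  moreover have "0 \<le> d * d" by simp
  ultimately have "(\<Sum>x\<in>S N. (1 - \<mu>) * prod_list (map gwt (fst x))) > 1 - e"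
    using d(3) unfolding sum by linarith
  moreover have "finite (S N)" by (simp add: S_def)
  moreover have "S N \<subseteq> patterns m" by (auto simp: S_def patterns_def lists_n_def)
  ultimately show ?thesis by blast
qed

lemma measure_Un_events:
  assumes "finite S" "S \<subseteq> patterns m"
  shows "measure M (\<Union>x\<in>S. {\<omega>. event m x \<omega>}) = (\<Sum>x\<in>S. (1 - \<mu>) * prod_list (map gwt (fst x)))"
proof -
  have "measure M (\<Union>x\<in>S. {\<omega>. event m x \<omega>}) = (\<Sum>x\<in>S. measure M {\<omega>. event m x \<omega>})"
  proof (rule M.finite_measure_finite_Union[OF assms(1)])
    show "(\<lambda>x. {\<omega>. event m x \<omega>}) ` S \<subseteq> sets M" using assms(2) event_sets by blast
    show "disjoint_family_on (\<lambda>x. {\<omega>. event m x \<omega>}) S"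
      unfolding disjoint_family_on_def using assms(2) event_unique by blast
  qed
  also have "\<dots> = (\<Sum>x\<in>S. (1 - \<mu>) * prod_list (map gwt (fst x)))"
    using assms by (intro sum.cong refl measure_event) auto
  finally show ?thesis .
qed

lemma AE_event: "AE \<omega> in M. \<exists>x\<in>patterns m. event m x \<omega>"
proof -
  let ?U = "\<Union>x\<in>patterns m. {\<omega>. event m x \<omega>}"
  have U: "?U \<in> sets M"
    using countable_patterns event_sets by (intro sets.countable_UN') auto
  have "1 - e \<le> measure M ?U" if e: "e > 0" for e :: real
  proof -
    obtain S where S: "finite S" "S \<subseteq> patterns m" "(\<Sum>x\<in>S. (1 - \<mu>) * prod_list (map gwt (fst x))) > 1 - e"
      using patterns_mass[OF e] by blast
    have "measure M (\<Union>x\<in>S. {\<omega>. event m x \<omega>}) \<le> measure M ?U"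
      using S U by (intro M.finite_measure_mono) auto
    then show ?thesis using S measure_Un_events by simp
  qed
  note le = this
  have "1 \<le> measure M ?U"
  proof (rule field_le_epsilon)
    fix e :: real assume "0 < e"
    from le[OF this] show "1 \<le> measure M ?U + e" by linarith
  qed
  then have "measure M ?U = 1" by (rule antisym[OF M.prob_le_1])
  then have "AE \<omega> in M. \<omega> \<in> ?U" by (rule M.AE_prob_1)
  then show ?thesis by eventually_elim auto
qed

text \<open>By continuity, the infimum of \<open>f\<close> over the cylinder around a configuration converges to the
  value there as the cylinders shrink.\<close>
lemma expectation_Tstarbar_le:
  fixes f :: "(uvert \<Rightarrow> tval) \<Rightarrow> real"
  assumes f: "continuous_on TS f" and bd: "\<And>g. g \<in> TS \<Longrightarrow> 0 \<le> f g \<and> f g \<le> B" and e: "e > 0"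
  shows "\<exists>m S h. finite S \<and> S \<subseteq> patterns m \<and> (\<forall>x\<in>S. 0 \<le> h x) \<and> (\<forall>x\<in>S. \<forall>g\<in>cyl m x. h x \<le> f g) \<and>
     (\<integral>\<omega>. f (Tstarbar \<omega>) \<partial>M) - e \<le> (\<Sum>x\<in>S. h x * ((1 - \<mu>) * prod_list (map gwt (fst x))))"
proof -
  define h where "h m x = (if cyl m x = {} then 0 else INF g\<in>cyl m x. f g)" for m x
  have cyl_TS: "cyl m x \<subseteq> TS" for m x by (auto simp: cyl_def split: prod.splits)
  have bb: "bdd_below (f ` cyl m x)" for m x
    using bd cyl_TS by (intro bdd_belowI2[of _ 0]) blast
  have h0: "0 \<le> h m x" for m x
    using cINF_greatest[of "cyl m x" 0 f] bd[OF subsetD[OF cyl_TS]] by (auto simp: h_def)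
  have hle: "h m x \<le> f g" if "g \<in> cyl m x" for m x g
    using cINF_lower[OF bb that] that by (auto simp: h_def)
  have hap: "\<exists>g\<in>cyl m x. f g < h m x + d" if "cyl m x \<noteq> {}" "d > 0" for m x d
    using cINF_less_iff[OF that(1) bb, of "h m x + d"] that by (simp add: h_def)
  have TSne: "TS \<noteq> {}" using enc_in_TS by blast
  have B0: "0 \<le> B" using bd TSne by force
  have hB: "h m x \<le> B" for m x
  proof (cases "cyl m x = {}")
    case False
    then obtain g where "g \<in> cyl m x" by blast
    then show ?thesis using hle bd cyl_TS by (meson order_trans subsetD)
  qed (simp add: h_def B0)
  define pat where "pat m \<omega> = (if \<exists>x\<in>patterns m. event m x \<omega> then Some (THE x. x \<in> patterns m \<and> event m x \<omega>) else None)" for m \<omega>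
  have pat: "pat m \<omega> = Some x" if "x \<in> patterns m" "event m x \<omega>" for m x \<omega>
  proof -
    have "(THE x. x \<in> patterns m \<and> event m x \<omega>) = x"
      using that event_unique by (intro the_equality) blast+
    then show ?thesis using that by (auto simp: pat_def)
  qed
  have pat_None: "pat m \<omega> = None \<longleftrightarrow> \<not> (\<exists>x\<in>patterns m. event m x \<omega>)" for m \<omega>
    by (simp add: pat_def)
  have pat_Some: "pat m \<omega> = Some x \<longleftrightarrow> x \<in> patterns m \<and> event m x \<omega>" for m \<omega> x
    by (metis option.distinct(1) option.inject pat pat_None)
  define H where "H m \<omega> = (case pat m \<omega> of None \<Rightarrow> 0 | Some x \<Rightarrow> h m x)" for m \<omega>
  have H: "H m \<omega> = h m x" if "x \<in> patterns m" "event m x \<omega>" for m x \<omega>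
    using pat[OF that] by (simp add: H_def)
  have pat_meas: "pat m \<in> measurable M (count_space UNIV)" for m
  proof -
    have "pat m -` {y} \<inter> space M \<in> sets M" for y
    proof (cases y)
      case None
      have "pat m -` {y} \<inter> space M = space M - (\<Union>x\<in>patterns m. {\<omega>. event m x \<omega>})"
        using None by (auto simp: pat_None)
      also have "\<dots> \<in> sets M"
        by (intro sets.Diff sets.top sets.countable_UN' countable_patterns image_subsetI event_sets)
      finally show ?thesis .
    next
      case (Some x)
      have "pat m -` {y} \<inter> space M = (if x \<in> patterns m then {\<omega>. event m x \<omega>} else {})"
        unfolding Some by (auto simp: pat_Some vimage_def)
      then show ?thesis using event_sets by simp
    qed
    then show ?thesis by (simp add: measurable_count_space_eq2_countable)
  qed
  have H_meas: "H m \<in> borel_measurable M" for m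
    unfolding H_def by (rule measurable_compose[OF pat_meas]) simp
  have H_bound: "0 \<le> H m \<omega>" "H m \<omega> \<le> B" for m \<omega>
    using h0 hB B0 by (auto simp: H_def split: option.split)
  have "AE \<omega> in M. \<forall>m. \<exists>x\<in>patterns m. event m x \<omega>"
    by (subst AE_all_countable) (intro allI AE_event)
  then have lim: "AE \<omega> in M. (\<lambda>m. H m \<omega>) \<longlonglongrightarrow> f (Tstarbar \<omega>)"
  proof eventually_elim
    case (elim \<omega>)
    then obtain x where x: "\<And>m. x m \<in> patterns m" "\<And>m. event m (x m) \<omega>" by metis
    define cs v where "cs m = fst (x m)" and "v m = snd (x m)" for m
    obtain X Y where \<omega>: "\<omega> = (X, Y)" by (cases \<omega>)
    define L where "L = (LEAST i. Y i = None)"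
    have T: "Tstarbar \<omega> \<in> cyl m (cs m, v m)" for m
      using event_imp_cyl[OF x(2) x(1)] by (simp add: cs_def v_def)
    have len: "length (v m) = L" for m
      using event_least[of m "cs m" "v m" X Y] x(2)[of m] by (simp add: cs_def v_def \<omega> L_def)
    have TL: "Tstarbar \<omega> (Sp L) = SPair \<infinity> \<infinity>" by (simp add: Tstarbar_def \<omega> L_def)
    have "\<exists>g\<in>cyl m (cs m, v m). f g < h m (cs m, v m) + inverse (real (Suc m))" for m
      using T by (intro hap) auto
    then obtain g where g: "\<And>m. g m \<in> cyl m (cs m, v m)" "\<And>m. f (g m) < h m (cs m, v m) + inverse (real (Suc m))"
      by metis
    have Hx: "H m \<omega> = h m (cs m, v m)" for m using H[OF x(1,2)] by (simp add: cs_def v_def)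
    have "g \<longlonglongrightarrow> Tstarbar \<omega>" by (rule cyl_tendsto[OF T len TL g(1)])
    then have "(\<lambda>m. f (g m)) \<longlonglongrightarrow> f (Tstarbar \<omega>)"
      by (rule continuous_on_tendsto_compose[OF f _ Tstarbar_in_TS always_eventually[OF allI]])
        (rule subsetD[OF cyl_TS g(1)])
    then have "(\<lambda>m. f (g m) - inverse (real (Suc m))) \<longlonglongrightarrow> f (Tstarbar \<omega>) - 0"
      by (intro tendsto_diff LIMSEQ_inverse_real_of_nat)
    then have low: "(\<lambda>m. f (g m) - inverse (real (Suc m))) \<longlonglongrightarrow> f (Tstarbar \<omega>)" by simp
    have "f (g m) - inverse (real (Suc m)) \<le> H m \<omega>" for m
      using g(2)[of m] unfolding Hx by linarith
    moreover have "H m \<omega> \<le> f (Tstarbar \<omega>)" for m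
      unfolding Hx by (rule hle[OF T])
    ultimately show ?case
      by (intro tendsto_sandwich[OF always_eventually always_eventually low tendsto_const] allI)
  qed
  have "(\<lambda>m. integral\<^sup>L M (H m)) \<longlonglongrightarrow> (\<integral>\<omega>. f (Tstarbar \<omega>) \<partial>M)"
    using H_bound
    by (intro integral_dominated_convergence[where w = "\<lambda>_. B"] measurable_continuous_Tstarbar f H_meas lim) auto
  then have "eventually (\<lambda>m. (\<integral>\<omega>. f (Tstarbar \<omega>) \<partial>M) - e / 2 < integral\<^sup>L M (H m)) sequentially"
    using e by (intro order_tendstoD) auto
  then obtain m where m: "(\<integral>\<omega>. f (Tstarbar \<omega>) \<partial>M) - e / 2 < integral\<^sup>L M (H m)"
    unfolding eventually_sequentially by blast
  define d where "d = e / (2 * (B + 1))"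
  have d: "d > 0" "B * d \<le> e / 2" using e B0 by (auto simp: d_def field_simps)
  obtain S where S: "finite S" "S \<subseteq> patterns m" "(\<Sum>x\<in>S. (1 - \<mu>) * prod_list (map gwt (fst x))) > 1 - d"
    using patterns_mass[OF d(1)] by blast
  let ?U = "\<Union>x\<in>S. {\<omega>. event m x \<omega>}"
  have Us: "?U \<in> sets M" using S event_sets by (intro sets.finite_UN) auto
  have "integral\<^sup>L M (H m) \<le> (\<integral>\<omega>. (\<Sum>x\<in>S. h m x * indicator {\<omega>. event m x \<omega>} \<omega>) + B * indicator (UNIV - ?U) \<omega> \<partial>M)"
  proof (intro integral_mono)
    show "integrable M (H m)"
      using H_bound by (intro M.integrable_const_bound[of _ B] H_meas) auto
    show "integrable M (\<lambda>\<omega>. (\<Sum>x\<in>S. h m x * indicator {\<omega>. event m x \<omega>} \<omega>) + B * indicator (UNIV - ?U) \<omega>)"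
      using S Us event_sets sets.compl_sets[OF Us]
      by (intro Bochner_Integration.integrable_add Bochner_Integration.integrable_sum integrable_mult_right
          integrable_real_indicator) (auto simp: M.emeasure_eq_measure)
    fix \<omega>
    show "H m \<omega> \<le> (\<Sum>x\<in>S. h m x * indicator {\<omega>. event m x \<omega>} \<omega>) + B * indicator (UNIV - ?U) \<omega>"
    proof (cases "\<omega> \<in> ?U")
      case True
      then obtain x where x: "x \<in> S" "event m x \<omega>" by auto
      then have "H m \<omega> = h m x * indicator {\<omega>. event m x \<omega>} \<omega>"
        using H[OF subsetD[OF S(2) x(1)] x(2)] by simp
      also have "\<dots> \<le> (\<Sum>x\<in>S. h m x * indicator {\<omega>. event m x \<omega>} \<omega>)"
        using x S h0 by (intro member_le_sum[of x S "\<lambda>x. h m x * indicator {\<omega>. event m x \<omega>} \<omega>"]) auto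
      finally show ?thesis using True by simp
    next
      case False
      have "0 \<le> (\<Sum>x\<in>S. h m x * indicator {\<omega>. event m x \<omega>} \<omega>)" using h0 by (intro sum_nonneg) auto
      then show ?thesis using H_bound[of m \<omega>] False by auto
    qed
  qed
  also have "\<dots> = (\<Sum>x\<in>S. h m x * measure M {\<omega>. event m x \<omega>}) + B * measure M (UNIV - ?U)"
    using S Us event_sets sets.compl_sets[OF Us]
    by (subst Bochner_Integration.integral_add, (intro Bochner_Integration.integrable_sum integrable_mult_right
          integrable_real_indicator; auto simp: M.emeasure_eq_measure), (intro integrable_mult_right
          integrable_real_indicator; auto simp: M.emeasure_eq_measure),
        subst Bochner_Integration.integral_sum, (intro integrable_mult_right
          integrable_real_indicator; auto simp: M.emeasure_eq_measure)) simp
  also have "(\<Sum>x\<in>S. h m x * measure M {\<omega>. event m x \<omega>}) = (\<Sum>x\<in>S. h m x * ((1 - \<mu>) * prod_list (map gwt (fst x))))"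
    using S by (intro sum.cong refl arg_cong2[of _ _ _ _ "(*)"] measure_event) auto
  also have "B * measure M (UNIV - ?U) \<le> B * d"
    using M.prob_compl[OF Us] measure_Un_events[OF S(1,2)] S(3) B0 by (intro mult_left_mono) auto
  finally have "(\<integral>\<omega>. f (Tstarbar \<omega>) \<partial>M) - e \<le> (\<Sum>x\<in>S. h m x * ((1 - \<mu>) * prod_list (map gwt (fst x))))"
    using m d by linarith
  then show ?thesis using S h0 hle by (intro exI[of _ m] exI[of _ S] exI[of _ "h m"]) auto
qed

end

context limit_tree
begin

lemma expectation_pointedTn_lower:
  fixes f :: "(uvert \<Rightarrow> tval) \<Rightarrow> real" and \<Omega> :: "nat \<Rightarrow> real"
  assumes win: "\<And>cs d. cs \<noteq> [] \<Longrightarrow> d > 0 \<Longrightarrow> ((\<lambda>n. measure_pmf.prob (Tn w n)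
        {t. windows (\<Omega> n) cs t < ((1 - \<mu>) * prod_list (map gwt cs) - d) * real n}) \<longlongrightarrow> 0) F"
    and supp: "eventually (\<lambda>n. set_pmf (Tn w n) \<subseteq> {t. nv t = n}) F"
    and Om: "filterlim \<Omega> at_top F"
    and f: "continuous_on TS f" and bd: "\<And>g. g \<in> TS \<Longrightarrow> 0 \<le> f g \<and> f g \<le> B" and c: "0 \<le> c" and e: "e > 0"
  shows "eventually (\<lambda>n. (\<integral>\<omega>. f (Tstarbar \<omega>) \<partial>M) - e \<le>
     measure_pmf.expectation (pointedTn w n) (\<lambda>(t, p). case Hfr t p (\<Omega> n) of None \<Rightarrow> c | Some x \<Rightarrow> f x)) F"
proof -
  have "e / 2 > 0" using e by simp
  then obtain m S h where S: "finite S" "S \<subseteq> patterns m" and h0': "\<forall>x\<in>S. 0 \<le> h x"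
    and h': "\<forall>x\<in>S. \<forall>g\<in>cyl m x. h x \<le> f g"
    and le: "(\<integral>\<omega>. f (Tstarbar \<omega>) \<partial>M) - e / 2 \<le> (\<Sum>x\<in>S. h x * ((1 - \<mu>) * prod_list (map gwt (fst x))))"
    using expectation_Tstarbar_le[OF f bd, of "e / 2"] by blast
  have h0: "0 \<le> h x" if "x \<in> S" for x using h0' that by blast
  have h: "h x \<le> f g" if "x \<in> S" "g \<in> cyl m x" for x g using h' that by blast
  define d where "d = e / (4 * (1 + sum h S))"
  have hs: "sum h S \<ge> 0" using h0 by (rule sum_nonneg)
  have d: "d > 0" using e hs by (simp add: d_def)
  have dh: "sum h S * (2 * d) \<le> e / 2"
    using e hs by (simp add: d_def field_simps)
  have "eventually (\<lambda>n. (1 - \<mu>) * prod_list (map gwt (fst x)) - 2 * d \<le>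
      measure_pmf.expectation (Tn w n) (windows (\<Omega> n) (fst x)) / real n) F" if x: "x \<in> S" for x
  proof -
    have ne: "fst x \<noteq> []" using S x by (auto simp: patterns_def)
    show ?thesis
      using expectation_windows_ge[OF win[OF ne d] supp d] by (simp add: algebra_simps)
  qed
  then have "eventually (\<lambda>n. \<forall>x\<in>S. (1 - \<mu>) * prod_list (map gwt (fst x)) - 2 * d \<le>
      measure_pmf.expectation (Tn w n) (windows (\<Omega> n) (fst x)) / real n) F"
    using S(1) by (simp add: eventually_ball_finite_distrib)
  moreover have "eventually (\<lambda>n. \<forall>x\<in>S. real (nv (fst x ! m)) \<le> \<Omega> n) F"
    using S(1) Om by (simp add: eventually_ball_finite_distrib filterlim_at_top)
  ultimately show ?thesis using supp
  proof eventually_elim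
    case (elim n)
    have "(\<Sum>x\<in>S. h x * ((1 - \<mu>) * prod_list (map gwt (fst x)))) - sum h S * (2 * d) =
        (\<Sum>x\<in>S. h x * ((1 - \<mu>) * prod_list (map gwt (fst x)) - 2 * d))"
      by (simp add: right_diff_distrib sum_subtractf sum_distrib_right)
    also have "\<dots> \<le> (\<Sum>x\<in>S. h x * (measure_pmf.expectation (Tn w n) (windows (\<Omega> n) (fst x)) / real n))"
      using elim(1) h0 by (intro sum_mono mult_left_mono) auto
    also have "\<dots> \<le> measure_pmf.expectation (pointedTn w n) (\<lambda>(t, p). case Hfr t p (\<Omega> n) of None \<Rightarrow> c | Some x \<Rightarrow> f x)"
      using elim(2,3) bd c h by (intro expectation_pointedTn_ge[OF S]) auto
    finally show ?case using le dh by linarith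
  qed
qed

lemma integrable_continuous_Tstarbar:
  fixes f :: "(uvert \<Rightarrow> tval) \<Rightarrow> real"
  assumes "continuous_on TS f" "\<And>g. g \<in> TS \<Longrightarrow> \<bar>f g\<bar> \<le> B"
  shows "integrable M (\<lambda>\<omega>. f (Tstarbar \<omega>))"
  using assms Tstarbar_in_TS
  by (intro M.integrable_const_bound[of _ B] measurable_continuous_Tstarbar) auto

theorem expectation_pointedTn_tendsto:
  fixes f :: "(uvert \<Rightarrow> tval) \<Rightarrow> real" and \<Omega> :: "nat \<Rightarrow> real"
  assumes win: "\<And>cs d. cs \<noteq> [] \<Longrightarrow> d > 0 \<Longrightarrow> ((\<lambda>n. measure_pmf.prob (Tn w n)
        {t. windows (\<Omega> n) cs t < ((1 - \<mu>) * prod_list (map gwt cs) - d) * real n}) \<longlongrightarrow> 0) F"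
    and supp: "eventually (\<lambda>n. set_pmf (Tn w n) \<subseteq> {t. nv t = n}) F"
    and Om: "filterlim \<Omega> at_top F"
    and f: "continuous_on TS f" and bd: "bounded (f ` TS)"
  shows "((\<lambda>n. measure_pmf.expectation (pointedTn w n) (\<lambda>(t, p). case Hfr t p (\<Omega> n) of None \<Rightarrow> c | Some x \<Rightarrow> f x))
     \<longlongrightarrow> (\<integral>\<omega>. f (Tstarbar \<omega>) \<partial>M)) F"
proof (rule tendstoI)
  fix e :: real assume e: "e > 0"
  obtain B0 where B0: "\<And>g. g \<in> TS \<Longrightarrow> \<bar>f g\<bar> \<le> B0" using bd by (auto simp: bounded_iff)
  define B where "B = max B0 \<bar>c\<bar>"
  have B: "\<bar>f g\<bar> \<le> B" if "g \<in> TS" for g using B0[OF that] by (simp add: B_def)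
  have cB: "\<bar>c\<bar> \<le> B" by (simp add: B_def)
  let ?I = "\<integral>\<omega>. f (Tstarbar \<omega>) \<partial>M"
  let ?v = "\<lambda>n. (\<lambda>(t, p). case Hfr t p (\<Omega> n) of None \<Rightarrow> c | Some x \<Rightarrow> f x)"
  let ?E = "\<lambda>n. measure_pmf.expectation (pointedTn w n) (?v n)"
  have UNIV: "measure M UNIV = 1" using M.prob_space by simp
  have int: "integrable M (\<lambda>\<omega>. f (Tstarbar \<omega>))" using f B by (rule integrable_continuous_Tstarbar)
  have vB: "\<bar>?v n y\<bar> \<le> B" for n y
    using B cB Hfr_in_TS[of "fst y" "snd y" "\<Omega> n"] by (cases y) (auto split: option.split)
  have intv: "integrable (measure_pmf (pointedTn w n)) (?v n)" for n
    by (rule measure_pmf.integrable_const_bound[of _ B]) (use vB in auto)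
  have "eventually (\<lambda>n. (\<integral>\<omega>. f (Tstarbar \<omega>) + B \<partial>M) - e / 2 \<le>
     measure_pmf.expectation (pointedTn w n) (\<lambda>(t, p). case Hfr t p (\<Omega> n) of None \<Rightarrow> c + B | Some x \<Rightarrow> f x + B)) F"
  proof (rule expectation_pointedTn_lower[where f = "\<lambda>g. f g + B" and B = "2 * B"])
    show "continuous_on TS (\<lambda>g. f g + B)" by (intro continuous_intros f)
    show "0 \<le> f g + B \<and> f g + B \<le> 2 * B" if "g \<in> TS" for g using B[OF that] by linarith
    show "0 \<le> c + B" using cB by linarith
    show "0 < e / 2" using e by simp
  qed (auto intro: win supp Om)
  moreover have "eventually (\<lambda>n. (\<integral>\<omega>. B - f (Tstarbar \<omega>) \<partial>M) - e / 2 \<le>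
     measure_pmf.expectation (pointedTn w n) (\<lambda>(t, p). case Hfr t p (\<Omega> n) of None \<Rightarrow> B - c | Some x \<Rightarrow> B - f x)) F"
  proof (rule expectation_pointedTn_lower[where f = "\<lambda>g. B - f g" and B = "2 * B"])
    show "continuous_on TS (\<lambda>g. B - f g)" by (intro continuous_intros f)
    show "0 \<le> B - f g \<and> B - f g \<le> 2 * B" if "g \<in> TS" for g using B[OF that] by linarith
    show "0 \<le> B - c" using cB by linarith
    show "0 < e / 2" using e by simp
  qed (auto intro: win supp Om)
  ultimately show "eventually (\<lambda>n. dist (?E n) ?I < e) F"
  proof eventually_elim
    case (elim n)
    have "(\<lambda>(t, p). case Hfr t p (\<Omega> n) of None \<Rightarrow> c + B | Some x \<Rightarrow> f x + B) = (\<lambda>y. ?v n y + B)"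
      by (auto simp: fun_eq_iff split: option.split)
    then have "?I + B - e / 2 \<le> ?E n + B"
      using elim(1) int intv by (simp add: UNIV)
    moreover have "(\<lambda>(t, p). case Hfr t p (\<Omega> n) of None \<Rightarrow> B - c | Some x \<Rightarrow> B - f x) = (\<lambda>y. B - ?v n y)"
      by (auto simp: fun_eq_iff split: option.split)
    then have "B - ?I - e / 2 \<le> B - ?E n"
      using elim(2) int intv by (simp add: UNIV)
    ultimately show ?case using e by (simp add: dist_real_def)
  qed
qed

end

subsection \<open>Weight sequences of types II and III\<close>

lemma pmf_xi:
  assumes w: "\<And>k. w k \<ge> 0" and t: "\<tau> \<ge> 0" and s: "summable (\<lambda>k. w k * \<tau> ^ k)" and pos: "phi w \<tau> > 0"
  shows "pmf (xi w \<tau>) k = \<tau> ^ k * w k / phi w \<tau>"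
proof -
  have "(\<lambda>k. w k * \<tau> ^ k) sums phi w \<tau>" using s by (simp add: phi_def summable_sums)
  from sums_divide[OF this, of "phi w \<tau>"] have "(\<lambda>k. \<tau> ^ k * w k / phi w \<tau>) sums 1"
    using pos by (simp add: mult.commute)
  moreover have nn: "0 \<le> \<tau> ^ k * w k / phi w \<tau>" for k using w t pos by simp
  ultimately have "(\<integral>\<^sup>+ k. ennreal (\<tau> ^ k * w k / phi w \<tau>) \<partial>count_space UNIV) = ennreal 1"
    unfolding nn_integral_count_space_nat by (intro suminf_ennreal_eq)
  then show ?thesis unfolding xi_def using nn by (subst pmf_embed_pmf) auto
qed

lemma nn_integral_count_space_option:
  "(\<integral>\<^sup>+ y. f y \<partial>count_space UNIV) = f None + (\<integral>\<^sup>+ x. f (Some x) \<partial>count_space UNIV)"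
proof -
  have "(\<integral>\<^sup>+ y. f y \<partial>count_space UNIV) = (\<integral>\<^sup>+ y. f y * indicator {None} y + f y * indicator (range Some) y \<partial>count_space UNIV)"
  proof (rule nn_integral_cong)
    fix y show "f y = f y * indicator {None} y + f y * indicator (range Some) y"
      by (cases y) (auto simp: indicator_def)
  qed
  also have "\<dots> = (\<integral>\<^sup>+ y. f y * indicator {None} y \<partial>count_space UNIV) + (\<integral>\<^sup>+ y. f y * indicator (range Some) y \<partial>count_space UNIV)"
    by (rule nn_integral_add) auto
  also have "(\<integral>\<^sup>+ y. f y * indicator (range Some) y \<partial>count_space UNIV) = (\<integral>\<^sup>+ y. f y \<partial>count_space (range Some))"
    by (simp add: nn_integral_count_space_indicator)
  also have "\<dots> = (\<integral>\<^sup>+ x. f (Some x) \<partial>count_space UNIV)"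
    by (rule nn_integral_bij_count_space[symmetric]) (auto simp: bij_betw_def)
  also have "(\<integral>\<^sup>+ y. f y * indicator {None} y \<partial>count_space UNIV) = f None"
    by (subst nn_integral_indicator_finite) auto
  finally show ?thesis .
qed

lemma nn_integral_pairs_shifted_sum:
  fixes p :: "nat \<Rightarrow> ennreal"
  shows "(\<integral>\<^sup>+ (a, b). p (a + b + 1) \<partial>count_space UNIV) = (\<integral>\<^sup>+ k. of_nat k * p k \<partial>count_space UNIV)"
proof -
  have "(\<integral>\<^sup>+ (a, b). p (a + b + 1) \<partial>count_space UNIV) =
      (\<integral>\<^sup>+ a. \<integral>\<^sup>+ b. p (a + b + 1) \<partial>count_space UNIV \<partial>count_space UNIV)"
    by (subst nn_integral_fst_count_space[symmetric]) simp
  also have "\<dots> = (\<integral>\<^sup>+ a. \<integral>\<^sup>+ k. (p k * indicator {a<..} k) \<partial>count_space UNIV \<partial>count_space UNIV)"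
  proof (rule nn_integral_cong)
    fix a :: nat
    have "bij_betw (\<lambda>b. a + b + 1) UNIV {a<..}"
      by (rule bij_betw_byWitness[where f' = "\<lambda>k. k - a - 1"]) auto
    then have "(\<integral>\<^sup>+ b. p (a + b + 1) \<partial>count_space UNIV) = (\<integral>\<^sup>+ k. p k \<partial>count_space {a<..})"
      by (rule nn_integral_bij_count_space)
    then show "(\<integral>\<^sup>+ b. p (a + b + 1) \<partial>count_space UNIV) = (\<integral>\<^sup>+ k. p k * indicator {a<..} k \<partial>count_space UNIV)"
      by (simp add: nn_integral_count_space_indicator)
  qed
  also have "\<dots> = (\<integral>\<^sup>+ k. \<integral>\<^sup>+ a. (p k * indicator {a<..} k) \<partial>count_space UNIV \<partial>count_space UNIV)"
    using nn_integral_fst_count_space[of "\<lambda>(a, k). p k * indicator {a<..} k"]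
      nn_integral_snd_count_space[of "\<lambda>(a, k). p k * indicator {a<..} k"] by simp
  also have "\<dots> = (\<integral>\<^sup>+ k. of_nat k * p k \<partial>count_space UNIV)"
  proof (rule nn_integral_cong)
    fix k :: nat
    have "(\<integral>\<^sup>+ a. (p k * indicator {a<..} k) \<partial>count_space UNIV) = (\<integral>\<^sup>+ a. p k * indicator {..<k} a \<partial>count_space UNIV)"
      by (intro nn_integral_cong) (auto simp: indicator_def)
    also have "\<dots> = of_nat k * p k"
      by (subst nn_integral_cmult_indicator) (auto simp: mult.commute)
    finally show "(\<integral>\<^sup>+ a. (p k * indicator {a<..} k) \<partial>count_space UNIV) = of_nat k * p k" .
  qed
  finally show ?thesis .
qed

lemma limit_tree_xi_yhat:
  assumes mean: "(\<lambda>k. real k * pmf (xi w \<tau>) k) sums mu w \<tau>" and m1: "mu w \<tau> < 1"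
  shows "limit_tree (xi w \<tau>) (mu w \<tau>) (yhat w \<tau>)"
proof -
  have m0: "mu w \<tau> \<ge> 0" using sums_le[OF _ sums_zero mean] by simp
  let ?f = "\<lambda>y. case y of None \<Rightarrow> 1 - mu w \<tau> | Some (a, b) \<Rightarrow> pmf (xi w \<tau>) (a + b + 1)"
  have "(\<integral>\<^sup>+ y. ennreal (?f y) \<partial>count_space UNIV) =
      ennreal (1 - mu w \<tau>) + (\<integral>\<^sup>+ (a, b). ennreal (pmf (xi w \<tau>) (a + b + 1)) \<partial>count_space UNIV)"
    by (subst nn_integral_count_space_option) (auto intro!: arg_cong2[of _ _ _ _ "(+)"] nn_integral_cong)
  also have "(\<integral>\<^sup>+ (a, b). ennreal (pmf (xi w \<tau>) (a + b + 1)) \<partial>count_space UNIV) =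
      (\<integral>\<^sup>+ k. ennreal (real k * pmf (xi w \<tau>) k) \<partial>count_space UNIV)"
    by (subst nn_integral_pairs_shifted_sum) (simp add: ennreal_mult ennreal_of_nat_eq_real_of_nat)
  also have "\<dots> = ennreal (mu w \<tau>)"
    unfolding nn_integral_count_space_nat by (rule suminf_ennreal_eq[OF _ mean]) simp
  also have "ennreal (1 - mu w \<tau>) + ennreal (mu w \<tau>) = 1"
    using m0 m1 by (simp flip: ennreal_plus)
  finally have int: "(\<integral>\<^sup>+ y. ennreal (?f y) \<partial>count_space UNIV) = 1" .
  have nn: "0 \<le> ?f y" for y using m1 by (auto split: option.split)
  have "pmf (yhat w \<tau>) y = ?f y" for y
    unfolding yhat_def by (rule pmf_embed_pmf[OF nn int])
  then show ?thesis using mean m1 by unfold_locales auto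
qed

lemma typeII_mean:
  assumes w: "weight_seq w" and II: "typeII w \<tau>"
  shows "summable (\<lambda>k. w k * \<tau> ^ k)" "summable (\<lambda>k. real k * (w k * \<tau> ^ k))"
    "(\<Sum>k. real k * (w k * \<tau> ^ k)) < (\<Sum>k. w k * \<tau> ^ k)"
proof -
  have w0: "w k \<ge> 0" for k using w by (simp add: weight_seq_def)
  have w00: "w 0 > 0" using w by (simp add: weight_seq_def)
  obtain \<nu> where rad: "conv_radius w = ereal \<tau>" and tau: "\<tau> > 0" and lim: "(psi w \<longlongrightarrow> \<nu>) (at_left \<tau>)"
    and nu: "0 < \<nu>" "\<nu> < 1" using II by (auto simp: typeII_def)
  define c where "c = (1 + \<nu>) / 2"
  have c: "\<nu> < c" "0 < c" "c < 1" using nu by (auto simp: c_def)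
  let ?a = "\<lambda>k. w k * \<tau> ^ k"
  have a0: "?a k \<ge> 0" for k using w0 tau by simp
  have part: "(\<Sum>k\<le>N. (real k - c) * ?a k) \<le> 0" for N
  proof (rule tendsto_upperbound)
    have "isCont (\<lambda>t. \<Sum>k\<le>N. (real k - c) * (w k * t ^ k)) \<tau>" by (intro continuous_intros)
    then show "((\<lambda>t. \<Sum>k\<le>N. (real k - c) * (w k * t ^ k)) \<longlongrightarrow> (\<Sum>k\<le>N. (real k - c) * ?a k)) (at_left \<tau>)"
      by (simp add: isCont_def filterlim_at_split)
    have "eventually (\<lambda>t. psi w t < c) (at_left \<tau>)" using order_tendstoD(2)[OF lim c(1)] .
    moreover have "eventually (\<lambda>t. t \<in> {0<..<\<tau>}) (at_left \<tau>)" using eventually_at_left_real[OF tau] .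
    ultimately show "eventually (\<lambda>t. (\<Sum>k\<le>N. (real k - c) * (w k * t ^ k)) \<le> 0) (at_left \<tau>)"
    proof eventually_elim
      case (elim t)
      have t: "0 < t" "t < \<tau>" using elim(2) by auto
      have sm: "summable (\<lambda>n. w n * x ^ n)" if "norm x < \<tau>" for x :: real
        using that by (intro summable_in_conv_radius) (simp add: rad)
      have s1: "summable (\<lambda>n. w n * t ^ n)" using t by (intro sm) simp
      have "((\<lambda>x. \<Sum>n. w n * x ^ n) has_field_derivative (\<Sum>n. diffs w n * t ^ n)) (at t)"
        by (rule termdiffs_strong'[of \<tau>]) (use sm t in auto)
      then have der: "deriv (phi w) t = (\<Sum>n. diffs w n * t ^ n)"
        using DERIV_imp_deriv by (simp add: phi_def[abs_def])
      have sd: "summable (\<lambda>n. diffs w n * t ^ n)"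
        by (rule termdiff_converges[of _ \<tau>]) (use sm t in auto)
      have "(\<lambda>n. t * (diffs w n * t ^ n)) sums (t * deriv (phi w) t)"
        unfolding der using sd by (intro sums_mult summable_sums)
      then have "(\<lambda>n. real (Suc n) * (w (Suc n) * t ^ Suc n)) sums (t * deriv (phi w) t)"
        by (simp add: diffs_def mult_ac)
      then have s2: "(\<lambda>k. real k * (w k * t ^ k)) sums (t * deriv (phi w) t)"
        by (subst (asm) sums_Suc_iff) simp
      have s3: "(\<lambda>k. w k * t ^ k) sums phi w t" using s1 by (simp add: phi_def summable_sums)
      have "w 0 * t ^ 0 \<le> phi w t"
        using sum_le_suminf[OF s1, of "{0}"] w0 t by (simp add: phi_def)
      then have "phi w t > 0" using w00 by simp
      then have le: "t * deriv (phi w) t - c * phi w t \<le> 0" using elim(1) by (simp add: psi_def field_simps)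
      have s4: "(\<lambda>k. (real k - c) * (w k * t ^ k)) sums (t * deriv (phi w) t - c * phi w t)"
        using sums_diff[OF s2 sums_mult[OF s3, of c]] by (simp add: algebra_simps)
      have "(\<Sum>k\<le>N. (real k - c) * (w k * t ^ k)) \<le> (\<Sum>k. (real k - c) * (w k * t ^ k))"
      proof (rule sum_le_suminf[OF sums_summable[OF s4]])
        fix k assume "k \<in> - {..N}"
        then have "real k \<ge> 1" by simp
        then show "0 \<le> (real k - c) * (w k * t ^ k)" using c w0 t by (intro mult_nonneg_nonneg) auto
      qed simp
      also have "\<dots> \<le> 0" using le sums_unique[OF s4] by simp
      finally show ?case .
    qed
  qed (use tau in auto)
  have "(1 - c) * (\<Sum>k\<le>N. real k * ?a k) \<le> c * ?a 0" for N
  proof -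
    have "(1 - c) * (\<Sum>k\<le>N. real k * ?a k) \<le> (\<Sum>k\<le>N. (real k - c) * ?a k + (if k = 0 then c * ?a 0 else 0))"
      unfolding sum_distrib_left
    proof (intro sum_mono)
      fix k
      show "(1 - c) * (real k * ?a k) \<le> (real k - c) * ?a k + (if k = 0 then c * ?a 0 else 0)"
      proof (cases "k = 0")
        case False
        then have "0 \<le> c * (real k - 1) * ?a k" using c w0 tau by (intro mult_nonneg_nonneg) auto
        then show ?thesis using False by (simp add: algebra_simps)
      qed simp
    qed
    also have "\<dots> \<le> c * ?a 0" using part[of N] by (simp add: sum.distrib)
    finally show ?thesis .
  qed
  then have bd: "(\<Sum>k\<le>N. real k * ?a k) \<le> c * ?a 0 / (1 - c)" for N
    using c by (simp add: field_simps)
  show s2: "summable (\<lambda>k. real k * ?a k)"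
  proof (rule summableI_nonneg_bounded)
    show "(\<Sum>k<n. real k * ?a k) \<le> c * ?a 0 / (1 - c)" for n
    proof -
      have "(\<Sum>k<n. real k * ?a k) \<le> (\<Sum>k\<le>n. real k * ?a k)"
        using w0 tau by (intro sum_mono2 mult_nonneg_nonneg) auto
      then show ?thesis using bd[of n] by linarith
    qed
  qed (use a0 in auto)
  show s1: "summable ?a"
  proof (rule summable_comparison_test_ev[OF _ s2])
    show "eventually (\<lambda>k. norm (?a k) \<le> real k * ?a k) sequentially"
      using eventually_ge_at_top[of 1]
    proof eventually_elim
      case (elim k)
      then show ?case using mult_right_mono[of 1 "real k" "?a k"] a0[of k] by simp
    qed
  qed
  have "(\<lambda>N. \<Sum>k\<le>N. (real k - c) * ?a k) \<longlonglongrightarrow> (\<Sum>k. real k * ?a k) - c * (\<Sum>k. ?a k)"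
    using sums_diff[OF summable_sums[OF s2] sums_mult[OF summable_sums[OF s1], of c]]
    by (simp add: sums_def_le left_diff_distrib)
  then have "(\<Sum>k. real k * ?a k) - c * (\<Sum>k. ?a k) \<le> 0"
    by (rule LIMSEQ_le_const2) (use part in auto)
  moreover have "?a 0 \<le> (\<Sum>k. ?a k)" using sum_le_suminf[OF s1, of "{0}"] w0 tau by simp
  then have "c * (\<Sum>k. ?a k) < 1 * (\<Sum>k. ?a k)" using c w00 by (intro mult_strict_right_mono) auto
  ultimately show "(\<Sum>k. real k * ?a k) < (\<Sum>k. ?a k)" by simp
qed

lemma wt_tilt: "wt (\<lambda>k. b ^ k * w k / a) t = b ^ (nv t - 1) / a ^ nv t * wt w t"
proof -
  have "wt (\<lambda>k. b ^ k * w k / a) t = (\<Prod>p\<in>verts t. b ^ outdeg (the (subt t p))) * wt w t / a ^ nv t"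
    unfolding wt_conv_prod by (simp add: prod.distrib prod_dividef card_verts)
  also have "(\<Prod>p\<in>verts t. b ^ outdeg (the (subt t p))) = b ^ tot outdeg t"
    by (simp add: tot_def power_sum)
  also have "tot outdeg t = nv t - 1" using tot_outdeg[of t] by simp
  finally show ?thesis by simp
qed

lemma Tn_tilt:
  assumes "b \<noteq> 0" "a \<noteq> 0"
  shows "Tn (\<lambda>k. b ^ k * w k / a) n = Tn w n"
proof -
  have Z: "Zn (\<lambda>k. b ^ k * w k / a) n = b ^ (n - 1) / a ^ n * Zn w n"
    by (simp add: Zn_def sum_distrib_left wt_tilt)
  show ?thesis unfolding Tn_def Z wt_tilt using assms by (intro arg_cong[of _ _ embed_pmf]) auto
qed

lemma phi_pos:
  assumes w: "weight_seq w" and t: "\<tau> \<ge> 0" and s: "summable (\<lambda>k. w k * \<tau> ^ k)"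
  shows "phi w \<tau> > 0"
proof -
  have "w 0 * \<tau> ^ 0 \<le> phi w \<tau>"
    using sum_le_suminf[OF s, of "{0}"] w t by (simp add: phi_def weight_seq_def)
  then show ?thesis using w by (simp add: weight_seq_def)
qed

lemma typeII_windows:
  fixes \<Omega> :: "nat \<Rightarrow> real"
  assumes w: "weight_seq w" and II: "typeII w \<tau>" and Om: "filterlim \<Omega> at_top sequentially"
    and conc: "\<And>\<epsilon>. \<epsilon> > 0 \<Longrightarrow> ((\<lambda>n. measure_pmf.prob (Tn w n)
        {t. \<bar>real (tot (big (\<Omega> n) length) t) - (1 - mu w \<tau>) * real n\<bar> > \<epsilon> * real n}) \<longlongrightarrow> 0) (admF w)"
  shows "limit_tree (xi w \<tau>) (mu w \<tau>) (yhat w \<tau>)"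
    and "cs \<noteq> [] \<Longrightarrow> d > 0 \<Longrightarrow> ((\<lambda>n. measure_pmf.prob (Tn w n)
        {t. windows (\<Omega> n) cs t < ((1 - mu w \<tau>) * prod_list (map (wt (pmf (xi w \<tau>))) cs) - d) * real n}) \<longlongrightarrow> 0) (admF w)"
proof -
  have w0: "w k \<ge> 0" for k using w by (simp add: weight_seq_def)
  have tau: "\<tau> > 0" and rad: "conv_radius w = ereal \<tau>" using II by (auto simp: typeII_def)
  note sm = typeII_mean[OF w II]
  have phi: "phi w \<tau> > 0" using phi_pos[OF w _ sm(1)] tau by simp
  have p: "pmf (xi w \<tau>) = (\<lambda>k. \<tau> ^ k * w k / phi w \<tau>)"
    using pmf_xi[OF w0 _ sm(1) phi] tau by (simp add: fun_eq_iff)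
  have "(\<lambda>k. real k * (w k * \<tau> ^ k) / phi w \<tau>) sums ((\<Sum>k. real k * (w k * \<tau> ^ k)) / phi w \<tau>)"
    by (intro sums_divide summable_sums sm)
  then have mean: "(\<lambda>k. real k * pmf (xi w \<tau>) k) sums ((\<Sum>k. real k * (w k * \<tau> ^ k)) / phi w \<tau>)"
    by (simp add: p mult_ac)
  have mu: "mu w \<tau> = (\<Sum>k. real k * (w k * \<tau> ^ k)) / phi w \<tau>"
    using sums_unique[OF mean] by (simp add: mu_def)
  have m1: "mu w \<tau> < 1" using sm(3) phi by (simp add: mu phi_def)
  show lt: "limit_tree (xi w \<tau>) (mu w \<tau>) (yhat w \<tau>)"
    using mean m1 unfolding mu[symmetric] by (rule limit_tree_xi_yhat)
  interpret limit_tree "xi w \<tau>" "mu w \<tau>" "yhat w \<tau>" by (rule lt)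
  have pos: "pmf (xi w \<tau>) k > 0 \<longleftrightarrow> w k > 0" for k
    using tau phi by (simp add: p zero_less_mult_iff zero_less_divide_iff)
  have wp: "weight_seq (pmf (xi w \<tau>))" using w by (simp only: weight_seq_def pos) auto
  have adm: "admF (pmf (xi w \<tau>)) = admF w" by (simp only: admF_def span_def pos)
  have Tn: "Tn (pmf (xi w \<tau>)) n = Tn w n" for n
    unfolding p using tau phi by (intro Tn_tilt) auto
  have nsum: "\<not> summable (\<lambda>k. pmf (xi w \<tau>) k * r ^ k)" if r: "r > 1" for r
  proof
    assume "summable (\<lambda>k. pmf (xi w \<tau>) k * r ^ k)"
    then have "summable (\<lambda>k. phi w \<tau> * (pmf (xi w \<tau>) k * r ^ k))" by (rule summable_mult)
    also have "(\<lambda>k. phi w \<tau> * (pmf (xi w \<tau>) k * r ^ k)) = (\<lambda>k. w k * (\<tau> * r) ^ k)"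
      using phi by (simp add: p fun_eq_iff power_mult_distrib)
    finally have "ereal (norm (\<tau> * r)) \<le> conv_radius w" by (rule conv_radius_geI)
    then show False using tau r by (simp add: rad)
  qed
  have low: "\<exists>b>0. eventually (\<lambda>n. Zn (pmf (xi w \<tau>)) n \<ge> b * exp (- (e * real n))) (admF w)" if e: "e > 0" for e
  proof -
    obtain n0 where "n0 \<ge> 1" "Zn (pmf (xi w \<tau>)) (Suc n0) \<ge> pmf (xi w \<tau>) 0 * exp (- (e * real n0))"
      using Zn_not_exp_small[OF _ nsum e] wp by (auto simp: weight_seq_def)
    then show ?thesis using Zn_exp_lower[OF wp] e unfolding adm by simp
  qed
  assume "cs \<noteq> []" "d > 0"
  then show "((\<lambda>n. measure_pmf.prob (Tn w n)
        {t. windows (\<Omega> n) cs t < ((1 - mu w \<tau>) * prod_list (map gwt cs) - d) * real n}) \<longlongrightarrow> 0) (admF w)"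
    using windows_prob_tendsto[OF _ Om low, of cs d] conc by (simp add: Tn admF_def)
qed

lemma typeIII_windows:
  fixes \<Omega> :: "nat \<Rightarrow> real"
  assumes w: "weight_seq w" and Om: "filterlim \<Omega> at_top sequentially"
    and conc: "\<And>\<epsilon>. \<epsilon> > 0 \<Longrightarrow> ((\<lambda>n. measure_pmf.prob (Tn w n)
        {t. \<bar>real (tot (big (\<Omega> n) length) t) - (1 - mu w 0) * real n\<bar> > \<epsilon> * real n}) \<longlongrightarrow> 0) (admF w)"
  shows "limit_tree (xi w 0) (mu w 0) (yhat w 0)"
    and "cs \<noteq> [] \<Longrightarrow> d > 0 \<Longrightarrow> ((\<lambda>n. measure_pmf.prob (Tn w n)
        {t. windows (\<Omega> n) cs t < ((1 - mu w 0) * prod_list (map (wt (pmf (xi w 0))) cs) - d) * real n}) \<longlongrightarrow> 0) (admF w)"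
proof -
  have w0: "w k \<ge> 0" for k using w by (simp add: weight_seq_def)
  have s: "summable (\<lambda>k. w k * 0 ^ k)" by (rule summable_finite[of "{0}"]) (auto simp: power_0_left)
  have phi: "phi w 0 > 0" by (rule phi_pos[OF w _ s]) simp
  have phi0: "phi w 0 = w 0" unfolding phi_def by (rule powser_zero)
  have p: "pmf (xi w 0) k = (if k = 0 then 1 else 0)" for k
    using pmf_xi[OF w0 _ s phi] phi by (simp add: phi0)
  have kp: "(\<lambda>k. real k * pmf (xi w 0) k) = (\<lambda>_. 0)" by (simp add: p fun_eq_iff)
  have mu: "mu w 0 = 0" unfolding mu_def kp by simp
  show "limit_tree (xi w 0) (mu w 0) (yhat w 0)"
    by (rule limit_tree_xi_yhat) (simp_all add: kp mu)
  assume cs: "cs \<noteq> []" and d: "d > 0"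
  have leaf: "wt (pmf (xi w 0)) c = (if c = Node [] then 1 else 0)" for c
    by (cases c) (auto simp: p)
  show "((\<lambda>n. measure_pmf.prob (Tn w n)
        {t. windows (\<Omega> n) cs t < ((1 - mu w 0) * prod_list (map (wt (pmf (xi w 0))) cs) - d) * real n}) \<longlongrightarrow> 0) (admF w)"
  proof (cases "\<forall>c\<in>set cs. c = Node []")
    case True
    then have "cs = replicate (length cs) (Node [])" by (simp add: replicate_length_same)
    then obtain N where N: "cs = replicate N (Node [])" by blast
    have q: "prod_list (map (wt (pmf (xi w 0))) cs) = 1" by (simp add: N p)
    show ?thesis unfolding q
      using windows_leaves_prob_tendsto[OF w0 _ Om Zn_pos_eventually[OF w] _ d, of N] conc
      by (simp add: N mu admF_def)
  next
    case False
    then have q: "prod_list (map (wt (pmf (xi w 0))) cs) = 0"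
      by (auto simp: prod_list_zero_iff leaf image_iff)
    have "{t. windows (\<Omega> n) cs t < ((1 - mu w 0) * 0 - d) * real n} = {}" for n
      using windows_nonneg[of "\<Omega> n" cs] d by (auto simp: not_less intro: order_trans[of _ 0])
    then show ?thesis unfolding q by (simp only: measure_empty tendsto_const)
  qed
qed

theorem theorem5p6:
  fixes w :: "nat \<Rightarrow> real" and \<tau> :: real and \<Omega> :: "nat \<Rightarrow> real"
  assumes wseq: "weight_seq w"
    and wtype: "typeII w \<tau> \<or> (typeIII w \<and> \<tau> = 0)"
    and Om_inf: "filterlim \<Omega> at_top sequentially"
    and Om_small: "((\<lambda>n. \<Omega> n / real n) \<longlongrightarrow> 0) sequentially"
    and Om_prop: "\<And>K :: nat \<Rightarrow> real. filterlim K at_top sequentially \<Longrightarrow> (\<forall>n. K n \<le> \<Omega> n) \<Longrightarrow>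
        (\<forall>\<epsilon>>0. ((\<lambda>n. measure_pmf.prob (Tn w n)
             {t. \<bar>(\<Sum>k\<in>{k. real k \<le> K n}. real k * Nk t k) - mu w \<tau> * real n\<bar> > \<epsilon> * real n})
           \<longlongrightarrow> 0) (admF w)) \<and>
        (\<forall>\<epsilon>>0. ((\<lambda>n. measure_pmf.prob (Tn w n)
             {t. \<bar>(\<Sum>k. if real k > K n then real k * Nk t k else 0) - (1 - mu w \<tau>) * real n\<bar> > \<epsilon> * real n})
           \<longlongrightarrow> 0) (admF w))"
  shows "\<forall>(f :: (uvert \<Rightarrow> tval) \<Rightarrow> real) (c :: real).
           continuous_on TS f \<and> bounded (f ` TS) \<longrightarrow>
           ((\<lambda>n. measure_pmf.expectation (pointedTn w n)
                   (\<lambda>(t, p). case Hfr t p (\<Omega> n) of None \<Rightarrow> c | Some x \<Rightarrow> f x))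
             \<longlongrightarrow> (\<integral>\<omega>. f (Tstarbar \<omega>) \<partial>(Tstar_space w \<tau>))) (admF w)"
proof (intro allI impI)
  fix f :: "(uvert \<Rightarrow> tval) \<Rightarrow> real" and c :: real
  assume f: "continuous_on TS f \<and> bounded (f ` TS)"
  have w0: "w k \<ge> 0" for k using wseq by (simp add: weight_seq_def)
  have conc: "((\<lambda>n. measure_pmf.prob (Tn w n)
      {t. \<bar>real (tot (big (\<Omega> n) length) t) - (1 - mu w \<tau>) * real n\<bar> > \<epsilon> * real n}) \<longlongrightarrow> 0) (admF w)"
    if "\<epsilon> > 0" for \<epsilon>
    using Om_prop[OF Om_inf] that by (simp add: suminf_big_degrees)
  have lt: "limit_tree (xi w \<tau>) (mu w \<tau>) (yhat w \<tau>)"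
    using wtype typeII_windows(1)[OF wseq _ Om_inf conc] typeIII_windows(1)[OF wseq Om_inf] conc by blast
  have win: "((\<lambda>n. measure_pmf.prob (Tn w n) {t. windows (\<Omega> n) cs t <
      ((1 - mu w \<tau>) * prod_list (map (wt (pmf (xi w \<tau>))) cs) - d) * real n}) \<longlongrightarrow> 0) (admF w)"
    if "cs \<noteq> []" "d > 0" for cs d
    using wtype
  proof
    assume "typeII w \<tau>"
    then show ?thesis using conc that by (intro typeII_windows(2)[OF wseq _ Om_inf]) auto
  next
    assume "typeIII w \<and> \<tau> = 0"
    then show ?thesis using conc that typeIII_windows(2)[OF wseq Om_inf, of cs d] by simp
  qed
  have supp: "eventually (\<lambda>n. set_pmf (Tn w n) \<subseteq> {t. nv t = n}) (admF w)"
    using Zn_pos_eventually[OF wseq] by eventually_elim (rule set_pmf_Tn[OF w0])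
  have Om: "filterlim \<Omega> at_top (admF w)"
    using Om_inf by (rule filterlim_mono) (simp_all add: admF_def)
  show "((\<lambda>n. measure_pmf.expectation (pointedTn w n)
                   (\<lambda>(t, p). case Hfr t p (\<Omega> n) of None \<Rightarrow> c | Some x \<Rightarrow> f x))
             \<longlongrightarrow> (\<integral>\<omega>. f (Tstarbar \<omega>) \<partial>(Tstar_space w \<tau>))) (admF w)"
    using limit_tree.expectation_pointedTn_tendsto[OF lt win supp Om] f
    by (simp add: limit_tree.M_def[OF lt] Tstar_space_def)
qed

end
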